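(* For ${\rm APP}=\{{\rm APP}_d\}_{d\in\mathbb N}$ in the average case setting with the absolute error criterion and for fixed $s,t>0$, ${\rm APP}$ is ALG-$(s,t)$-WT for $\Lambda^{\rm all}$ if and only if it is ALG-$(s,t)$-WT for $\Lambda^{\rm std}$.
   Context: Setting (average case approximation). For each $d\in\mathbb N$: $D_d\subset\mathbb R^d$ is a Borel set of positive Lebesgue measure, $\rho_d$ is a probability density on $D_d$, and $G_d=L_2(D_d,\rho_d(x)\,dx)$. $F_d$ is a separable Banach space of real-valued functions on $D_d$, continuously embedded in $G_d$, such that every point evaluation $f\mapsto f(x)$, $x\in D_d$, is a continuous linear functional on $F_d$; $F_d$ carries a zero-mean Gaussian measure $\mu_d$. ${\rm APP}_d:F_d\to G_d$, ${\rm APP}_d f=f$. $\Lambda^{\rm all}$ is the class of all continuous linear functionals on $F_d$, $\Lambda^{\rm std}$ the class of point evaluations. For $\Lambda\in\{\Lambda^{\rm all},\Lambda^{\rm std}\}$, an algorithm is $A_{n,d}f=\phi_{n,d}(L_1(f),\dots,L_n(f))$ with $L_i\in\Lambda$ and $\phi_{n,d}:\mathbb R^n\to G_d$ measurable; its average case error is $e^{\rm avg}(A_{n,d})=\big(\int_{F_d}\|f-A_{n,d}f\|_{G_d}^2\,\mu_d(df)\big)^{1/2}$, and $e^{\rm avg}(n,d;\Lambda)$ is the infimum of $e^{\rm avg}(A_{n,d})$ over all such algorithms using $n$ functionals from $\Lambda$ (for $n=0$, $A_{0,d}=0$). Absolute-error information complexity: $n^{\rm ABS}(\varepsilon,d;\Lambda)=\min\{n\ge0:\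 e^{\rm avg}(n,d;\Lambda)\le\varepsilon\}$. ALG-$(s,t)$-WT for $\Lambda$: $\lim_{\varepsilon^{-1}+d\to\infty}\frac{\ln n^{\rm ABS}(\varepsilon,d;\Lambda)}{\varepsilon^{-s}+d^{t}}=0$, where the limit means: for every $\eta>0$ there is $M$ such that the quotient is $<\eta$ for all $d\in\mathbb N$, $\varepsilon\in(0,1)$ with $\varepsilon^{-1}+d>M$. *)

theory Defs
  imports "HOL-Probability.Probability"
begin

definition Rd :: "nat \<Rightarrow> (nat \<Rightarrow> real) measure" where
  "Rd d = PiM {..<d} (\<lambda>_. lborel)"

definition G_normsq ::
  "nat \<Rightarrow> (nat \<Rightarrow> (nat \<Rightarrow> real) set) \<Rightarrow> (nat \<Rightarrow> (nat \<Rightarrow> real) \<Rightarrow> real)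
   \<Rightarrow> ((nat \<Rightarrow> real) \<Rightarrow> real) \<Rightarrow> ennreal" where
  "G_normsq d D \<rho> g = (\<integral>\<^sup>+ x\<in>D d. ennreal ((g x)\<^sup>2 * \<rho> d x) \<partial>Rd d)"

definition centered_gaussian_real :: "real measure \<Rightarrow> bool" where
  "centered_gaussian_real N \<longleftrightarrow>
     N = return borel 0 \<or> (\<exists>\<sigma>>0. N = density lborel (normal_density 0 \<sigma>))"

text \<open>Zero-mean Gaussian (Borel probability) measure on the Banach space
  F = V (a closed subspace of the ambient space 'f), concentrated on V:
  every continuous linear functional is centered-Gaussian distributed.\<close>
definition gaussian_measure :: "'f::real_normed_vector measure \<Rightarrow> 'f set \<Rightarrow> bool" where
  "gaussian_measure \<mu> V \<longleftrightarrow>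
     prob_space \<mu> \<and> sets \<mu> = sets borel \<and> emeasure \<mu> V = 1 \<and>
     (\<forall>L::'f \<Rightarrow> real. bounded_linear L \<longrightarrow> centered_gaussian_real (distr \<mu> borel L))"

text \<open>The standing assumptions of the average case approximation setting, for all d >= 1.
  F_d is the closed subspace V d of a separable Banach space 'f; the element f of F_d
  is the function (evl d f) on D_d.\<close>
definition avg_app_setting ::
  "(nat \<Rightarrow> (nat \<Rightarrow> real) set) \<Rightarrow> (nat \<Rightarrow> (nat \<Rightarrow> real) \<Rightarrow> real) \<Rightarrow> (nat \<Rightarrow> 'f::banach set)
   \<Rightarrow> (nat \<Rightarrow> 'f \<Rightarrow> (nat \<Rightarrow> real) \<Rightarrow> real) \<Rightarrow> (nat \<Rightarrow> 'f measure) \<Rightarrow> bool" where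
  "avg_app_setting D \<rho> V evl \<mu> \<longleftrightarrow> (\<forall>d\<ge>1.
     D d \<in> sets (Rd d) \<and> emeasure (Rd d) (D d) > 0 \<and>
     \<rho> d \<in> borel_measurable (Rd d) \<and> (\<forall>x\<in>D d. \<rho> d x \<ge> 0) \<and>
     (\<integral>\<^sup>+ x\<in>D d. ennreal (\<rho> d x) \<partial>Rd d) = 1 \<and>
     subspace (V d) \<and> closed (V d) \<and>
     (\<forall>x\<in>D d. bounded_linear (\<lambda>f. evl d f x)) \<and>
     (\<forall>f\<in>V d. \<forall>g\<in>V d. (\<forall>x\<in>D d. evl d f x = evl d g x) \<longrightarrow> f = g) \<and>
     (\<forall>f\<in>V d. evl d f \<in> borel_measurable (restrict_space (Rd d) (D d))) \<and>
     (\<exists>C. \<forall>f\<in>V d. G_normsq d D \<rho> (evl d f) \<le> ennreal (C * (norm f)\<^sup>2)) \<and>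
     gaussian_measure (\<mu> d) (V d))"

definition Lambda_all :: "nat \<Rightarrow> ('f::real_normed_vector \<Rightarrow> real) \<Rightarrow> bool" where
  "Lambda_all d L \<longleftrightarrow> bounded_linear L"

definition Lambda_std ::
  "(nat \<Rightarrow> (nat \<Rightarrow> real) set) \<Rightarrow> (nat \<Rightarrow> 'f \<Rightarrow> (nat \<Rightarrow> real) \<Rightarrow> real)
   \<Rightarrow> nat \<Rightarrow> ('f \<Rightarrow> real) \<Rightarrow> bool" where
  "Lambda_std D evl d L \<longleftrightarrow> (\<exists>x\<in>D d. L = (\<lambda>f. evl d f x))"

definition alg_err2 ::
  "(nat \<Rightarrow> (nat \<Rightarrow> real) set) \<Rightarrow> (nat \<Rightarrow> (nat \<Rightarrow> real) \<Rightarrow> real)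
   \<Rightarrow> (nat \<Rightarrow> 'f \<Rightarrow> (nat \<Rightarrow> real) \<Rightarrow> real) \<Rightarrow> (nat \<Rightarrow> 'f measure)
   \<Rightarrow> nat \<Rightarrow> nat \<Rightarrow> (nat \<Rightarrow> 'f \<Rightarrow> real) \<Rightarrow> ((nat \<Rightarrow> real) \<Rightarrow> (nat \<Rightarrow> real) \<Rightarrow> real) \<Rightarrow> ennreal" where
  "alg_err2 D \<rho> evl \<mu> d n L \<phi> =
     (\<integral>\<^sup>+ f. G_normsq d D \<rho> (\<lambda>x. evl d f x - \<phi> (restrict (\<lambda>i. L i f) {..<n}) x) \<partial>\<mu> d)"

text \<open>Admissible algorithms using n functionals from Lambda: phi : R^n -> G_d measurable
  (rendered as joint measurability of (y,x) |-> phi y x, with phi y in L_2).\<close>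
definition admissible_alg ::
  "(nat \<Rightarrow> (nat \<Rightarrow> real) set) \<Rightarrow> (nat \<Rightarrow> (nat \<Rightarrow> real) \<Rightarrow> real)
   \<Rightarrow> (nat \<Rightarrow> ('f \<Rightarrow> real) \<Rightarrow> bool) \<Rightarrow> nat \<Rightarrow> nat
   \<Rightarrow> (nat \<Rightarrow> 'f \<Rightarrow> real) \<Rightarrow> ((nat \<Rightarrow> real) \<Rightarrow> (nat \<Rightarrow> real) \<Rightarrow> real) \<Rightarrow> bool" where
  "admissible_alg D \<rho> \<Lambda> d n L \<phi> \<longleftrightarrow>
     (\<forall>i<n. \<Lambda> d (L i)) \<and>
     (\<lambda>(y, x). \<phi> y x) \<in> borel_measurable
        (PiM {..<n} (\<lambda>_. borel) \<Otimes>\<^sub>M restrict_space (Rd d) (D d)) \<and>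
     (\<forall>y\<in>space (PiM {..<n} (\<lambda>_. (borel::real measure))). G_normsq d D \<rho> (\<phi> y) < \<infinity>)"

definition min_err2 ::
  "(nat \<Rightarrow> (nat \<Rightarrow> real) set) \<Rightarrow> (nat \<Rightarrow> (nat \<Rightarrow> real) \<Rightarrow> real)
   \<Rightarrow> (nat \<Rightarrow> 'f \<Rightarrow> (nat \<Rightarrow> real) \<Rightarrow> real) \<Rightarrow> (nat \<Rightarrow> 'f measure)
   \<Rightarrow> (nat \<Rightarrow> ('f \<Rightarrow> real) \<Rightarrow> bool) \<Rightarrow> nat \<Rightarrow> nat \<Rightarrow> ennreal" where
  "min_err2 D \<rho> evl \<mu> \<Lambda> n d =
     (if n = 0 then alg_err2 D \<rho> evl \<mu> d 0 (\<lambda>_ _. 0) (\<lambda>_ _. 0)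
      else (INF (L, \<phi>) \<in> {(L, \<phi>). admissible_alg D \<rho> \<Lambda> d n L \<phi>}. alg_err2 D \<rho> evl \<mu> d n L \<phi>))"

definition n_abs ::
  "(nat \<Rightarrow> (nat \<Rightarrow> real) set) \<Rightarrow> (nat \<Rightarrow> (nat \<Rightarrow> real) \<Rightarrow> real)
   \<Rightarrow> (nat \<Rightarrow> 'f \<Rightarrow> (nat \<Rightarrow> real) \<Rightarrow> real) \<Rightarrow> (nat \<Rightarrow> 'f measure)
   \<Rightarrow> (nat \<Rightarrow> ('f \<Rightarrow> real) \<Rightarrow> bool) \<Rightarrow> real \<Rightarrow> nat \<Rightarrow> nat" where
  "n_abs D \<rho> evl \<mu> \<Lambda> \<epsilon> d = (LEAST n. min_err2 D \<rho> evl \<mu> \<Lambda> n d \<le> ennreal (\<epsilon>\<^sup>2))"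

text \<open>ALG-(s,t)-WT; ln 0 is read as contributing 0 (convention ln max(1,n)).\<close>
definition ALG_WT :: "real \<Rightarrow> real \<Rightarrow> (real \<Rightarrow> nat \<Rightarrow> nat) \<Rightarrow> bool" where
  "ALG_WT s t N \<longleftrightarrow>
     (\<forall>\<eta>>0. \<exists>M. \<forall>d::nat. \<forall>\<epsilon>::real. d \<ge> 1 \<and> 0 < \<epsilon> \<and> \<epsilon> < 1 \<and> 1 / \<epsilon> + real d > M \<longrightarrow>
        ln (max 1 (real (N \<epsilon> d))) / (\<epsilon> powr (-s) + real d powr t) < \<eta>)"

end

theory Submission
  imports Defs
begin

text \<open>Standard information is at most polynomially weaker than arbitrary linear information:
  if \<open>n\<close> functionals achieve squared error \<open>\<delta>\<close>, then at most \<open>8 n\<^sup>2\<close> samples achieve \<open>20 \<delta>\<close>, which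
  is harmless for the logarithm of the complexity.

  Since the measure is Gaussian, the algorithm may be taken linear, \<open>f \<approx> \<Sum> \<beta>\<^sub>p(f) a\<^sub>p\<close>, with residual \<open>g\<close>.
  Let \<open>u\<^sub>1, \<dots>, u\<^sub>k\<close> be an orthonormal basis of the span of the \<open>a\<^sub>p\<close>. Weighted least squares in this
  span reproduces it exactly, so only \<open>g\<close> contributes to the error, provided that the weighted
  empirical Gram matrix is within \<open>1/2\<close> of the identity and the weighted empirical
  mean of \<open>E g(x)\<^sup>2\<close> is at most twice its integral. For the weight \<open>k / \<Sum> u\<^sub>i(x)\<^sup>2\<close> such points are
  chosen one at a time, each step controlling the sum of both deviations by its average.\<close>

section \<open>Orthonormal systems of square integrable functions\<close>

text \<open>The information complexity is a \<open>LEAST\<close>, which carries information only if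
  some number of samples reaches the required accuracy. Hence consistency of sampling has to be
  proved on its own, although it contributes nothing to the quantitative bound.

  Consistency and the choice of linear coefficients both need the mean squared \<open>L_2\<close>
  norm of a random path to be finite. The embedding yields only finiteness path by path; the moment
  identities of Gaussian variables upgrade this to a finite mean.

  Linearity is obtained separately at every point \<open>x\<close>: the residual of the best linear
  prediction of \<open>f x\<close> is uncorrelated with the data, and for jointly Gaussian variables
  this makes it orthogonal to every square integrable function of the data. Fubini then compares the
  integrated errors.

  Functions are kept as functions, not as classes modulo null sets, since samples are point values.
  Identities that hold only almost everywhere must therefore be secured at the chosen points; this
  is the role of the predicate \<open>Q\<close> in the sampling lemmas.\<close>

definition sq_int :: "'a measure \<Rightarrow> ('a \<Rightarrow> real) \<Rightarrow> bool" where
  "sq_int M f \<longleftrightarrow> f \<in> borel_measurable M \<and> integrable M (\<lambda>x. (f x)\<^sup>2)"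

lemma sq_int_measurable [measurable_dest]: "sq_int M f \<Longrightarrow> f \<in> borel_measurable M"
  and sq_int_square: "sq_int M f \<Longrightarrow> integrable M (\<lambda>x. (f x)\<^sup>2)"
  by (auto simp: sq_int_def)

lemma sq_int_mult_integrable:
  assumes "sq_int M f" "sq_int M g"
  shows "integrable M (\<lambda>x. f x * g x)"
proof (rule Bochner_Integration.integrable_bound)
  show "integrable M (\<lambda>x. (f x)\<^sup>2 + (g x)\<^sup>2)"
    using assms by (auto simp: sq_int_def)
  show "(\<lambda>x. f x * g x) \<in> borel_measurable M"
    using assms by (auto simp: sq_int_def)
  show "AE x in M. norm (f x * g x) \<le> norm ((f x)\<^sup>2 + (g x)\<^sup>2)"
  proof (intro AE_I2)
    fix x
    have "0 \<le> (\<bar>f x\<bar> - \<bar>g x\<bar>)\<^sup>2" "0 \<le> \<bar>f x\<bar> * \<bar>g x\<bar>" by auto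
    then have "\<bar>f x\<bar> * \<bar>g x\<bar> \<le> (f x)\<^sup>2 + (g x)\<^sup>2"
      unfolding power2_diff power2_abs by linarith
    then show "norm (f x * g x) \<le> norm ((f x)\<^sup>2 + (g x)\<^sup>2)"
      by (simp add: abs_mult)
  qed
qed

lemma sq_int_add:
  assumes "sq_int M f" "sq_int M g"
  shows "sq_int M (\<lambda>x. f x + g x)"
proof -
  have "integrable M (\<lambda>x. (f x)\<^sup>2 + (g x)\<^sup>2 + 2 * (f x * g x))"
    using assms sq_int_mult_integrable[OF assms] by (auto simp: sq_int_def)
  then show ?thesis
    using assms by (auto simp: sq_int_def power2_sum mult.assoc)
qed

lemma sq_int_cmult: "sq_int M f \<Longrightarrow> sq_int M (\<lambda>x. c * f x)"
  by (auto simp: sq_int_def power_mult_distrib)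

lemma sq_int_zero: "sq_int M (\<lambda>x. 0)"
  by (auto simp: sq_int_def)

lemma sq_int_diff:
  assumes "sq_int M f" "sq_int M g"
  shows "sq_int M (\<lambda>x. f x - g x)"
  using sq_int_add[OF assms(1) sq_int_cmult[OF assms(2), of "-1"]] by simp

lemma sq_int_sum:
  "(\<And>i. i \<in> I \<Longrightarrow> sq_int M (f i)) \<Longrightarrow> sq_int M (\<lambda>x. \<Sum>i\<in>I. f i x)"
  by (induction I rule: infinite_finite_induct) (auto intro: sq_int_add sq_int_zero)

lemma sq_int_lincomb:
  "(\<And>i. i \<in> I \<Longrightarrow> sq_int M (f i)) \<Longrightarrow> sq_int M (\<lambda>x. \<Sum>i\<in>I. c i * f i x)"
  by (intro sq_int_sum sq_int_cmult)

lemma integral_lincomb_mult: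
  assumes "\<And>i. i \<in> I \<Longrightarrow> sq_int M (f i)" "sq_int M g"
  shows "(\<integral>x. (\<Sum>i\<in>I. c i * f i x) * g x \<partial>M) = (\<Sum>i\<in>I. c i * (\<integral>x. f i x * g x \<partial>M))"
proof -
  have "(\<integral>x. (\<Sum>i\<in>I. c i * f i x) * g x \<partial>M) = (\<integral>x. (\<Sum>i\<in>I. c i * (f i x * g x)) \<partial>M)"
    by (simp add: sum_distrib_right mult.assoc)
  also have "\<dots> = (\<Sum>i\<in>I. c i * (\<integral>x. f i x * g x \<partial>M))"
    by (subst Bochner_Integration.integral_sum)
       (auto intro!: sq_int_mult_integrable assms)
  finally show ?thesis .
qed

lemma sum_kronecker:
  fixes f :: "nat \<Rightarrow> real"
  assumes "q < k"
  shows "(\<Sum>p<k. f p * (if p = q then 1 else 0)) = f q"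
proof -
  have "(\<Sum>p<k. f p * (if p = q then 1 else 0)) = (\<Sum>p<k. if p = q then f p else 0)"
    by (intro sum.cong) auto
  then show ?thesis using assms by simp
qed

lemma sq_int_AE_zero:
  assumes "sq_int M r" "(\<integral>x. r x * r x \<partial>M) = 0"
  shows "AE x in M. r x = 0"
proof -
  have "integrable M (\<lambda>x. (r x)\<^sup>2)" using assms by (auto simp: sq_int_def)
  moreover have "(\<integral>x. (r x)\<^sup>2 \<partial>M) = 0" using assms by (simp add: power2_eq_square)
  ultimately have "AE x in M. (r x)\<^sup>2 = 0"
    by (subst (asm) integral_nonneg_eq_0_iff_AE) auto
  then show ?thesis by auto
qed

lemma lincomb_closed:
  fixes a :: "nat \<Rightarrow> 'x \<Rightarrow> real"
  assumes "\<And>p. p < k \<Longrightarrow> \<exists>c. v p = (\<lambda>x. \<Sum>i<n. c i * a i x)"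
  shows "\<exists>c. (\<lambda>x. \<Sum>p<k. d p * v p x) = (\<lambda>x. \<Sum>i<n. c i * a i x)"
proof -
  obtain C where C: "\<And>p. p < k \<Longrightarrow> v p = (\<lambda>x. \<Sum>i<n. C p i * a i x)"
    using assms by metis
  have "(\<Sum>p<k. d p * v p x) = (\<Sum>i<n. (\<Sum>p<k. d p * C p i) * a i x)" for x
  proof -
    have "(\<Sum>p<k. d p * v p x) = (\<Sum>p<k. \<Sum>i<n. d p * C p i * a i x)"
      by (intro sum.cong refl) (simp add: C sum_distrib_left mult.assoc)
    also have "\<dots> = (\<Sum>i<n. (\<Sum>p<k. d p * C p i) * a i x)"
      by (subst sum.swap) (simp add: sum_distrib_right)
    finally show ?thesis .
  qed
  then show ?thesis by (intro exI[of _ "\<lambda>i. \<Sum>p<k. d p * C p i"]) auto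
qed

text \<open>The two directions of the change of basis differ on purpose. Each \<open>v p\<close> is
  a combination of the \<open>a i\<close> at every point, so it inherits bounded linearity when the
  \<open>a i\<close> are functionals. Each \<open>a i\<close> is recovered only almost everywhere,
  since linearly dependent inputs are dropped on the strength of a zero norm.\<close>

lemma gram_schmidt_L2:
  fixes a :: "nat \<Rightarrow> 'x \<Rightarrow> real"
  assumes "\<And>i. i < n \<Longrightarrow> sq_int N (a i)"
  shows "\<exists>k\<le>n. \<exists>v. (\<forall>p<k. \<exists>c. v p = (\<lambda>x. \<Sum>i<n. c i * a i x)) \<and>
    (\<forall>p<k. \<forall>q<k. (\<integral>x. v p x * v q x \<partial>N) = (if p = q then 1 else 0)) \<and>
    (\<forall>i<n. AE x in N. a i x = (\<Sum>p<k. (\<integral>x. a i x * v p x \<partial>N) * v p x))"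
  using assms
proof (induction n)
  case 0
  then show ?case by auto
next
  case (Suc n)
  have "\<And>i. i < n \<Longrightarrow> sq_int N (a i)" using Suc.prems by auto
  from Suc.IH[OF this] obtain k v where k: "k \<le> n"
    and lin: "\<And>p. p < k \<Longrightarrow> \<exists>c. v p = (\<lambda>x. \<Sum>i<n. c i * a i x)"
    and on: "\<And>p q. p < k \<Longrightarrow> q < k \<Longrightarrow> (\<integral>x. v p x * v q x \<partial>N) = (if p = q then 1 else 0)"
    and ex: "\<And>i. i < n \<Longrightarrow> AE x in N. a i x = (\<Sum>p<k. (\<integral>x. a i x * v p x \<partial>N) * v p x)"
    by blast
  have sqa: "\<And>i. i < Suc n \<Longrightarrow> sq_int N (a i)" by fact
  have sqv: "sq_int N (v p)" if "p < k" for p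
  proof -
    from lin[OF that] obtain c where c: "v p = (\<lambda>x. \<Sum>i<n. c i * a i x)" by blast
    show ?thesis unfolding c by (intro sq_int_lincomb sqa) auto
  qed
  have ext: "\<exists>c. g = (\<lambda>x. \<Sum>i<Suc n. c i * a i x)"
    if "\<exists>c. g = (\<lambda>x. \<Sum>i<n. c i * a i x)" for g
  proof -
    from that obtain c where c: "g = (\<lambda>x. \<Sum>i<n. c i * a i x)" by auto
    show ?thesis
      by (rule exI[of _ "c(n := 0)"]) (auto simp: c intro!: sum.cong)
  qed
  define e where "e p = (\<integral>x. a n x * v p x \<partial>N)" for p
  define r where "r x = a n x - (\<Sum>p<k. e p * v p x)" for x
  have sqs: "sq_int N (\<lambda>x. \<Sum>p<k. e p * v p x)"
    by (intro sq_int_lincomb) (auto intro: sqv)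
  have sqr: "sq_int N r"
    unfolding r_def by (intro sq_int_diff sqs sqa) auto
  have rv: "(\<integral>x. r x * v q x \<partial>N) = 0" if "q < k" for q
  proof -
    have "(\<integral>x. r x * v q x \<partial>N) = (\<integral>x. a n x * v q x - (\<Sum>p<k. e p * v p x) * v q x \<partial>N)"
      by (simp add: r_def algebra_simps)
    also have "\<dots> = e q - (\<integral>x. (\<Sum>p<k. e p * v p x) * v q x \<partial>N)"
      unfolding e_def[of q]
      by (intro Bochner_Integration.integral_diff sq_int_mult_integrable sqs sqa sqv that) auto
    also have "(\<integral>x. (\<Sum>p<k. e p * v p x) * v q x \<partial>N) = (\<Sum>p<k. e p * (\<integral>x. v p x * v q x \<partial>N))"
      using sqv that by (intro integral_lincomb_mult) auto
    also have "\<dots> = (\<Sum>p<k. e p * (if p = q then 1 else 0))"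
      using that by (intro sum.cong) (auto simp: on)
    also have "\<dots> = e q" by (rule sum_kronecker[OF that])
    finally show ?thesis by simp
  qed
  \<comment> \<open>The squared norm of the residual. If it is zero, the old system already
    represents \<open>a n\<close> almost everywhere; otherwise the normalised residual is
    appended.\<close>
  define s where "s = (\<integral>x. r x * r x \<partial>N)"
  show ?case
  proof (cases "s = 0")
    case True
    have "AE x in N. r x = 0"
      by (rule sq_int_AE_zero[OF sqr]) (use True s_def in auto)
    then have "AE x in N. a n x = (\<Sum>p<k. (\<integral>x. a n x * v p x \<partial>N) * v p x)"
      unfolding e_def[symmetric] r_def by auto
    then have "\<forall>i<Suc n. AE x in N. a i x = (\<Sum>p<k. (\<integral>x. a i x * v p x \<partial>N) * v p x)"
      using ex less_Suc_eq by auto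
    then show ?thesis using k on lin ext
      by (intro exI[of _ k] conjI exI[of _ v]) auto
  next
    case False
    have "s \<ge> 0" unfolding s_def by (intro integral_nonneg_AE) auto
    with False have s: "s > 0" by auto
    define vk where "vk x = (1 / sqrt s) * r x" for x
    define v' where "v' = v(k := vk)"
    have sqvk: "sq_int N vk" unfolding vk_def by (intro sq_int_cmult sqr)
    have vkv: "(\<integral>x. vk x * v q x \<partial>N) = 0" if "q < k" for q
    proof -
      have "(\<integral>x. vk x * v q x \<partial>N) = (\<integral>x. (1 / sqrt s) * (r x * v q x) \<partial>N)"
        by (simp add: vk_def mult.assoc)
      also have "\<dots> = (1 / sqrt s) * (\<integral>x. r x * v q x \<partial>N)" by (rule integral_mult_right_zero)
      finally show ?thesis using rv[OF that] by simp
    qed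
    have vvk: "(\<integral>x. v q x * vk x \<partial>N) = 0" if "q < k" for q
      using vkv[OF that] by (simp add: mult.commute)
    have vkvk: "(\<integral>x. vk x * vk x \<partial>N) = 1"
    proof -
      have "(\<integral>x. vk x * vk x \<partial>N) = (\<integral>x. (1 / s) * (r x * r x) \<partial>N)"
        using s by (simp add: vk_def field_simps)
      also have "\<dots> = (1 / s) * s" unfolding s_def by (rule integral_mult_right_zero)
      finally show ?thesis using s by simp
    qed
    have decomp: "a n x = (\<Sum>p<k. e p * v p x) + sqrt s * vk x" for x
      using s by (simp add: vk_def r_def)
    have orth: "(\<integral>x. (\<Sum>p<k. f p * v p x) * vk x \<partial>N) = 0" for f
      by (subst integral_lincomb_mult) (auto simp: sqv sqvk vvk)
    have ank: "(\<integral>x. a n x * vk x \<partial>N) = sqrt s"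
    proof -
      have "(\<integral>x. a n x * vk x \<partial>N) = (\<integral>x. (\<Sum>p<k. e p * v p x) * vk x + sqrt s * (vk x * vk x) \<partial>N)"
        by (simp add: decomp algebra_simps)
      also have "\<dots> = (\<integral>x. (\<Sum>p<k. e p * v p x) * vk x \<partial>N) + (\<integral>x. sqrt s * (vk x * vk x) \<partial>N)"
        by (intro Bochner_Integration.integral_add sq_int_mult_integrable integrable_mult_right sqs sqvk)
      finally show ?thesis by (simp add: orth vkvk)
    qed
    have aik: "(\<integral>x. a i x * vk x \<partial>N) = 0" if "i < n" for i
    proof -
      have "(\<integral>x. a i x * vk x \<partial>N) = (\<integral>x. (\<Sum>p<k. (\<integral>x. a i x * v p x \<partial>N) * v p x) * vk x \<partial>N)"
      proof (rule integral_cong_AE)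
        show "(\<lambda>x. a i x * vk x) \<in> borel_measurable N"
          using sqa[of i] sqvk that by (auto simp: sq_int_def)
        show "(\<lambda>x. (\<Sum>p<k. (\<integral>x. a i x * v p x \<partial>N) * v p x) * vk x) \<in> borel_measurable N"
          by (intro borel_measurable_integrable sq_int_mult_integrable sq_int_lincomb sqvk) (auto intro: sqv)
        show "AE x in N. a i x * vk x = (\<Sum>p<k. (\<integral>x. a i x * v p x \<partial>N) * v p x) * vk x"
          using ex[OF that] by eventually_elim (rule arg_cong[where f="\<lambda>t. t * _"])
      qed
      then show ?thesis by (simp add: orth)
    qed
    have lin': "\<exists>c. v' p = (\<lambda>x. \<Sum>i<Suc n. c i * a i x)" if "p < Suc k" for p
    proof (cases "p < k")
      case True
      then show ?thesis unfolding v'_def using ext lin by auto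
    next
      case False
      with that have [simp]: "p = k" by auto
      obtain c where c: "(\<lambda>x. \<Sum>p<k. e p * v p x) = (\<lambda>x. \<Sum>i<n. c i * a i x)"
        using lincomb_closed[of k v a n e] lin by blast
      have "vk x = (\<Sum>i<Suc n. ((if i = n then 1 else - c i) / sqrt s) * a i x)" for x
      proof -
        have "(\<Sum>i<n. ((if i = n then 1 else - c i) / sqrt s) * a i x) = - ((\<Sum>i<n. c i * a i x) / sqrt s)"
          unfolding sum_divide_distrib sum_negf[symmetric] by (intro sum.cong) auto
        then show ?thesis using fun_cong[OF c, of x]
          by (simp add: vk_def r_def diff_divide_distrib)
      qed
      then show ?thesis unfolding v'_def
        by (intro exI[of _ "\<lambda>i. (if i = n then 1 else - c i) / sqrt s"]) auto
    qed
    have on': "(\<integral>x. v' p x * v' q x \<partial>N) = (if p = q then 1 else 0)" if "p < Suc k" "q < Suc k" for p q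
      using that on vkv vvk vkvk by (auto simp: v'_def less_Suc_eq)
    have ex': "AE x in N. a i x = (\<Sum>p<Suc k. (\<integral>x. a i x * v' p x \<partial>N) * v' p x)" if "i < Suc n" for i
    proof -
      have *: "(\<Sum>p<k. (\<integral>x. a i x * v' p x \<partial>N) * v' p x) = (\<Sum>p<k. (\<integral>x. a i x * v p x \<partial>N) * v p x)" for x
        by (intro sum.cong) (auto simp: v'_def)
      show ?thesis
      proof (cases "i < n")
        case True
        show ?thesis using ex[OF True] by eventually_elim (simp add: * v'_def[THEN fun_cong, of k] aik[OF True])
      next
        case False
        with that have [simp]: "i = n" by auto
        have "(\<Sum>p<Suc k. (\<integral>x. a i x * v' p x \<partial>N) * v' p x) = a i x" for x
          using decomp[of x] * by (simp add: v'_def[THEN fun_cong, of k] ank e_def)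
        then show ?thesis by simp
      qed
    qed
    show ?thesis
      using k lin' on' ex' by (intro exI[of _ "Suc k"] conjI exI[of _ v']) auto
  qed
qed

lemma integral_orthonormal_lincomb_square:
  fixes v :: "nat \<Rightarrow> 'x \<Rightarrow> real"
  assumes sq: "\<And>p. p < k \<Longrightarrow> sq_int N (v p)"
    and on: "\<And>p q. p < k \<Longrightarrow> q < k \<Longrightarrow> (\<integral>x. v p x * v q x \<partial>N) = (if p = q then 1 else 0)"
  shows "(\<integral>x. (\<Sum>p<k. b p * v p x)\<^sup>2 \<partial>N) = (\<Sum>p<k. (b p)\<^sup>2)"
proof -
  have vq: "(\<integral>x. v q x * (\<Sum>p<k. b p * v p x) \<partial>N) = b q" if "q < k" for q
  proof -
    have "(\<integral>x. v q x * (\<Sum>p<k. b p * v p x) \<partial>N) = (\<integral>x. (\<Sum>p<k. b p * v p x) * v q x \<partial>N)"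
      by (simp add: mult.commute)
    also have "\<dots> = (\<Sum>p<k. b p * (\<integral>x. v p x * v q x \<partial>N))"
      using sq that by (intro integral_lincomb_mult) auto
    also have "\<dots> = (\<Sum>p<k. b p * (if p = q then 1 else 0))"
      using on that by (intro sum.cong) auto
    finally show ?thesis using sum_kronecker[OF that, of b] by simp
  qed
  have "(\<integral>x. (\<Sum>p<k. b p * v p x)\<^sup>2 \<partial>N) = (\<Sum>p<k. b p * (\<integral>x. v p x * (\<Sum>p<k. b p * v p x) \<partial>N))"
    unfolding power2_eq_square
    by (intro integral_lincomb_mult sq_int_lincomb) (auto intro: sq)
  also have "\<dots> = (\<Sum>p<k. (b p)\<^sup>2)"
    by (intro sum.cong) (auto simp: vq power2_eq_square)
  finally show ?thesis .
qed

text \<open>The function \<open>h\<close> is the projection of \<open>g\<close> onto the system, and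
  the integral of \<open>(g - h)^2\<close> is nonnegative.\<close>

lemma bessel_inequality:
  fixes v :: "nat \<Rightarrow> 'x \<Rightarrow> real"
  assumes sq: "\<And>p. p < k \<Longrightarrow> sq_int N (v p)" and g: "sq_int N g"
    and on: "\<And>p q. p < k \<Longrightarrow> q < k \<Longrightarrow> (\<integral>x. v p x * v q x \<partial>N) = (if p = q then 1 else 0)"
  shows "(\<Sum>p<k. (\<integral>x. g x * v p x \<partial>N)\<^sup>2) \<le> (\<integral>x. (g x)\<^sup>2 \<partial>N)"
proof -
  define b where "b p = (\<integral>x. g x * v p x \<partial>N)" for p
  define h where "h x = (\<Sum>p<k. b p * v p x)" for x
  have sqh: "sq_int N h" unfolding h_def by (intro sq_int_lincomb) (auto intro: sq)
  have hh: "(\<integral>x. (h x)\<^sup>2 \<partial>N) = (\<Sum>p<k. (b p)\<^sup>2)"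
    unfolding h_def by (intro integral_orthonormal_lincomb_square sq on)
  have hg: "(\<integral>x. h x * g x \<partial>N) = (\<Sum>p<k. (b p)\<^sup>2)"
  proof -
    have "(\<integral>x. h x * g x \<partial>N) = (\<Sum>p<k. b p * (\<integral>x. v p x * g x \<partial>N))"
      unfolding h_def by (intro integral_lincomb_mult) (auto intro: sq g)
    then show ?thesis by (simp add: b_def power2_eq_square mult.commute)
  qed
  have "0 \<le> (\<integral>x. (g x - h x)\<^sup>2 \<partial>N)" by simp
  also have "\<dots> = (\<integral>x. (g x)\<^sup>2 + (h x)\<^sup>2 - 2 * (h x * g x) \<partial>N)"
    by (simp add: power2_diff mult_ac)
  also have "\<dots> = (\<integral>x. (g x)\<^sup>2 \<partial>N) + (\<integral>x. (h x)\<^sup>2 \<partial>N) - 2 * (\<integral>x. h x * g x \<partial>N)"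
    using g sqh sq_int_mult_integrable[OF sqh g] by (simp add: sq_int_square)
  finally show ?thesis using hh hg by (simp add: b_def)
qed

text \<open>The Frobenius norm dominates the operator norm: Cauchy-Schwarz over the index pairs
  bounds the form of \<open>G - I\<close> by half of the squared length of \<open>c\<close>, which
  leaves at least the other half. This is what makes least squares stable.\<close>

lemma near_identity_quadratic_form:
  fixes G :: "nat \<Rightarrow> nat \<Rightarrow> real"
  assumes "(\<Sum>p<k. \<Sum>q<k. (G p q - (if p = q then 1 else 0))\<^sup>2) \<le> 1/4"
  shows "(\<Sum>p<k. (c p)\<^sup>2) \<le> 2 * (\<Sum>p<k. \<Sum>q<k. c p * c q * G p q)"
proof -
  define E where "E p q = G p q - (if p = q then 1 else 0)" for p q
  define S where "S = (\<Sum>p<k. (c p)\<^sup>2)"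
  define R where "R = (\<Sum>p<k. \<Sum>q<k. c p * c q * E p q)"
  have "R = (\<Sum>z\<in>{..<k}\<times>{..<k}. (c (fst z) * c (snd z)) * E (fst z) (snd z))"
    by (simp add: R_def sum.cartesian_product case_prod_unfold)
  then have "R\<^sup>2 \<le> (\<Sum>z\<in>{..<k}\<times>{..<k}. (c (fst z) * c (snd z))\<^sup>2) * (\<Sum>z\<in>{..<k}\<times>{..<k}. (E (fst z) (snd z))\<^sup>2)"
    by (simp add: Cauchy_Schwarz_ineq_sum)
  also have "(\<Sum>z\<in>{..<k}\<times>{..<k}. (E (fst z) (snd z))\<^sup>2) = (\<Sum>p<k. \<Sum>q<k. (E p q)\<^sup>2)"
    by (simp add: sum.cartesian_product case_prod_unfold)
  also have "(\<Sum>z\<in>{..<k}\<times>{..<k}. (c (fst z) * c (snd z))\<^sup>2) = S\<^sup>2"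
    unfolding S_def power2_eq_square[of "sum _ _"] sum_product
    by (simp add: sum.cartesian_product case_prod_unfold power_mult_distrib)
  also have "S\<^sup>2 * (\<Sum>p<k. \<Sum>q<k. (E p q)\<^sup>2) \<le> S\<^sup>2 * (1/4)"
    using assms by (intro mult_left_mono) (auto simp: E_def)
  also have "\<dots> = (S / 2)\<^sup>2" by (simp add: power2_eq_square)
  finally have "\<bar>R\<bar> \<le> \<bar>S / 2\<bar>" by (simp only: abs_le_square_iff)
  moreover have "S \<ge> 0" by (simp add: S_def sum_nonneg)
  moreover have "(\<Sum>p<k. \<Sum>q<k. c p * c q * G p q) = S + R"
  proof -
    have "(\<Sum>q<k. c p * c q * G p q) = (c p)\<^sup>2 + (\<Sum>q<k. c p * c q * E p q)" if "p < k" for p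
    proof -
      have "(\<Sum>q<k. c p * c q * G p q) = (\<Sum>q<k. (c p * c q) * (if q = p then 1 else 0) + c p * c q * E p q)"
        by (intro sum.cong) (auto simp: E_def algebra_simps)
      then show ?thesis using sum_kronecker[OF that, of "\<lambda>q. c p * c q"]
        by (simp only: sum.distrib power2_eq_square)
    qed
    then show ?thesis unfolding S_def R_def sum.distrib[symmetric] by (intro sum.cong) auto
  qed
  ultimately show ?thesis unfolding S_def[symmetric] by linarith
qed

text \<open>Applying Gram-Schmidt to the columns of \<open>H\<close> avoids matrix inverses.\<close>

lemma least_squares_operator:
  fixes H :: "nat \<Rightarrow> nat \<Rightarrow> real"
  assumes coercive: "\<And>c. (\<Sum>i<k. (c i)\<^sup>2) \<le> 2 * (\<Sum>j<m. (\<Sum>i<k. H j i * c i)\<^sup>2)"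
  shows "\<exists>B. \<forall>s z. (\<Sum>i<k. (s i - (\<Sum>j<m. B i j * z j))\<^sup>2) \<le> 2 * (\<Sum>j<m. (z j - (\<Sum>i<k. H j i * s i))\<^sup>2)"
proof -
  \<comment> \<open>Under counting measure, vectors with \<open>m\<close> entries are square
    integrable functions, so Gram-Schmidt and Bessel apply to the columns of
    \<open>H\<close>.\<close>
  define N where "N = count_space {..<m}"
  have int: "(\<integral>j. f j \<partial>N) = (\<Sum>j<m. f j)" for f :: "nat \<Rightarrow> real"
    unfolding N_def by (rule lebesgue_integral_count_space_finite) simp
  have sq: "sq_int N f" for f :: "nat \<Rightarrow> real"
    unfolding N_def sq_int_def by (auto intro: integrable_count_space)
  obtain l :: nat and v where lin: "\<And>p. p < l \<Longrightarrow> \<exists>c. v p = (\<lambda>j. \<Sum>i<k. c i * H j i)"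
    and on: "\<And>p q. p < l \<Longrightarrow> q < l \<Longrightarrow> (\<integral>j. v p j * v q j \<partial>N) = (if p = q then 1 else 0)"
    and ex: "\<And>i. i < k \<Longrightarrow> AE j in N. H j i = (\<Sum>p<l. (\<integral>j. H j i * v p j \<partial>N) * v p j)"
    using gram_schmidt_L2[of k N "\<lambda>i j. H j i", OF sq] by blast
  obtain C where C: "\<And>p. p < l \<Longrightarrow> v p = (\<lambda>j. \<Sum>i<k. C p i * H j i)"
    using lin by metis
  have ex': "H j i = (\<Sum>p<l. (\<integral>j. H j i * v p j \<partial>N) * v p j)" if "i < k" "j < m" for i j
    using ex[OF that(1)] that(2) unfolding N_def AE_count_space by auto
  \<comment> \<open>\<open>B z\<close> is the coefficient vector whose image under \<open>H\<close>
    is the orthogonal projection of \<open>z\<close> onto the column span.\<close>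
  define B where "B i j = (\<Sum>p<l. C p i * v p j)" for i j
  show ?thesis
  proof (intro exI[of _ B] allI)
    fix s z :: "nat \<Rightarrow> real"
    define h where "h j = (\<Sum>i<k. H j i * s i)" for j
    define w where "w j = z j - h j" for j
    define c where "c i = s i - (\<Sum>j<m. B i j * z j)" for i
    have hj: "h j = (\<Sum>p<l. (\<integral>j. h j * v p j \<partial>N) * v p j)" if "j < m" for j
    proof -
      have "(\<integral>j. h j * v p j \<partial>N) = (\<Sum>i<k. s i * (\<integral>j. H j i * v p j \<partial>N))" for p
        using integral_lincomb_mult[of "{..<k}" N "\<lambda>i j. H j i" "v p" s] sq
        by (simp add: h_def mult.commute)
      then have "(\<Sum>p<l. (\<integral>j. h j * v p j \<partial>N) * v p j) = (\<Sum>p<l. \<Sum>i<k. s i * ((\<integral>j. H j i * v p j \<partial>N) * v p j))"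
        by (simp add: sum_distrib_right mult.assoc)
      also have "\<dots> = (\<Sum>i<k. s i * (\<Sum>p<l. (\<integral>j. H j i * v p j \<partial>N) * v p j))"
        by (subst sum.swap) (simp add: sum_distrib_left)
      also have "\<dots> = (\<Sum>i<k. s i * H j i)"
        using ex'[OF _ that] by (intro sum.cong) auto
      finally show ?thesis by (simp add: h_def mult.commute)
    qed
    \<comment> \<open>Since \<open>H s = h\<close> lies in the column span, it is fixed by the
      projection; hence \<open>H c\<close> is minus the projection of the residual \<open>w\<close>.
      Coercivity bounds \<open>c\<close> by \<open>H c\<close>, and Bessel bounds the projection by
      \<open>w\<close>.\<close>
    have Hc: "(\<Sum>i<k. H j i * c i) = (\<Sum>p<l. (- (\<integral>j. w j * v p j \<partial>N)) * v p j)" if "j < m" for j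
    proof -
      have "(\<Sum>i<k. H j i * (\<Sum>j<m. B i j * z j)) = (\<Sum>i<k. \<Sum>p<l. (C p i * H j i) * (\<Sum>j<m. v p j * z j))"
      proof (intro sum.cong refl)
        fix i
        have "(\<Sum>j<m. B i j * z j) = (\<Sum>j<m. \<Sum>p<l. C p i * (v p j * z j))"
          by (simp add: B_def sum_distrib_right mult.assoc)
        also have "\<dots> = (\<Sum>p<l. C p i * (\<Sum>j<m. v p j * z j))"
          by (subst sum.swap) (simp add: sum_distrib_left)
        finally show "H j i * (\<Sum>j<m. B i j * z j) = (\<Sum>p<l. (C p i * H j i) * (\<Sum>j<m. v p j * z j))"
          by (simp add: sum_distrib_left mult_ac)
      qed
      also have "\<dots> = (\<Sum>p<l. (\<Sum>i<k. C p i * H j i) * (\<Sum>j<m. v p j * z j))"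
        by (subst sum.swap) (simp add: sum_distrib_right)
      also have "\<dots> = (\<Sum>p<l. (\<integral>j. z j * v p j \<partial>N) * v p j)"
        by (intro sum.cong) (auto simp: C int mult.commute)
      finally have "(\<Sum>i<k. H j i * c i) = h j - (\<Sum>p<l. (\<integral>j. z j * v p j \<partial>N) * v p j)"
        by (simp add: c_def h_def right_diff_distrib sum_subtractf)
      also have "\<dots> = (\<Sum>p<l. ((\<integral>j. h j * v p j \<partial>N) - (\<integral>j. z j * v p j \<partial>N)) * v p j)"
        by (subst hj[OF that]) (simp add: left_diff_distrib sum_subtractf)
      also have "\<dots> = (\<Sum>p<l. (- (\<integral>j. w j * v p j \<partial>N)) * v p j)"
        by (intro sum.cong refl) (simp add: int w_def left_diff_distrib sum_subtractf)
      finally show ?thesis .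
    qed
    have "(\<Sum>i<k. (c i)\<^sup>2) \<le> 2 * (\<Sum>j<m. (\<Sum>i<k. H j i * c i)\<^sup>2)" by (rule coercive)
    also have "(\<Sum>j<m. (\<Sum>i<k. H j i * c i)\<^sup>2) = (\<integral>j. (\<Sum>p<l. (- (\<integral>j. w j * v p j \<partial>N)) * v p j)\<^sup>2 \<partial>N)"
      unfolding int[of "\<lambda>j. (\<Sum>p<l. (- (\<integral>j. w j * v p j \<partial>N)) * v p j)\<^sup>2"]
      by (intro sum.cong) (auto simp: Hc)
    also have "\<dots> = (\<Sum>p<l. (- (\<integral>j. w j * v p j \<partial>N))\<^sup>2)"
      by (rule integral_orthonormal_lincomb_square) (auto simp: sq on)
    also have "\<dots> \<le> (\<integral>j. (w j)\<^sup>2 \<partial>N)"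
      using bessel_inequality[of l N v w] sq on by simp
    finally show "(\<Sum>i<k. (s i - (\<Sum>j<m. B i j * z j))\<^sup>2) \<le> 2 * (\<Sum>j<m. (z j - (\<Sum>i<k. H j i * s i))\<^sup>2)"
      by (simp add: c_def int w_def h_def)
  qed
qed

section \<open>Choice of the sample points\<close>

text \<open>A first moment argument. If \<open>x\<close> is drawn from \<open>P\<close> with density
  \<open>w\<close> and weighted by \<open>1 / w x\<close>, the rank-one sample has mean the
  identity, so its inner product with the accumulated deviation \<open>S\<close> has mean zero, and
  the weighted \<open>\<gamma>\<close> has mean at most \<open>E0\<close>. Some point does at least
  as well as the average, and \<open>Q\<close> holds almost everywhere. The remaining square of the
  single deviation is below \<open>k^2\<close> for every such point.\<close>

lemma sampling_point_step:
  fixes u :: "nat \<Rightarrow> 'x \<Rightarrow> real"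
  assumes "prob_space P" and k: "k \<ge> 1"
    and sq: "\<And>p. p < k \<Longrightarrow> sq_int P (u p)"
    and on: "\<And>p q. p < k \<Longrightarrow> q < k \<Longrightarrow> (\<integral>x. u p x * u q x \<partial>P) = (if p = q then 1 else 0)"
    and \<gamma>: "\<And>x. \<gamma> x \<ge> 0" "integrable P \<gamma>" "(\<integral>x. \<gamma> x \<partial>P) \<le> E0"
    and Q: "AE x in P. Q x" and \<alpha>: "\<alpha> \<ge> 0"
  shows "\<exists>x\<in>space P. Q x \<and> (\<exists>\<omega>>0.
      (\<Sum>p<k. \<Sum>q<k. (S p q + (\<omega> * u p x * u q x - (if p = q then 1 else 0)))\<^sup>2) + \<alpha> * (\<omega> * \<gamma> x)
      \<le> (\<Sum>p<k. \<Sum>q<k. (S p q)\<^sup>2) + (real k)\<^sup>2 + \<alpha> * E0)"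
proof -
  interpret prob_space P by fact
  define w where "w x = (\<Sum>p<k. (u p x)\<^sup>2) / k" for x
  define \<delta> where "\<delta> p q = (if p = q then 1 else (0::real))" for p q :: nat
  \<comment> \<open>This is \<open>w x\<close> times the excess over the bound, apart from the
    deterministic square. Multiplying by \<open>w x\<close> keeps the integral over \<open>P\<close>
    and avoids division where \<open>w\<close> vanishes.\<close>
  define F where "F x = 2 * (\<Sum>p<k. \<Sum>q<k. S p q * (u p x * u q x - w x * \<delta> p q)) + \<alpha> * \<gamma> x - w x * (\<alpha> * E0)" for x
  have w0: "w x \<ge> 0" for x unfolding w_def by (intro divide_nonneg_nonneg sum_nonneg) auto
  have wi: "integrable P w"
    unfolding w_def using sq by (intro integrable_divide integrable_sum) (auto simp: sq_int_def)
  have w1: "(\<integral>x. w x \<partial>P) = 1"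
  proof -
    have "(\<integral>x. w x \<partial>P) = (\<integral>x. (\<Sum>p<k. (u p x)\<^sup>2) \<partial>P) / k"
      by (simp add: w_def)
    also have "(\<integral>x. (\<Sum>p<k. (u p x)\<^sup>2) \<partial>P) = (\<Sum>p<k. (\<integral>x. (u p x)\<^sup>2 \<partial>P))"
      by (rule Bochner_Integration.integral_sum) (use sq in \<open>auto simp: sq_int_def\<close>)
    also have "\<dots> = (\<Sum>p<k. 1)"
      using on by (intro sum.cong) (auto simp: power2_eq_square)
    finally show ?thesis using k by simp
  qed
  have ui: "integrable P (\<lambda>x. S p q * (u p x * u q x - w x * \<delta> p q))" if "p < k" "q < k" for p q
    using sq_int_mult_integrable[OF sq sq] that wi by auto
  have si: "integrable P (\<lambda>x. \<Sum>p<k. \<Sum>q<k. S p q * (u p x * u q x - w x * \<delta> p q))"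
    by (intro Bochner_Integration.integrable_sum ui) auto
  have Fi: "integrable P F"
    unfolding F_def using si wi \<gamma>(2)
    by (intro Bochner_Integration.integrable_diff Bochner_Integration.integrable_add integrable_mult_right integrable_mult_left) auto
  have uz: "(\<integral>x. S p q * (u p x * u q x - w x * \<delta> p q) \<partial>P) = 0" if "p < k" "q < k" for p q
  proof -
    have "(\<integral>x. u p x * u q x - w x * \<delta> p q \<partial>P) = (\<integral>x. u p x * u q x \<partial>P) - (\<integral>x. w x * \<delta> p q \<partial>P)"
      using sq_int_mult_integrable[OF sq sq] that wi by (intro Bochner_Integration.integral_diff) auto
    then have "(\<integral>x. u p x * u q x - w x * \<delta> p q \<partial>P) = 0"
      using on[OF that] w1 by (simp add: \<delta>_def)
    then show ?thesis by simp
  qed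
  have F0: "(\<integral>x. F x \<partial>P) \<le> 0"
  proof -
    have "(\<integral>x. (\<Sum>p<k. \<Sum>q<k. S p q * (u p x * u q x - w x * \<delta> p q)) \<partial>P) =
          (\<Sum>p<k. \<Sum>q<k. (\<integral>x. S p q * (u p x * u q x - w x * \<delta> p q) \<partial>P))"
      using ui by (subst Bochner_Integration.integral_sum; (intro Bochner_Integration.integrable_sum)?)
        (auto intro!: sum.cong Bochner_Integration.integral_sum)
    also have "\<dots> = 0" using uz by (intro sum.neutral ballI) auto
    finally have s0: "(\<integral>x. (\<Sum>p<k. \<Sum>q<k. S p q * (u p x * u q x - w x * \<delta> p q)) \<partial>P) = 0" .
    have "(\<integral>x. F x \<partial>P) = 2 * (\<integral>x. (\<Sum>p<k. \<Sum>q<k. S p q * (u p x * u q x - w x * \<delta> p q)) \<partial>P)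
        + \<alpha> * (\<integral>x. \<gamma> x \<partial>P) - (\<integral>x. w x \<partial>P) * (\<alpha> * E0)"
      unfolding F_def using si wi \<gamma>(2) by simp
    also have "\<dots> = \<alpha> * ((\<integral>x. \<gamma> x \<partial>P) - E0)" using s0 w1 by (simp add: algebra_simps)
    also have "\<dots> \<le> 0" using \<alpha> \<gamma>(3) by (intro mult_nonneg_nonpos) auto
    finally show ?thesis .
  qed
  \<comment> \<open>Where \<open>w\<close> vanishes all \<open>u p\<close> vanish and
    \<open>F\<close> is nonnegative. Without a good point \<open>F\<close> would be nonnegative
    almost everywhere with nonpositive mean, so \<open>F\<close>, and with it \<open>w\<close>,
    would be zero almost everywhere, contradicting that \<open>w\<close> has integral 1.\<close>
  have "\<exists>x\<in>space P. Q x \<and> w x > 0 \<and> F x \<le> 0"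
  proof (rule ccontr)
    assume neg: "\<not> (\<exists>x\<in>space P. Q x \<and> w x > 0 \<and> F x \<le> 0)"
    have Fw: "F x \<ge> 0 \<and> (F x = 0 \<longrightarrow> w x = 0)" if "x \<in> space P" "Q x" for x
    proof (cases "w x > 0")
      case True
      then show ?thesis using neg that by force
    next
      case False
      then have wx: "w x = 0" using w0[of x] by auto
      then have "(\<Sum>p<k. (u p x)\<^sup>2) = 0" using k by (simp add: w_def)
      then have "u p x = 0" if "p < k" for p
        using that by (subst (asm) sum_nonneg_eq_0_iff) auto
      then have "F x = \<alpha> * \<gamma> x" by (simp add: F_def wx)
      then show ?thesis using \<alpha> \<gamma>(1)[of x] wx by simp
    qed
    have "AE x in P. F x \<ge> 0" using Q AE_space by eventually_elim (use Fw in auto)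
    moreover have *: "AE x in P. F x = 0 \<longrightarrow> w x = 0"
      using Q AE_space by eventually_elim (use Fw in auto)
    ultimately have "AE x in P. F x = 0"
      using F0 integral_nonneg_AE[of F P] integral_nonneg_eq_0_iff_AE[OF Fi] by auto
    with * have "AE x in P. w x = 0" by eventually_elim auto
    then have "(\<integral>x. w x \<partial>P) = (\<integral>x. 0 \<partial>P)"
      using wi by (intro integral_cong_AE) auto
    with w1 show False by simp
  qed
  then obtain x where x: "x \<in> space P" "Q x" "w x > 0" "F x \<le> 0" by blast
  define \<omega> where "\<omega> = 1 / w x"
  have \<omega>: "\<omega> > 0" "\<omega> * w x = 1" using x by (auto simp: \<omega>_def)
  define U where "U = (\<Sum>p<k. (u p x)\<^sup>2)"
  have U: "\<omega> * U = k" using \<omega>(2) k by (simp add: w_def U_def field_simps)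
  define X where "X p q = \<omega> * u p x * u q x - \<delta> p q" for p q
  \<comment> \<open>The weight makes the deviation of a single rank-one sample deterministic.\<close>
  have XX: "(\<Sum>p<k. \<Sum>q<k. (X p q)\<^sup>2) = (real k)\<^sup>2 - k"
  proof -
    have "(\<Sum>q<k. (X p q)\<^sup>2) = \<omega>\<^sup>2 * (u p x)\<^sup>2 * U - 2 * \<omega> * (u p x)\<^sup>2 + 1" if "p < k" for p
    proof -
      have "(\<Sum>q<k. (X p q)\<^sup>2) = (\<Sum>q<k. \<omega>\<^sup>2 * (u p x)\<^sup>2 * (u q x)\<^sup>2 + (1 - 2 * \<omega> * u p x * u q x) * (if q = p then 1 else 0))"
        by (intro sum.cong) (auto simp: X_def \<delta>_def power2_eq_square algebra_simps)
      also have "\<dots> = (\<Sum>q<k. \<omega>\<^sup>2 * (u p x)\<^sup>2 * (u q x)\<^sup>2) + (\<Sum>q<k. (1 - 2 * \<omega> * u p x * u q x) * (if q = p then 1 else 0))"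
        by (rule sum.distrib)
      also have "(\<Sum>q<k. (1 - 2 * \<omega> * u p x * u q x) * (if q = p then 1 else 0)) = 1 - 2 * \<omega> * u p x * u p x"
        by (rule sum_kronecker[OF that])
      finally show ?thesis by (simp add: U_def sum_distrib_left power2_eq_square algebra_simps)
    qed
    then have "(\<Sum>p<k. \<Sum>q<k. (X p q)\<^sup>2) = (\<Sum>p<k. (\<omega>\<^sup>2 * U - 2 * \<omega>) * (u p x)\<^sup>2 + 1)"
      by (intro sum.cong) (auto simp: algebra_simps)
    also have "\<dots> = (\<omega>\<^sup>2 * U - 2 * \<omega>) * U + k"
      by (simp add: sum.distrib sum_distrib_left[symmetric] U_def)
    also have "\<dots> = (\<omega> * U)\<^sup>2 - 2 * (\<omega> * U) + k" by (simp add: power2_eq_square algebra_simps)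
    finally show ?thesis by (simp add: U)
  qed
  have SX: "2 * (\<Sum>p<k. \<Sum>q<k. S p q * X p q) + \<alpha> * (\<omega> * \<gamma> x) \<le> \<alpha> * E0"
  proof -
    define W where "W = (\<Sum>p<k. \<Sum>q<k. S p q * (u p x * u q x - w x * \<delta> p q))"
    have "S p q * X p q = \<omega> * (S p q * (u p x * u q x - w x * \<delta> p q))" for p q
      using \<omega>(2) by (simp add: X_def algebra_simps)
    then have *: "(\<Sum>p<k. \<Sum>q<k. S p q * X p q) = \<omega> * W"
      by (simp only: sum_distrib_left[symmetric] W_def)
    have "2 * (\<Sum>p<k. \<Sum>q<k. S p q * X p q) + \<alpha> * (\<omega> * \<gamma> x) - \<alpha> * E0 =
        2 * (\<omega> * W) + \<alpha> * (\<omega> * \<gamma> x) - (\<omega> * w x) * (\<alpha> * E0)"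
      by (simp only: * \<omega>(2) mult_1)
    also have "\<dots> = \<omega> * F x"
      unfolding F_def W_def[symmetric] by (simp add: algebra_simps)
    also have "\<dots> \<le> 0" using \<omega>(1) x(4) by (intro mult_nonneg_nonpos) auto
    finally show ?thesis by simp
  qed
  have "(\<Sum>p<k. \<Sum>q<k. (S p q + X p q)\<^sup>2) = (\<Sum>p<k. \<Sum>q<k. (S p q)\<^sup>2) + 2 * (\<Sum>p<k. \<Sum>q<k. S p q * X p q) + (\<Sum>p<k. \<Sum>q<k. (X p q)\<^sup>2)"
    by (simp add: power2_sum sum.distrib sum_distrib_left mult.assoc)
  then have "(\<Sum>p<k. \<Sum>q<k. (S p q + X p q)\<^sup>2) + \<alpha> * (\<omega> * \<gamma> x) \<le> (\<Sum>p<k. \<Sum>q<k. (S p q)\<^sup>2) + (real k)\<^sup>2 + \<alpha> * E0"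
    using XX SX by linarith
  then show ?thesis
    using x \<omega>(1) unfolding X_def \<delta>_def by blast
qed

text \<open>The potential grows only linearly in \<open>m\<close>, although it contains the square
  of a sum of \<open>m\<close> deviations, because each new point is chosen with the cross term
  under control. After division of the weights by \<open>m\<close> the squared Gram error is
  therefore of order \<open>1 / m\<close>. One common potential is used since the same points must
  serve both terms.\<close>

lemma sampling_points:
  fixes u :: "nat \<Rightarrow> 'x \<Rightarrow> real"
  assumes "prob_space P" and "k \<ge> 1"
    and "\<And>p. p < k \<Longrightarrow> sq_int P (u p)"
    and "\<And>p q. p < k \<Longrightarrow> q < k \<Longrightarrow> (\<integral>x. u p x * u q x \<partial>P) = (if p = q then 1 else 0)"
    and "\<And>x. \<gamma> x \<ge> 0" "integrable P \<gamma>" "(\<integral>x. \<gamma> x \<partial>P) \<le> E0"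
    and "AE x in P. Q x" and \<alpha>: "\<alpha> \<ge> 0"
  shows "\<exists>x \<omega>. (\<forall>j<m. x j \<in> space P \<and> Q (x j) \<and> \<omega> j > 0) \<and>
      (\<Sum>p<k. \<Sum>q<k. (\<Sum>j<m. \<omega> j * u p (x j) * u q (x j) - (if p = q then 1 else 0))\<^sup>2)
        + \<alpha> * (\<Sum>j<m. \<omega> j * \<gamma> (x j)) \<le> real m * ((real k)\<^sup>2 + \<alpha> * E0)"
proof (induction m)
  case 0
  then show ?case by auto
next
  case (Suc m)
  then obtain x \<omega> where x: "\<And>j. j < m \<Longrightarrow> x j \<in> space P \<and> Q (x j) \<and> \<omega> j > 0"
    and b: "(\<Sum>p<k. \<Sum>q<k. (\<Sum>j<m. \<omega> j * u p (x j) * u q (x j) - (if p = q then 1 else 0))\<^sup>2)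
        + \<alpha> * (\<Sum>j<m. \<omega> j * \<gamma> (x j)) \<le> real m * ((real k)\<^sup>2 + \<alpha> * E0)" by auto
  obtain x' \<omega>' where x': "x' \<in> space P" "Q x'" "\<omega>' > 0"
    and b': "(\<Sum>p<k. \<Sum>q<k. ((\<Sum>j<m. \<omega> j * u p (x j) * u q (x j) - (if p = q then 1 else 0))
          + (\<omega>' * u p x' * u q x' - (if p = q then 1 else 0)))\<^sup>2) + \<alpha> * (\<omega>' * \<gamma> x')
      \<le> (\<Sum>p<k. \<Sum>q<k. (\<Sum>j<m. \<omega> j * u p (x j) * u q (x j) - (if p = q then 1 else 0))\<^sup>2) + (real k)\<^sup>2 + \<alpha> * E0"
    using sampling_point_step[OF assms, of "\<lambda>p q. \<Sum>j<m. \<omega> j * u p (x j) * u q (x j) - (if p = q then 1 else 0)"] by blast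
  define y where "y = x(m := x')"
  define \<tau> where "\<tau> j = (if j = m then \<omega>' else \<omega> j)" for j
  have 1: "\<forall>j<Suc m. y j \<in> space P \<and> Q (y j) \<and> \<tau> j > 0"
    using x x' by (auto simp: y_def \<tau>_def less_Suc_eq)
  have 2: "(\<Sum>j<Suc m. \<tau> j * u p (y j) * u q (y j) - c) = (\<Sum>j<m. \<omega> j * u p (x j) * u q (x j) - c) + (\<omega>' * u p x' * u q x' - c)" for p q c
    by (simp add: y_def \<tau>_def)
  have 3: "(\<Sum>j<Suc m. \<tau> j * \<gamma> (y j)) = (\<Sum>j<m. \<omega> j * \<gamma> (x j)) + \<omega>' * \<gamma> x'"
    by (simp add: y_def \<tau>_def)
  show ?case
    by (rule exI[of _ y], rule exI[of _ \<tau>], rule conjI[OF 1], unfold 2 3)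
       (use b b' in \<open>simp add: algebra_simps\<close>)
qed

section \<open>Gaussian variables\<close>

text \<open>Point mass and proper normal law become one family, so moments and trigonometric
  integrals need to be computed only for the standard normal law.\<close>

lemma centered_gaussian_real_scale:
  assumes "centered_gaussian_real N"
  shows "\<exists>\<sigma>\<ge>0. N = distr std_normal_distribution borel (\<lambda>x. \<sigma> * x)"
  using assms unfolding centered_gaussian_real_def
proof (elim disjE exE conjE)
  assume N: "N = return borel 0"
  interpret S: prob_space std_normal_distribution by (rule prob_space_normal_density) simp
  have "distr std_normal_distribution borel (\<lambda>x. 0 * x) = (return borel 0 :: real measure)"
    using S.distr_const[of 0 borel] by simp
  then show ?thesis using N by (intro exI[of _ 0]) auto
next
  fix \<sigma> :: real
  assume \<sigma>: "\<sigma> > 0" and N: "N = density lborel (normal_density 0 \<sigma>)"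
  have "distributed std_normal_distribution lborel (\<lambda>x. x) std_normal_density"
    unfolding distributed_def by (auto simp: distr_id2 normal_density_nonneg)
  then have "distributed std_normal_distribution lborel (\<lambda>x. 0 + \<sigma> * x) (normal_density (0 + \<sigma> * 0) (\<bar>\<sigma>\<bar> * 1))"
    using \<sigma> by (intro prob_space.normal_density_affine prob_space_normal_density) auto
  then have "distr std_normal_distribution lborel (\<lambda>x. \<sigma> * x) = N"
    using \<sigma> unfolding N distributed_def by simp
  moreover have "distr std_normal_distribution lborel (\<lambda>x. \<sigma> * x) = distr std_normal_distribution borel (\<lambda>x. \<sigma> * x)"
    by (rule distr_cong) auto
  ultimately show ?thesis using \<sigma> by (intro exI[of _ \<sigma>]) auto
qed

lemma std_normal_distribution_facts:
  "prob_space std_normal_distribution"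
  "integrable std_normal_distribution (\<lambda>x. x)"
  "integrable std_normal_distribution (\<lambda>x. x\<^sup>2)"
  "integrable std_normal_distribution (\<lambda>x. x ^ 4)"
  "(\<integral>x. x\<^sup>2 \<partial>std_normal_distribution) = 1"
  "(\<integral>x. x ^ 4 \<partial>std_normal_distribution) = 3"
  "(\<integral>x. cos (t * x) \<partial>std_normal_distribution) = exp (- t\<^sup>2 / 2)"
  "(\<integral>x. sin (t * x) \<partial>std_normal_distribution) = 0"
proof -
  show P: "prob_space std_normal_distribution" by (rule prob_space_normal_density) simp
  then interpret S: prob_space std_normal_distribution .
  have i: "integrable std_normal_distribution (\<lambda>x. x ^ k)" for k
    using integrable_std_normal_moment[of k] by (subst integrable_density) (auto simp: normal_density_nonneg)
  show "integrable std_normal_distribution (\<lambda>x. x)" using i[of 1] by simp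
  show "integrable std_normal_distribution (\<lambda>x. x\<^sup>2)" using i[of 2] by simp
  show "integrable std_normal_distribution (\<lambda>x. x ^ 4)" using i[of 4] by simp
  have e: "(\<integral>x. x ^ (2 * k) \<partial>std_normal_distribution) = fact (2 * k) / (2^k * fact k)" for k
    using integral_std_normal_moment_even[of k] by (subst integral_density) (auto simp: normal_density_nonneg)
  show "(\<integral>x. x\<^sup>2 \<partial>std_normal_distribution) = 1" using e[of 1] by simp
  show "(\<integral>x. x ^ 4 \<partial>std_normal_distribution) = 3" using e[of 2] by (simp add: fact_numeral)
  \<comment> \<open>The cosine and sine integrals are the real and imaginary parts of the
    characteristic function.\<close>
  have int: "integrable std_normal_distribution (\<lambda>x. iexp (t * x))"
    by (rule S.integrable_const_bound[where B=1]) auto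
  have c: "(\<integral>x. iexp (t * x) \<partial>std_normal_distribution) = complex_of_real (exp (- (t^2) / 2))"
    using fun_cong[OF char_std_normal_distribution, of t] by (simp add: char_def)
  have "(\<integral>x. Re (iexp (t * x)) \<partial>std_normal_distribution) = exp (- (t^2) / 2)"
    using integral_Re[OF int] c by simp
  moreover have "(\<integral>x. Im (iexp (t * x)) \<partial>std_normal_distribution) = 0"
    using integral_Im[OF int] c by simp
  moreover have "Re (iexp (t * x)) = cos (t * x)" "Im (iexp (t * x)) = sin (t * x)" for x
    by (simp_all add: Re_exp Im_exp)
  ultimately show "(\<integral>x. cos (t * x) \<partial>std_normal_distribution) = exp (- t\<^sup>2 / 2)"
    "(\<integral>x. sin (t * x) \<partial>std_normal_distribution) = 0" by simp_all
qed

text \<open>The form in which Gaussian laws are used later: the fourth moment feeds the bound on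
  path norms, and the trigonometric integrals carry both the orthogonality to nonlinear functions of
  the data and the convergence of variances.\<close>

lemma centered_gaussian_moments:
  assumes "prob_space M" and X: "X \<in> borel_measurable M" and g: "centered_gaussian_real (distr M borel X)"
  shows "integrable M X" "integrable M (\<lambda>x. (X x)\<^sup>2)" "integrable M (\<lambda>x. (X x) ^ 4)"
    "(\<integral>x. (X x) ^ 4 \<partial>M) = 3 * (\<integral>x. (X x)\<^sup>2 \<partial>M)\<^sup>2"
    "(\<integral>x. cos (X x) \<partial>M) = exp (- (\<integral>x. (X x)\<^sup>2 \<partial>M) / 2)"
    "(\<integral>x. sin (X x) \<partial>M) = 0"
proof -
  obtain \<sigma> where d: "distr M borel X = distr std_normal_distribution borel (\<lambda>x. \<sigma> * x)"
    using centered_gaussian_real_scale[OF g] by auto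
  have int: "integrable M (\<lambda>x. h (X x)) \<longleftrightarrow> integrable std_normal_distribution (\<lambda>x. h (\<sigma> * x))"
    and eq: "(\<integral>x. h (X x) \<partial>M) = (\<integral>x. h (\<sigma> * x) \<partial>std_normal_distribution)"
    if [measurable]: "h \<in> borel_measurable borel" for h :: "real \<Rightarrow> real"
  proof -
    have "integrable M (\<lambda>x. h (X x)) \<longleftrightarrow> integrable (distr M borel X) h"
      using X by (subst integrable_distr_eq) auto
    also have "\<dots> \<longleftrightarrow> integrable std_normal_distribution (\<lambda>x. h (\<sigma> * x))"
      unfolding d by (subst integrable_distr_eq) auto
    finally show "integrable M (\<lambda>x. h (X x)) \<longleftrightarrow> integrable std_normal_distribution (\<lambda>x. h (\<sigma> * x))" .
    have "(\<integral>x. h (X x) \<partial>M) = (\<integral>x. h x \<partial>distr M borel X)"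
      using X by (subst integral_distr) auto
    also have "\<dots> = (\<integral>x. h (\<sigma> * x) \<partial>std_normal_distribution)"
      unfolding d by (subst integral_distr) auto
    finally show "(\<integral>x. h (X x) \<partial>M) = (\<integral>x. h (\<sigma> * x) \<partial>std_normal_distribution)" .
  qed
  have s2: "(\<integral>x. (X x)\<^sup>2 \<partial>M) = \<sigma>\<^sup>2"
    using eq[of "\<lambda>x. x\<^sup>2"] by (simp add: power_mult_distrib std_normal_distribution_facts)
  show "integrable M X" using int[of "\<lambda>x. x"] by (simp add: std_normal_distribution_facts)
  show "integrable M (\<lambda>x. (X x)\<^sup>2)" using int[of "\<lambda>x. x\<^sup>2"]
    by (simp add: power_mult_distrib std_normal_distribution_facts)
  show "integrable M (\<lambda>x. (X x) ^ 4)" using int[of "\<lambda>x. x ^ 4"]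
    by (simp add: power_mult_distrib std_normal_distribution_facts)
  show "(\<integral>x. (X x) ^ 4 \<partial>M) = 3 * (\<integral>x. (X x)\<^sup>2 \<partial>M)\<^sup>2"
    using eq[of "\<lambda>x. x ^ 4"] by (simp add: power_mult_distrib std_normal_distribution_facts s2)
  show "(\<integral>x. cos (X x) \<partial>M) = exp (- (\<integral>x. (X x)\<^sup>2 \<partial>M) / 2)"
    using eq[of cos] by (simp add: std_normal_distribution_facts s2)
  show "(\<integral>x. sin (X x) \<partial>M) = 0"
    using eq[of sin] by (simp add: std_normal_distribution_facts)
qed

text \<open>Fourier uniqueness for the signed measure with density \<open>W\<close> pushed forward by \<open>Y\<close>.\<close>

lemma fourier_zero_imp_zero_real:
  fixes W Y :: "'a \<Rightarrow> real"
  assumes "prob_space M" and W: "integrable M W" and Y[measurable]: "Y \<in> borel_measurable M"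
    and c: "\<And>t. (\<integral>x. W x * cos (t * Y x) \<partial>M) = 0" and s: "\<And>t. (\<integral>x. W x * sin (t * Y x) \<partial>M) = 0"
    and A[measurable]: "A \<in> sets borel"
  shows "(\<integral>x. W x * indicator A (Y x) \<partial>M) = 0"
proof -
  interpret prob_space M by fact
  have [measurable]: "W \<in> borel_measurable M" using W by auto
  define Wp where "Wp x = max 0 (W x)" for x
  define Wn where "Wn x = max 0 (- W x)" for x
  have Wi: "integrable M Wp" "integrable M Wn" unfolding Wp_def Wn_def using W by auto
  have [measurable]: "Wp \<in> borel_measurable M" "Wn \<in> borel_measurable M" using Wi by auto
  have W0: "Wp x \<ge> 0" "Wn x \<ge> 0" for x by (auto simp: Wp_def Wn_def)
  have Wd: "W x = Wp x - Wn x" for x by (auto simp: Wp_def Wn_def)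
  define m where "m = (\<integral>x. Wp x \<partial>M)"
  have bi: "integrable M (\<lambda>x. V x * g (Y x))" if "integrable M V" "g \<in> borel_measurable borel" "\<And>y. \<bar>g y\<bar> \<le> 1"
    for V :: "'a \<Rightarrow> real" and g :: "real \<Rightarrow> real"
  proof (rule Bochner_Integration.integrable_bound[OF that(1)])
    show "(\<lambda>x. V x * g (Y x)) \<in> borel_measurable M" using that(1,2) by auto
    show "AE x in M. norm (V x * g (Y x)) \<le> norm (V x)"
      using that(3) by (auto simp: abs_mult intro!: mult_left_le)
  qed
  have split: "(\<integral>x. W x * g (Y x) \<partial>M) = (\<integral>x. Wp x * g (Y x) \<partial>M) - (\<integral>x. Wn x * g (Y x) \<partial>M)"
    if "g \<in> borel_measurable borel" "\<And>y. \<bar>g y\<bar> \<le> 1" for g :: "real \<Rightarrow> real"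
    using bi[OF Wi(1) that] bi[OF Wi(2) that] by (simp add: Wd left_diff_distrib)
  \<comment> \<open>At \<open>t = 0\<close> the cosine hypothesis says that positive and negative
    part have equal mass \<open>m\<close>.\<close>
  have m': "(\<integral>x. Wn x \<partial>M) = m"
    using split[of "\<lambda>_. 1"] c[of 0] by (simp add: m_def)
  have m0: "m \<ge> 0" unfolding m_def using W0 by simp
  show ?thesis
  proof (cases "m = 0")
    case True
    have "AE x in M. Wp x = 0" "AE x in M. Wn x = 0"
      using integral_nonneg_eq_0_iff_AE[OF Wi(1)] integral_nonneg_eq_0_iff_AE[OF Wi(2)] W0 m' True m_def by auto
    then have "AE x in M. W x * indicator A (Y x) = 0"
      by eventually_elim (simp add: Wd)
    then have "(\<integral>x. W x * indicator A (Y x) \<partial>M) = (\<integral>x. 0 \<partial>M)"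
      by (intro integral_cong_AE) auto
    then show ?thesis by simp
  next
    case False
    with m0 have m: "m > 0" by simp
    \<comment> \<open>Division by the common mass turns both parts into probability measures, to
      which uniqueness of characteristic functions applies.\<close>
    define \<nu> where "\<nu> V = distr (density M (\<lambda>x. ennreal (V x / m))) borel Y" for V :: "'a \<Rightarrow> real"
    have int\<nu>: "(\<integral>y. g y \<partial>\<nu> V) = (\<integral>x. (V x / m) *\<^sub>R g (Y x) \<partial>M)"
      if "g \<in> borel_measurable borel" "V \<in> borel_measurable M" "\<And>x. V x \<ge> 0" for g :: "real \<Rightarrow> 'z::{banach, second_countable_topology}" and V
      unfolding \<nu>_def using that m by (subst integral_distr; (subst integral_density)?) auto
    have rd: "real_distribution (\<nu> V)" if "integrable M V" "\<And>x. V x \<ge> 0" "(\<integral>x. V x \<partial>M) = m" for V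
    proof -
      have [measurable]: "V \<in> borel_measurable M" using that by auto
      have "emeasure (density M (\<lambda>x. ennreal (V x / m))) (space M) = (\<integral>\<^sup>+x. ennreal (V x / m) \<partial>M)"
        by (subst emeasure_density) (auto intro!: nn_integral_cong)
      also have "\<dots> = ennreal (\<integral>x. V x / m \<partial>M)"
        using that m by (intro nn_integral_eq_integral) auto
      also have "\<dots> = 1" using that m by simp
      finally have "prob_space (density M (\<lambda>x. ennreal (V x / m)))"
        by (intro prob_spaceI) simp
      then have "prob_space (\<nu> V)" unfolding \<nu>_def by (intro prob_space.prob_space_distr) auto
      then show ?thesis unfolding real_distribution_def real_distribution_axioms_def by (simp add: \<nu>_def)
    qed
    have ch: "char (\<nu> V) t = Complex ((\<integral>x. V x * cos (t * Y x) \<partial>M) / m) ((\<integral>x. V x * sin (t * Y x) \<partial>M) / m)"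
      if V: "integrable M V" "\<And>x. V x \<ge> 0" for V t
    proof -
      have [measurable]: "V \<in> borel_measurable M" using that by auto
      have "char (\<nu> V) t = (\<integral>x. (V x / m) *\<^sub>R iexp (t * Y x) \<partial>M)"
        unfolding char_def using V by (subst int\<nu>) auto
      moreover have i: "integrable M (\<lambda>x. (V x / m) *\<^sub>R iexp (t * Y x))"
      proof (rule Bochner_Integration.integrable_bound)
        show "integrable M (\<lambda>x. V x / m)" using V(1) by simp
      qed auto
      moreover have "Re (\<integral>x. (V x / m) *\<^sub>R iexp (t * Y x) \<partial>M) = (\<integral>x. V x * cos (t * Y x) / m \<partial>M)"
        by (subst integral_Re[OF i, symmetric]) (simp add: Re_exp)
      moreover have "Im (\<integral>x. (V x / m) *\<^sub>R iexp (t * Y x) \<partial>M) = (\<integral>x. V x * sin (t * Y x) / m \<partial>M)"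
        by (subst integral_Im[OF i, symmetric]) (simp add: Im_exp)
      ultimately show ?thesis by (simp add: complex_eq_iff)
    qed
    have "char (\<nu> Wp) = char (\<nu> Wn)"
    proof
      fix t
      have "(\<integral>x. Wp x * cos (t * Y x) \<partial>M) = (\<integral>x. Wn x * cos (t * Y x) \<partial>M)"
        using split[of "\<lambda>y. cos (t * y)"] c[of t] by simp
      moreover have "(\<integral>x. Wp x * sin (t * Y x) \<partial>M) = (\<integral>x. Wn x * sin (t * Y x) \<partial>M)"
        using split[of "\<lambda>y. sin (t * y)"] s[of t] by simp
      ultimately show "char (\<nu> Wp) t = char (\<nu> Wn) t"
        using ch[OF Wi(1) W0(1)] ch[OF Wi(2) W0(2)] by simp
    qed
    then have eq: "\<nu> Wp = \<nu> Wn"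
      by (intro Levy_uniqueness rd Wi W0) (auto simp: m_def m'[unfolded m_def])
    have "(\<integral>x. (Wp x / m) *\<^sub>R indicat_real A (Y x) \<partial>M) = (\<integral>y. indicat_real A y \<partial>\<nu> Wp)"
      by (rule int\<nu>[symmetric]) (auto simp: W0)
    also have "\<dots> = (\<integral>x. (Wn x / m) *\<^sub>R indicat_real A (Y x) \<partial>M)"
      unfolding eq by (rule int\<nu>) (auto simp: W0)
    finally have "(\<integral>x. Wp x * indicat_real A (Y x) / m \<partial>M) = (\<integral>x. Wn x * indicat_real A (Y x) / m \<partial>M)"
      by simp
    then have "(\<integral>x. Wp x * indicat_real A (Y x) \<partial>M) = (\<integral>x. Wn x * indicat_real A (Y x) \<partial>M)"
      using m by simp
    then show ?thesis using split[of "indicat_real A"] by (auto simp: indicator_def)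
  qed
qed

text \<open>Induction over the coordinates, replacing one trigonometric factor at a time by an
  indicator. For fixed frequencies of the others, the one-dimensional result is applied in the last
  variable to the weights \<open>W * cos\<close> and \<open>W * sin\<close>. The weight
  \<open>W\<close> has to be arbitrary because the indicator just gained is absorbed into
  it.\<close>

lemma fourier_zero_imp_zero_rectangle:
  fixes W :: "'a \<Rightarrow> real" and Y :: "nat \<Rightarrow> 'a \<Rightarrow> real"
  assumes M: "prob_space M"
  shows "integrable M W \<Longrightarrow> (\<And>i. i < n \<Longrightarrow> Y i \<in> borel_measurable M) \<Longrightarrow>
    (\<And>t. (\<integral>x. W x * cos (\<Sum>i<n. t i * Y i x) \<partial>M) = 0) \<Longrightarrow>
    (\<And>t. (\<integral>x. W x * sin (\<Sum>i<n. t i * Y i x) \<partial>M) = 0) \<Longrightarrow>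
    (\<And>i. i < n \<Longrightarrow> A i \<in> sets borel) \<Longrightarrow>
    (\<integral>x. W x * (\<Prod>i<n. indicator (A i) (Y i x)) \<partial>M) = 0"
proof (induction n arbitrary: W)
  case 0
  then show ?case by simp
next
  case (Suc n)
  interpret prob_space M by fact
  have [measurable]: "W \<in> borel_measurable M" using Suc.prems by auto
  have Y[measurable]: "Y i \<in> borel_measurable M" if "i \<le> n" for i using Suc.prems(2) that by auto
  have [measurable]: "A n \<in> sets borel" using Suc.prems by auto
  define c where "c t x = (\<Sum>i<n. t i * Y i x)" for t x
  have c[measurable]: "c t \<in> borel_measurable M" for t unfolding c_def by auto
  have Wg: "integrable M (\<lambda>x. W x * g x)" if "g \<in> borel_measurable M" "\<And>y. \<bar>g y\<bar> \<le> 1" for g :: "'a \<Rightarrow> real"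
  proof (rule Bochner_Integration.integrable_bound[OF Suc.prems(1)])
    show "(\<lambda>x. W x * g x) \<in> borel_measurable M" using that(1) by auto
    show "AE x in M. norm (W x * g x) \<le> norm (W x)"
      using that(2) by (auto simp: abs_mult intro!: mult_left_le)
  qed
  have ct: "c (t(n := s)) x = c t x" for t s x
    unfolding c_def by (intro sum.cong) auto
  have C: "(\<integral>x. W x * cos (c t x + s * Y n x) \<partial>M) = 0" for s t
    using Suc.prems(3)[of "t(n := s)"] by (simp add: c_def[symmetric] ct)
  have S: "(\<integral>x. W x * sin (c t x + s * Y n x) \<partial>M) = 0" for s t
    using Suc.prems(4)[of "t(n := s)"] by (simp add: c_def[symmetric] ct)
  have i1: "integrable M (\<lambda>x. W x * cos (c t x + s * Y n x))" "integrable M (\<lambda>x. W x * sin (c t x + s * Y n x))" for t s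
    by (intro Wg; auto)+
  \<comment> \<open>Used for the product-to-sum formulas: each product of trigonometric factors is
    half the sum or difference of two integrands covered by the hypotheses.\<close>
  have half: "(\<integral>x. F x \<partial>M) = 0" if "\<And>x. F x = (G x + s * H x) / 2" "integrable M G" "integrable M H" "(\<integral>x. G x \<partial>M) = 0" "(\<integral>x. H x \<partial>M) = 0"
    for F G H and s :: real
  proof -
    have "F = (\<lambda>x. (G x + s * H x) / 2)" using that(1) by auto
    then show ?thesis using that(2-) by simp
  qed
  have cc: "(\<integral>x. (W x * cos (c t x)) * cos (s * Y n x) \<partial>M) = 0" for s t
    by (rule half[of _ "\<lambda>x. W x * cos (c t x + s * Y n x)" 1 "\<lambda>x. W x * cos (c t x + (-s) * Y n x)", OF _ i1(1) i1(1) C C])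
       (simp add: cos_add cos_diff algebra_simps)
  have cs: "(\<integral>x. (W x * cos (c t x)) * sin (s * Y n x) \<partial>M) = 0" for s t
    by (rule half[of _ "\<lambda>x. W x * sin (c t x + s * Y n x)" "-1" "\<lambda>x. W x * sin (c t x + (-s) * Y n x)", OF _ i1(2) i1(2) S S])
       (simp add: sin_add sin_diff algebra_simps)
  have sc: "(\<integral>x. (W x * sin (c t x)) * cos (s * Y n x) \<partial>M) = 0" for s t
    by (rule half[of _ "\<lambda>x. W x * sin (c t x + s * Y n x)" 1 "\<lambda>x. W x * sin (c t x + (-s) * Y n x)", OF _ i1(2) i1(2) S S])
       (simp add: sin_add sin_diff algebra_simps)
  have ss: "(\<integral>x. (W x * sin (c t x)) * sin (s * Y n x) \<partial>M) = 0" for s t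
    by (rule half[of _ "\<lambda>x. W x * cos (c t x + (-s) * Y n x)" "-1" "\<lambda>x. W x * cos (c t x + s * Y n x)", OF _ i1(1) i1(1) C C])
       (simp add: cos_add cos_diff algebra_simps)
  define W' where "W' x = W x * indicator (A n) (Y n x)" for x
  have "(\<integral>x. W' x * (\<Prod>i<n. indicator (A i) (Y i x)) \<partial>M) = 0"
  proof (rule Suc.IH)
    show "integrable M W'" unfolding W'_def by (intro Wg) (auto simp: indicator_def)
    show "(\<integral>x. W' x * cos (\<Sum>i<n. t i * Y i x) \<partial>M) = 0" for t
      using fourier_zero_imp_zero_real[OF M Wg[of "\<lambda>x. cos (c t x)"] Y[of n] cc cs, of "A n"]
      by (simp add: W'_def c_def[symmetric] mult_ac)
    show "(\<integral>x. W' x * sin (\<Sum>i<n. t i * Y i x) \<partial>M) = 0" for t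
      using fourier_zero_imp_zero_real[OF M Wg[of "\<lambda>x. sin (c t x)"] Y[of n] sc ss, of "A n"]
      by (simp add: W'_def c_def[symmetric] mult_ac)
  qed (use Suc.prems in auto)
  then show ?case by (simp add: W'_def mult_ac)
qed

text \<open>The variance of \<open>a Z + b Y\<close> has no mixed term, so the mean of
  \<open>cos (a Z + Y)\<close> does not change with the sign in front of \<open>Y\<close>; the mean
  of \<open>sin (a Z) * sin Y\<close> is thus zero. The mean of \<open>sin (a Z) * cos Y\<close>
  vanishes since all sine means do. Dividing by \<open>a\<close> and letting \<open>a\<close> tend
  to 0 replaces \<open>sin (a Z)\<close> by \<open>Z\<close>.\<close>

lemma uncorrelated_gaussian_fourier:
  fixes Z Y :: "'a \<Rightarrow> real"
  assumes M: "prob_space M" and [measurable]: "Z \<in> borel_measurable M" "Y \<in> borel_measurable M"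
    and g: "\<And>a b. centered_gaussian_real (distr M borel (\<lambda>x. a * Z x + b * Y x))"
    and uncor: "(\<integral>x. Z x * Y x \<partial>M) = 0"
  shows "(\<integral>x. Z x * cos (Y x) \<partial>M) = 0" "(\<integral>x. Z x * sin (Y x) \<partial>M) = 0"
proof -
  interpret prob_space M by fact
  note mom = centered_gaussian_moments[OF M _ g, simplified]
  have sqZ: "sq_int M Z" and sqY: "sq_int M Y"
    using mom(2)[of 1 0] mom(2)[of 0 1] by (auto simp: sq_int_def)
  have Zi: "integrable M Z" using mom(1)[of 1 0] by auto
  have var: "(\<integral>x. (a * Z x + b * Y x)\<^sup>2 \<partial>M) = a\<^sup>2 * (\<integral>x. (Z x)\<^sup>2 \<partial>M) + b\<^sup>2 * (\<integral>x. (Y x)\<^sup>2 \<partial>M)" for a b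
  proof -
    have "(\<integral>x. (a * Z x + b * Y x)\<^sup>2 \<partial>M) = (\<integral>x. a\<^sup>2 * (Z x)\<^sup>2 + b\<^sup>2 * (Y x)\<^sup>2 + 2 * a * b * (Z x * Y x) \<partial>M)"
      by (simp add: power2_sum power_mult_distrib mult_ac)
    then show ?thesis
      using sq_int_square[OF sqZ] sq_int_square[OF sqY] sq_int_mult_integrable[OF sqZ sqY] uncor by simp
  qed
  have ib: "integrable M g" if "g \<in> borel_measurable M" "\<And>x. \<bar>g x\<bar> \<le> 1" for g :: "'a \<Rightarrow> real"
    using that by (intro integrable_const_bound[where B=1]) auto
  have half: "(\<integral>x. F x \<partial>M) = 0" if "\<And>x. F x = (G x + s * H x) / 2" "integrable M G" "integrable M H" "(\<integral>x. G x \<partial>M) + s * (\<integral>x. H x \<partial>M) = 0"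
    for F G H and s :: real
  proof -
    have "F = (\<lambda>x. (G x + s * H x) / 2)" using that(1) by auto
    then show ?thesis using that(2-) by simp
  qed
  have ic: "integrable M (\<lambda>x. cos (a * Z x + b * Y x))" and isn: "integrable M (\<lambda>x. sin (a * Z x + b * Y x))" for a b
    by (rule ib; simp)+
  have ss: "(\<integral>x. sin (a * Z x) * sin (Y x) \<partial>M) = 0" for a
  proof (rule half[of _ "\<lambda>x. cos (a * Z x + (-1) * Y x)" "-1" "\<lambda>x. cos (a * Z x + 1 * Y x)", OF _ ic ic])
    show "(\<integral>x. cos (a * Z x + (-1) * Y x) \<partial>M) + (-1) * (\<integral>x. cos (a * Z x + 1 * Y x) \<partial>M) = 0"
      unfolding mom(5) var by simp
  qed (simp add: cos_add cos_diff)
  have sc: "(\<integral>x. sin (a * Z x) * cos (Y x) \<partial>M) = 0" for a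
  proof (rule half[of _ "\<lambda>x. sin (a * Z x + (-1) * Y x)" "1" "\<lambda>x. sin (a * Z x + 1 * Y x)", OF _ isn isn])
    show "(\<integral>x. sin (a * Z x + (-1) * Y x) \<partial>M) + 1 * (\<integral>x. sin (a * Z x + 1 * Y x) \<partial>M) = 0"
      unfolding mom(6) by simp
  qed (simp add: sin_add sin_diff)
  \<comment> \<open>The limit is taken along \<open>a = 1 / Suc k\<close>; the inequality between a
    sine and its argument gives the integrable bound \<open>\<bar>Z x\<bar>\<close>.\<close>
  have lim: "(\<integral>x. Z x * h x \<partial>M) = 0"
    if h[measurable]: "h \<in> borel_measurable M" and hb: "\<And>x. \<bar>h x\<bar> \<le> 1" and z: "\<And>a. (\<integral>x. sin (a * Z x) * h x \<partial>M) = 0" for h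
  proof -
    have "(\<lambda>k. \<integral>x. (real (Suc k) * sin (Z x / real (Suc k))) * h x \<partial>M) \<longlonglongrightarrow> (\<integral>x. Z x * h x \<partial>M)"
    proof (rule integral_dominated_convergence[where w="\<lambda>x. \<bar>Z x\<bar>"])
      show "integrable M (\<lambda>x. \<bar>Z x\<bar>)" using Zi by simp
      have "(\<lambda>k. real (Suc k) * sin (z / real (Suc k))) \<longlonglongrightarrow> z" for z :: real
      proof -
        have "((\<lambda>a. sin (a * z) / a) \<longlongrightarrow> z) (at 0)"
        proof -
          have "((\<lambda>a. sin (a * z)) has_real_derivative (cos (0 * z) * z)) (at 0)"
            by (auto intro!: derivative_eq_intros)
          then show ?thesis by (simp add: has_field_derivative_iff)
        qed
        then have "(\<lambda>k. sin (inverse (real (Suc k)) * z) / inverse (real (Suc k))) \<longlonglongrightarrow> z"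
          by (rule tendsto_compose_eventually[OF _ LIMSEQ_inverse_real_of_nat, where g="\<lambda>a. sin (a * z) / a"]) auto
        then show ?thesis by (simp add: field_simps del: of_nat_Suc)
      qed
      then show "AE x in M. (\<lambda>k. (real (Suc k) * sin (Z x / real (Suc k))) * h x) \<longlonglongrightarrow> Z x * h x"
        by (intro AE_I2 tendsto_mult tendsto_const)
      show "AE x in M. norm ((real (Suc k) * sin (Z x / real (Suc k))) * h x) \<le> \<bar>Z x\<bar>" for k
      proof (intro AE_I2)
        fix x
        have "\<bar>sin (Z x / real (Suc k))\<bar> \<le> \<bar>Z x / real (Suc k)\<bar>" by (rule abs_sin_x_le_abs_x)
        then have "real (Suc k) * \<bar>sin (Z x / real (Suc k))\<bar> \<le> \<bar>Z x\<bar>"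
          by (simp add: field_simps del: of_nat_Suc)
        then have "(real (Suc k) * \<bar>sin (Z x / real (Suc k))\<bar>) * \<bar>h x\<bar> \<le> \<bar>Z x\<bar> * 1"
          by (intro mult_mono hb) auto
        then show "norm ((real (Suc k) * sin (Z x / real (Suc k))) * h x) \<le> \<bar>Z x\<bar>"
          by (simp add: abs_mult del: of_nat_Suc)
      qed
    qed auto
    moreover have "(\<integral>x. (real (Suc k) * sin (Z x / real (Suc k))) * h x \<partial>M) = 0" for k
    proof -
      have "(\<integral>x. (real (Suc k) * sin (Z x / real (Suc k))) * h x \<partial>M) = (\<integral>x. real (Suc k) * (sin ((1 / real (Suc k)) * Z x) * h x) \<partial>M)"
        by (simp add: mult.assoc del: of_nat_Suc)
      then show ?thesis using z[of "1 / real (Suc k)"] by (simp del: of_nat_Suc)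
    qed
    ultimately show ?thesis by (simp add: LIMSEQ_const_iff)
  qed
  show "(\<integral>x. Z x * cos (Y x) \<partial>M) = 0" by (rule lim[OF _ _ sc]) auto
  show "(\<integral>x. Z x * sin (Y x) \<partial>M) = 0" by (rule lim[OF _ _ ss]) auto
qed

text \<open>The signed measure with density \<open>Z\<close>, pushed forward by \<open>Y\<close>, vanishes by Fourier uniqueness;
  hence \<open>Z\<close> is orthogonal to every square integrable function of \<open>Y\<close>.\<close>

lemma gaussian_nonlinear_approximation_ge:
  fixes Z :: "'a \<Rightarrow> real" and Y :: "nat \<Rightarrow> 'a \<Rightarrow> real"
  assumes M: "prob_space M" and Zm[measurable]: "Z \<in> borel_measurable M"
    and Y: "\<And>i. i < n \<Longrightarrow> Y i \<in> borel_measurable M"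
    and g: "\<And>a t. centered_gaussian_real (distr M borel (\<lambda>x. a * Z x + (\<Sum>i<n. t i * Y i x)))"
    and uncor: "\<And>i. i < n \<Longrightarrow> (\<integral>x. Z x * Y i x \<partial>M) = 0"
    and h[measurable]: "h \<in> borel_measurable (PiM {..<n} (\<lambda>_. borel))"
  shows "ennreal (\<integral>x. (Z x)\<^sup>2 \<partial>M) \<le> (\<integral>\<^sup>+x. ennreal ((Z x - h (restrict (\<lambda>i. Y i x) {..<n}))\<^sup>2) \<partial>M)"
proof -
  interpret prob_space M by fact
  define T where "T x = restrict (\<lambda>i. Y i x) {..<n}" for x
  have T[measurable]: "T \<in> measurable M (PiM {..<n} (\<lambda>_. borel))"
    unfolding T_def using Y by (intro measurable_restrict) auto
  have [measurable]: "(\<lambda>x. \<Sum>i<n. t i * Y i x) \<in> borel_measurable M" for t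
    using Y by auto
  have g': "centered_gaussian_real (distr M borel (\<lambda>x. a * Z x + b * (\<Sum>i<n. t i * Y i x)))" for a b t
    using g[of a "\<lambda>i. b * t i"] by (simp add: sum_distrib_left mult.assoc)
  have sqZ: "sq_int M Z"
    using centered_gaussian_moments(2)[OF M _ g[of 1 "\<lambda>_. 0"]] by (auto simp: sq_int_def)
  have Zi: "integrable M Z"
    using centered_gaussian_moments(1)[OF M _ g[of 1 "\<lambda>_. 0"]] by auto
  have sqY: "sq_int M (Y i)" if "i < n" for i
    using centered_gaussian_moments(2)[OF M _ g[of 0 "\<lambda>j. if j = i then 1 else 0"]] that Y[OF that]
      sum_kronecker[OF that, of "\<lambda>j. Y j _"] by (auto simp: sq_int_def mult.commute)
  have un: "(\<integral>x. Z x * (\<Sum>i<n. t i * Y i x) \<partial>M) = 0" for t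
    using integral_lincomb_mult[of "{..<n}" M Y Z t] sqY sqZ uncor by (simp add: mult.commute)
  have rect: "(\<integral>x. Z x * (\<Prod>i<n. indicator (A i) (Y i x)) \<partial>M) = 0" if "\<And>i. i < n \<Longrightarrow> A i \<in> sets borel" for A
    by (rule fourier_zero_imp_zero_rectangle[OF M Zi Y])
       (auto intro!: uncorrelated_gaussian_fourier[OF M] g' un that)
  define \<nu> where "\<nu> V = distr (density M (\<lambda>x. ennreal (V x))) (PiM {..<n} (\<lambda>_. borel)) T" for V :: "'a \<Rightarrow> real"
  define Zp where "Zp x = max 0 (Z x)" for x
  define Zn where "Zn x = max 0 (- Z x)" for x
  have Zi': "integrable M Zp" "integrable M Zn" unfolding Zp_def Zn_def using Zi by auto
  have [measurable]: "Zp \<in> borel_measurable M" "Zn \<in> borel_measurable M" using Zi' by auto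
  have Z0: "Zp x \<ge> 0" "Zn x \<ge> 0" for x by (auto simp: Zp_def Zn_def)
  have Zd: "Z x = Zp x - Zn x" for x by (auto simp: Zp_def Zn_def)
  have em: "emeasure (\<nu> V) (Pi\<^sub>E {..<n} A) = ennreal (\<integral>x. V x * (\<Prod>i<n. indicator (A i) (Y i x)) \<partial>M)"
    if V: "integrable M V" "\<And>x. V x \<ge> 0" and A: "\<And>i. i < n \<Longrightarrow> A i \<in> sets borel" for V A
  proof -
    have [measurable]: "V \<in> borel_measurable M" using V by auto
    have [measurable]: "Pi\<^sub>E {..<n} A \<in> sets (PiM {..<n} (\<lambda>_. borel))"
      using A by (intro sets_PiM_I_finite) auto
    have i: "(indicator (T -` Pi\<^sub>E {..<n} A \<inter> space M) x :: real) = (\<Prod>i<n. indicator (A i) (Y i x))" if "x \<in> space M" for x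
    proof (cases "\<forall>i<n. Y i x \<in> A i")
      case True
      then show ?thesis using that by (auto simp: T_def PiE_def indicator_def extensional_def)
    next
      case False
      then obtain i where "i < n" "Y i x \<notin> A i" by auto
      then have "(\<Prod>i<n. indicator (A i) (Y i x)) = (0::real)" by (intro prod_zero) (auto intro!: bexI[of _ i])
      moreover have "T x \<notin> Pi\<^sub>E {..<n} A" using \<open>i < n\<close> \<open>Y i x \<notin> A i\<close> by (auto simp: T_def PiE_def Pi_def)
      ultimately show ?thesis by auto
    qed
    have "emeasure (\<nu> V) (Pi\<^sub>E {..<n} A) = emeasure (density M (\<lambda>x. ennreal (V x))) (T -` Pi\<^sub>E {..<n} A \<inter> space M)"
      unfolding \<nu>_def by (subst emeasure_distr) auto
    also have "\<dots> = (\<integral>\<^sup>+x. ennreal (V x) * indicator (T -` Pi\<^sub>E {..<n} A \<inter> space M) x \<partial>M)"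
      by (rule emeasure_density) auto
    also have "\<dots> = (\<integral>\<^sup>+x. ennreal (V x * (\<Prod>i<n. indicator (A i) (Y i x))) \<partial>M)"
    proof (intro nn_integral_cong)
      fix x assume "x \<in> space M"
      have "ennreal (V x) * indicator (T -` Pi\<^sub>E {..<n} A \<inter> space M) x = ennreal (V x * indicator (T -` Pi\<^sub>E {..<n} A \<inter> space M) x)"
        by (simp add: indicator_def)
      then show "ennreal (V x) * indicator (T -` Pi\<^sub>E {..<n} A \<inter> space M) x = ennreal (V x * (\<Prod>i<n. indicator (A i) (Y i x)))"
        using i[OF \<open>x \<in> space M\<close>] by simp
    qed
    also have "\<dots> = ennreal (\<integral>x. V x * (\<Prod>i<n. indicator (A i) (Y i x)) \<partial>M)"
    proof (rule nn_integral_eq_integral)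
      have "(\<lambda>x. \<Prod>i<n. indicator (A i) (Y i x) :: real) \<in> borel_measurable M"
        using Y A by (intro borel_measurable_prod) auto
      then show "integrable M (\<lambda>x. V x * (\<Prod>i<n. indicator (A i) (Y i x)))"
        by (intro Bochner_Integration.integrable_bound[OF V(1)])
           (auto simp: abs_mult abs_prod intro!: mult_left_le prod_le_1)
      show "AE x in M. 0 \<le> V x * (\<Prod>i<n. indicator (A i) (Y i x))"
        using V(2) by (auto intro!: mult_nonneg_nonneg prod_nonneg)
    qed
    finally show ?thesis .
  qed
  \<comment> \<open>Rectangles are stable under intersection and generate the product sigma algebra,
    and the total mass is finite; agreement on them is therefore enough.\<close>
  have eq: "\<nu> Zp = \<nu> Zn"
  proof (rule measure_eqI_PiM_finite[of "{..<n}" _ "\<lambda>_. borel" _ "\<lambda>_::nat. space (PiM {..<n} (\<lambda>_. borel))"])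
    fix A :: "nat \<Rightarrow> real set" assume "\<And>i. i \<in> {..<n} \<Longrightarrow> A i \<in> sets borel"
    then have A: "\<And>i. i < n \<Longrightarrow> A i \<in> sets borel" by auto
    have pm: "(\<lambda>x. \<Prod>i<n. indicator (A i) (Y i x) :: real) \<in> borel_measurable M"
      using Y A by (intro borel_measurable_prod) auto
    have pi: "integrable M (\<lambda>x. V x * (\<Prod>i<n. indicator (A i) (Y i x)))" if "integrable M V" for V :: "'a \<Rightarrow> real"
      using pm that by (intro Bochner_Integration.integrable_bound[OF that])
           (auto simp: abs_mult abs_prod intro!: mult_left_le prod_le_1)
    have "(\<integral>x. Zp x * (\<Prod>i<n. indicator (A i) (Y i x)) \<partial>M) = (\<integral>x. Zn x * (\<Prod>i<n. indicator (A i) (Y i x)) \<partial>M)"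
      using rect[of A, OF A] pi[OF Zi'(1)] pi[OF Zi'(2)] by (simp add: Zd left_diff_distrib)
    then show "emeasure (\<nu> Zp) (Pi\<^sub>E {..<n} A) = emeasure (\<nu> Zn) (Pi\<^sub>E {..<n} A)"
      using em[OF Zi'(1) Z0(1) A] em[OF Zi'(2) Z0(2) A] by simp
  next
    show "emeasure (\<nu> Zp) (space (PiM {..<n} (\<lambda>_. borel))) \<noteq> \<infinity>"
      using em[OF Zi'(1) Z0(1), of "\<lambda>_. UNIV"] by (simp add: space_PiM)
    show "range (\<lambda>_::nat. space (PiM {..<n} (\<lambda>_. borel :: real measure))) \<subseteq> prod_algebra {..<n} (\<lambda>_. borel)"
      by (auto simp: space_PiM intro!: prod_algebraI_finite)
  qed (auto simp: \<nu>_def)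
  have int\<nu>: "(\<integral>y. h y \<partial>\<nu> V) = (\<integral>x. V x * h (T x) \<partial>M)"
    if [measurable]: "V \<in> borel_measurable M" and "\<And>x. V x \<ge> 0" for V
    unfolding \<nu>_def using that by (subst integral_distr; (subst integral_density)?) auto
  show ?thesis
  proof (cases "(\<integral>\<^sup>+x. ennreal ((Z x - h (T x))\<^sup>2) \<partial>M) = \<infinity>")
    case True
    then show ?thesis by (simp add: T_def)
  next
    case False
    then have i: "integrable M (\<lambda>x. (Z x - h (T x))\<^sup>2)"
      by (intro integrableI_nonneg) (auto simp: top.not_eq_extremum)
    then have sqd: "sq_int M (\<lambda>x. Z x - h (T x))" by (auto simp: sq_int_def)
    \<comment> \<open>Finite error forces \<open>h (T x)\<close> to be square integrable, being the
      difference of two square integrable functions, so the product with \<open>Z\<close> may be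
      integrated.\<close>
    have sqh: "sq_int M (\<lambda>x. h (T x))" using sq_int_diff[OF sqZ sqd] by simp
    have sqp: "sq_int M Zp" "sq_int M Zn"
      using sq_int_square[OF sqZ]
      by (auto simp: sq_int_def Zp_def Zn_def max_def intro!: Bochner_Integration.integrable_bound[OF sq_int_square[OF sqZ]])
    have "(\<integral>x. Z x * h (T x) \<partial>M) = (\<integral>x. Zp x * h (T x) \<partial>M) - (\<integral>x. Zn x * h (T x) \<partial>M)"
      using sq_int_mult_integrable[OF sqp(1) sqh] sq_int_mult_integrable[OF sqp(2) sqh] by (simp add: Zd left_diff_distrib)
    also have "\<dots> = 0" using int\<nu>[of Zp] int\<nu>[of Zn] Z0 eq by simp
    finally have Zh: "(\<integral>x. Z x * h (T x) \<partial>M) = 0" .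
    have "(\<integral>x. (Z x - h (T x))\<^sup>2 \<partial>M) = (\<integral>x. (Z x)\<^sup>2 + (h (T x))\<^sup>2 - 2 * (Z x * h (T x)) \<partial>M)"
      by (simp add: power2_diff mult_ac)
    also have "\<dots> = (\<integral>x. (Z x)\<^sup>2 \<partial>M) + (\<integral>x. (h (T x))\<^sup>2 \<partial>M)"
      using sq_int_square[OF sqZ] sq_int_square[OF sqh] sq_int_mult_integrable[OF sqZ sqh] Zh by simp
    finally have "(\<integral>x. (Z x)\<^sup>2 \<partial>M) \<le> (\<integral>x. (Z x - h (T x))\<^sup>2 \<partial>M)" by simp
    moreover have "(\<integral>\<^sup>+x. ennreal ((Z x - h (T x))\<^sup>2) \<partial>M) = ennreal (\<integral>x. (Z x - h (T x))\<^sup>2 \<partial>M)"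
      using i by (intro nn_integral_eq_integral) auto
    ultimately show ?thesis by (simp add: T_def ennreal_leI)
  qed
qed

section \<open>Gaussian random functions\<close>

text \<open>One point is taken from every basic open set that meets \<open>S\<close>. The dense
  points must lie in \<open>S\<close> itself: later they have to be elements of \<open>V\<close> or
  to come from actual evaluation points.\<close>

lemma countable_dense_subset_of:
  fixes S :: "'a::second_countable_topology set"
  obtains T where "countable T" "T \<subseteq> S" "S \<subseteq> closure T"
proof -
  obtain B :: "'a set set" where B: "countable B" "topological_basis B"
    using ex_countable_basis by blast
  define T where "T = (\<lambda>b. SOME x. x \<in> b \<inter> S) ` {b \<in> B. b \<inter> S \<noteq> {}}"
  have in_T: "(SOME x. x \<in> b \<inter> S) \<in> b \<inter> S" if "b \<inter> S \<noteq> {}" for b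
    using that by (meson someI_ex ex_in_conv)
  show ?thesis
  proof
    show "countable T" unfolding T_def using B by (intro countable_image) auto
    show "T \<subseteq> S" unfolding T_def using in_T by auto
    show "S \<subseteq> closure T"
    proof
      fix x assume x: "x \<in> S"
      show "x \<in> closure T"
        unfolding closure_iff_nhds_not_empty
      proof (intro allI impI)
        fix A U assume "U \<subseteq> A" "open U" "x \<in> U"
        then obtain b where b: "b \<in> B" "x \<in> b" "b \<subseteq> U"
          using topological_basisE[OF B(2)] by metis
        then have "b \<inter> S \<noteq> {}" using x by auto
        then have "(SOME x. x \<in> b \<inter> S) \<in> T \<inter> b"
          using in_T b unfolding T_def by auto
        then show "T \<inter> A \<noteq> {}" using b \<open>U \<subseteq> A\<close> by auto
      qed
    qed
  qed
qed

text \<open>One fixed dimension, with the weight absorbed into the probability measure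
  \<open>P\<close>, so that the norm of \<open>G_d\<close> is the plain \<open>L_2\<close> norm of
  \<open>P\<close>. Evaluations are linear on the ambient space, whereas regularity in
  \<open>x\<close> is available only for elements of \<open>V\<close>.\<close>

locale gaussian_approximation =
  fixes \<mu> :: "'f::{banach, second_countable_topology} measure" and V :: "'f set"
    and P :: "'x measure" and ev :: "'f \<Rightarrow> 'x \<Rightarrow> real"
  assumes prob_\<mu>: "prob_space \<mu>" and sets_\<mu>: "sets \<mu> = sets borel"
    and closed_V: "closed V" and emeasure_V: "emeasure \<mu> V = 1"
    and gaussian: "\<And>L. bounded_linear L \<Longrightarrow> centered_gaussian_real (distr \<mu> borel L)"
    and prob_P: "prob_space P"
    and ev_linear: "\<And>x. x \<in> space P \<Longrightarrow> bounded_linear (\<lambda>f. ev f x)"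
    and ev_measurable: "\<And>f. f \<in> V \<Longrightarrow> ev f \<in> borel_measurable P"
    and ev_sq: "\<And>f. f \<in> V \<Longrightarrow> (\<integral>\<^sup>+x. ennreal ((ev f x)\<^sup>2) \<partial>P) < \<infinity>"
begin

sublocale M: prob_space \<mu> by (rule prob_\<mu>)
sublocale P: prob_space P by (rule prob_P)
sublocale MP: pair_prob_space \<mu> P ..

declare sets_\<mu>[measurable_cong]

text \<open>Truncation to \<open>V\<close>: outside \<open>V\<close> nothing is known about measurability of \<open>ev f\<close>.\<close>

definition app :: "'f \<Rightarrow> 'x \<Rightarrow> real" where
  "app f x = (if f \<in> V then ev f x else 0)"

lemma V_sets[measurable]: "V \<in> sets borel"
  using closed_V by auto

lemma AE_V: "AE f in \<mu>. f \<in> V"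
  by (rule M.AE_prob_1) (simp add: measure_def emeasure_V)

lemma AE_app: "AE f in \<mu>. \<forall>x. app f x = ev f x"
  using AE_V by eventually_elim (auto simp: app_def)

lemma V_nonempty: "V \<noteq> {}"
  using emeasure_V by auto

lemma bounded_linear_measurable: "bounded_linear L \<Longrightarrow> L \<in> borel_measurable \<mu>" for L :: "'f \<Rightarrow> real"
  by (subst measurable_cong_sets[OF sets_\<mu> refl])
     (intro borel_measurable_continuous_onI linear_continuous_on)

lemma bounded_linear_moments:
  fixes L :: "'f \<Rightarrow> real"
  assumes "bounded_linear L"
  shows "integrable \<mu> L" "integrable \<mu> (\<lambda>x. (L x)\<^sup>2)" "integrable \<mu> (\<lambda>x. (L x) ^ 4)"
    "(\<integral>x. (L x) ^ 4 \<partial>\<mu>) = 3 * (\<integral>x. (L x)\<^sup>2 \<partial>\<mu>)\<^sup>2"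
    "(\<integral>x. cos (L x) \<partial>\<mu>) = exp (- (\<integral>x. (L x)\<^sup>2 \<partial>\<mu>) / 2)"
  using centered_gaussian_moments[OF prob_\<mu> bounded_linear_measurable[OF assms] gaussian[OF assms]] by auto

lemma bounded_linear_sq_int: "bounded_linear L \<Longrightarrow> sq_int \<mu> L" for L :: "'f \<Rightarrow> real"
  using bounded_linear_measurable bounded_linear_moments(2) by (auto simp: sq_int_def)

lemma app_measurable_1[measurable]: "app f \<in> borel_measurable P"
proof -
  have "app f = (if f \<in> V then ev f else (\<lambda>_. 0))" by (auto simp: app_def)
  then show ?thesis using ev_measurable by auto
qed

lemma dense_sequence:
  "\<exists>q :: nat \<Rightarrow> 'f. (\<forall>i. q i \<in> V) \<and> (\<forall>f\<in>V. \<forall>e>0. \<exists>i. dist f (q i) < e)"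
proof -
  obtain T where T: "countable T" "T \<subseteq> V" "V \<subseteq> closure T" using countable_dense_subset_of by blast
  then have "T \<noteq> {}" using V_nonempty by force
  have "\<exists>i. dist f (from_nat_into T i) < e" if "f \<in> V" "e > 0" for f e
  proof -
    have "f \<in> closure T" using T(3) that(1) by blast
    from this[unfolded closure_approachable] that(2) obtain y where "y \<in> T" "dist y f < e" by blast
    then show ?thesis using T(1) from_nat_into_surj[of T y] by (auto simp: dist_commute)
  qed
  moreover have "from_nat_into T i \<in> V" for i
    using T(2) from_nat_into[OF \<open>T \<noteq> {}\<close>, of i] by (rule subsetD)
  ultimately show ?thesis by (intro exI[of _ "from_nat_into T"] conjI allI ballI impI)
qed

text \<open>On \<open>V\<close> the map is continuous in \<open>f\<close> and measurable in
  \<open>x\<close>, which suffices in a separable space: \<open>f\<close> is replaced by a member of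
  a dense sequence, chosen measurably, and the approximations converge pointwise.\<close>

lemma app_measurable_pair[measurable]: "(\<lambda>(f, x). app f x) \<in> borel_measurable (\<mu> \<Otimes>\<^sub>M P)"
proof -
  from dense_sequence obtain q :: "nat \<Rightarrow> 'f" where q': "\<forall>i. q i \<in> V"
    and q_dense': "\<forall>f\<in>V. \<forall>e>0. \<exists>i. dist f (q i) < e" by (elim exE conjE)
  have q: "q i \<in> V" for i using q' by (rule spec)
  have q_dense: "\<exists>i. dist f (q i) < e" if "f \<in> V" "e > 0" for f e
    using bspec[OF q_dense' that(1)] that(2) by simp
  \<comment> \<open>Taking the first index that is close enough makes the selection measurable with
    countably many values.\<close>
  define I where "I n f = (LEAST i. dist f (q i) < inverse (real (Suc n)))" for n f
  have I[measurable]: "I n \<in> measurable \<mu> (count_space UNIV)" for n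
    unfolding I_def by (rule measurable_Least) (simp add: measurable_cong_sets[OF sets_\<mu> refl])
  have Iq: "dist f (q (I n f)) < inverse (real (Suc n))" if "f \<in> V" for n f
    unfolding I_def by (rule LeastI_ex) (intro q_dense that, simp)
  define G where "G n z = app (q (I n (fst z))) (snd z) * indicator V (fst z)" for n z
  have "(\<lambda>z. app (q (I n (fst z))) (snd z)) \<in> borel_measurable (\<mu> \<Otimes>\<^sub>M P)" for n
  proof (rule measurable_compose_countable[of "\<lambda>i z. app (q i) (snd z)"])
    show "(\<lambda>z. app (q i) (snd z)) \<in> borel_measurable (\<mu> \<Otimes>\<^sub>M P)" for i
      by (rule measurable_compose[OF measurable_snd app_measurable_1])
    show "(\<lambda>z. I n (fst z)) \<in> measurable (\<mu> \<Otimes>\<^sub>M P) (count_space UNIV)"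
      by (rule measurable_compose[OF measurable_fst I])
  qed
  moreover have "(\<lambda>z. indicator V (fst z) :: real) \<in> borel_measurable (\<mu> \<Otimes>\<^sub>M P)"
    by (rule measurable_compose[OF measurable_fst]) (simp add: measurable_cong_sets[OF sets_\<mu> refl])
  ultimately have "G n \<in> borel_measurable (\<mu> \<Otimes>\<^sub>M P)" for n
    unfolding G_def by (rule borel_measurable_times)
  moreover have "(\<lambda>n. G n z) \<longlonglongrightarrow> app (fst z) (snd z)" if z: "z \<in> space (\<mu> \<Otimes>\<^sub>M P)" for z
  proof (cases "fst z \<in> V")
    case True
    have "(\<lambda>n. q (I n (fst z))) \<longlonglongrightarrow> fst z"
    proof (rule metric_LIMSEQ_I)
      fix r :: real assume "r > 0"
      then obtain N where N: "inverse (real (Suc N)) < r" using reals_Archimedean by blast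
      show "\<exists>N. \<forall>n\<ge>N. dist (q (I n (fst z))) (fst z) < r"
      proof (intro exI[of _ N] allI impI)
        fix n assume "n \<ge> N"
        have "dist (fst z) (q (I n (fst z))) < inverse (real (Suc n))" by (rule Iq[OF True])
        also have "\<dots> \<le> inverse (real (Suc N))" using \<open>n \<ge> N\<close> by (simp add: le_imp_inverse_le)
        finally show "dist (q (I n (fst z))) (fst z) < r" using N by (simp add: dist_commute)
      qed
    qed
    then have "(\<lambda>n. ev (q (I n (fst z))) (snd z)) \<longlonglongrightarrow> ev (fst z) (snd z)"
      using z ev_linear by (intro bounded_linear.tendsto[of "\<lambda>f. ev f (snd z)"]) (auto simp: space_pair_measure)
    then show ?thesis using True q by (simp add: G_def app_def)
  next
    case False
    then show ?thesis by (simp add: G_def app_def)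
  qed
  ultimately show ?thesis
    unfolding case_prod_unfold by (rule borel_measurable_LIMSEQ_real[rotated])
qed

lemma app_measurable_comp[measurable (raw)]:
  assumes "F \<in> measurable N \<mu>" "G \<in> measurable N P"
  shows "(\<lambda>z. app (F z) (G z)) \<in> borel_measurable N"
  using measurable_compose[OF measurable_Pair[OF assms] app_measurable_pair] by simp

lemma app_cong_integral:
  assumes "x \<in> space P" "(\<lambda>f. F f (ev f x)) \<in> borel_measurable \<mu>" "(\<lambda>f. F f (app f x)) \<in> borel_measurable \<mu>"
  shows "(\<integral>f. F f (app f x) \<partial>\<mu>) = (\<integral>f. F f (ev f x) \<partial>\<mu>)"
  using AE_app assms by (intro integral_cong_AE) auto

lemma ev_measurable_2: "x \<in> space P \<Longrightarrow> (\<lambda>f. ev f x) \<in> borel_measurable \<mu>"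
  by (rule bounded_linear_measurable[OF ev_linear])

lemma app_measurable_2: "x \<in> space P \<Longrightarrow> (\<lambda>f. app f x) \<in> borel_measurable \<mu>"
  by (rule app_measurable_comp) auto

text \<open>The diagonal of the covariance kernel of the random function; its integral over
  \<open>P\<close> is the squared error of the zero algorithm.\<close>

definition K :: "'x \<Rightarrow> real" where "K x = (\<integral>f. (app f x)\<^sup>2 \<partial>\<mu>)"

lemma K_measurable[measurable]: "K \<in> borel_measurable P"
  unfolding K_def by measurable

lemma K_eq: "x \<in> space P \<Longrightarrow> K x = (\<integral>f. (ev f x)\<^sup>2 \<partial>\<mu>)"
  unfolding K_def
  by (intro app_cong_integral[of x "\<lambda>_ y. y\<^sup>2"] borel_measurable_power ev_measurable_2 app_measurable_2)

lemma K_nonneg: "K x \<ge> 0"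
  unfolding K_def by simp

text \<open>A zero-one argument in the spirit of Fernique: on an event of probability \<open>11/12\<close>
  the \<open>L\<^sub>2\<close> norm of the path is bounded, and by the fourth moment identity this event
  carries at least half of every variance.\<close>

lemma K_integrable: "integrable P K"
proof -
  define h where "h f = (\<integral>\<^sup>+x. ennreal ((app f x)\<^sup>2) \<partial>P)" for f
  have [measurable]: "h \<in> borel_measurable \<mu>" unfolding h_def by measurable
  have hfin: "h f < top" for f
    using ev_sq[of f] by (cases "f \<in> V") (auto simp: h_def app_def)
  \<comment> \<open>Since \<open>h\<close> is finite on every path, these events exhaust the whole
    space.\<close>
  define E where "E N = {f \<in> space \<mu>. h f \<le> of_nat N}" for N :: nat
  have E[measurable]: "E N \<in> sets \<mu>" for N unfolding E_def by measurable
  have "incseq E"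
  proof (rule incseq_SucI)
    fix N
    have "(of_nat N :: ennreal) \<le> of_nat (Suc N)" by simp
    then show "E N \<subseteq> E (Suc N)" unfolding E_def using order_trans by blast
  qed
  then have "(\<lambda>N. measure \<mu> (E N)) \<longlonglongrightarrow> measure \<mu> (\<Union>N. E N)"
    using E by (intro M.finite_Lim_measure_incseq) auto
  also have "(\<Union>N. E N) = space \<mu>"
    using ennreal_Ex_less_of_nat[OF hfin] by (fastforce simp: E_def dest: less_imp_le)
  finally have "(\<lambda>N. measure \<mu> (E N)) \<longlonglongrightarrow> 1" by (simp add: M.prob_space)
  then have "\<forall>\<^sub>F N in sequentially. measure \<mu> (E N) > 11/12"
    by (rule order_tendstoD) simp
  then obtain N where N: "measure \<mu> (E N) > 11/12"
    by (auto simp: eventually_sequentially)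
  have half: "ennreal (K x) \<le> 2 * (\<integral>\<^sup>+f. ennreal ((app f x)\<^sup>2 * indicator (E N) f) \<partial>\<mu>)" if x: "x \<in> space P" for x
  proof -
    define X where "X f = ev f x" for f
    have X: "bounded_linear X" unfolding X_def by (rule ev_linear[OF x])
    have [measurable]: "X \<in> borel_measurable \<mu>" by (rule bounded_linear_measurable[OF X])
    define s where "s = K x"
    have s: "(\<integral>f. (X f)\<^sup>2 \<partial>\<mu>) = s" using K_eq[OF x] by (simp add: X_def s_def)
    have s4: "(\<integral>f. (X f)^4 \<partial>\<mu>) = 3 * s\<^sup>2" using bounded_linear_moments(4)[OF X] s by simp
    note i2 = bounded_linear_moments(2)[OF X] and i4 = bounded_linear_moments(3)[OF X]
    define R where "R = (\<integral>f. (X f)\<^sup>2 * indicator (space \<mu> - E N) f \<partial>\<mu>)"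
    define Q where "Q = (\<integral>f. (X f)\<^sup>2 * indicator (E N) f \<partial>\<mu>)"
    have iR: "integrable \<mu> (\<lambda>f. (X f)\<^sup>2 * indicator (space \<mu> - E N) f)"
      and iQ: "integrable \<mu> (\<lambda>f. (X f)\<^sup>2 * indicator (E N) f)"
      by (rule Bochner_Integration.integrable_bound[OF i2]; auto simp: indicator_def)+
    have "s = Q + R"
      unfolding Q_def R_def s[symmetric] Bochner_Integration.integral_add[OF iQ iR, symmetric]
      by (intro Bochner_Integration.integral_cong) (auto simp: indicator_def)
    moreover have "R \<le> s / 2"
    proof (cases "s = 0")
      case True
      have "AE f in \<mu>. (X f)\<^sup>2 = 0"
        using integral_nonneg_eq_0_iff_AE[OF i2] s True by simp
      then have "R = (\<integral>f. 0 \<partial>\<mu>)" unfolding R_def by (intro integral_cong_AE) auto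
      then show ?thesis using True by simp
    next
      case False
      then have sp: "s > 0" using K_nonneg[of x] by (simp add: s_def)
      have ii: "integrable \<mu> (indicat_real (space \<mu> - E N))"
        by (rule integrable_real_indicator) (auto simp: M.emeasure_finite less_top[symmetric])
      \<comment> \<open>From \<open>(X^2 - 6 s)^2 >= 0\<close> comes
        \<open>12 s X^2 <= X^4 + 36 s^2\<close>. With fourth moment \<open>3 s^2\<close> and an
        exceptional event of mass at most \<open>1/12\<close>, the right side integrates to at most
        \<open>6 s^2\<close>, which is \<open>12 s\<close> times \<open>s / 2\<close>. This fixes
        the threshold \<open>11/12\<close>.\<close>
      have "12 * s * R = (\<integral>f. 12 * s * ((X f)\<^sup>2 * indicator (space \<mu> - E N) f) \<partial>\<mu>)"
        unfolding R_def by simp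
      also have "\<dots> \<le> (\<integral>f. (X f)^4 + 36 * s\<^sup>2 * indicator (space \<mu> - E N) f \<partial>\<mu>)"
      proof (rule integral_mono)
        fix f
        have "0 \<le> ((X f)\<^sup>2 - 6 * s)\<^sup>2" by simp
        also have "\<dots> = (X f)^4 + 36 * s\<^sup>2 - 12 * s * (X f)\<^sup>2"
          by (simp add: power2_diff power_mult_distrib mult_ac flip: power_mult)
        finally show "12 * s * ((X f)\<^sup>2 * indicator (space \<mu> - E N) f) \<le> (X f)^4 + 36 * s\<^sup>2 * indicator (space \<mu> - E N) f"
          by (auto simp: indicator_def)
      next
        show "integrable \<mu> (\<lambda>f. 12 * s * ((X f)\<^sup>2 * indicator (space \<mu> - E N) f))"
          using iR by simp
        show "integrable \<mu> (\<lambda>f. (X f)^4 + 36 * s\<^sup>2 * indicator (space \<mu> - E N) f)"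
          using i4 ii by (intro Bochner_Integration.integrable_add integrable_mult_right) auto
      qed
      also have "\<dots> = 3 * s\<^sup>2 + 36 * s\<^sup>2 * measure \<mu> (space \<mu> - E N)"
        using i4 s4 ii by (subst Bochner_Integration.integral_add) auto
      also have "measure \<mu> (space \<mu> - E N) = 1 - measure \<mu> (E N)" by (rule M.prob_compl) simp
      also have "3 * s\<^sup>2 + 36 * s\<^sup>2 * (1 - measure \<mu> (E N)) \<le> 3 * s\<^sup>2 + 36 * s\<^sup>2 * (1/12)"
        using N by (intro add_left_mono mult_left_mono) auto
      also have "\<dots> = 12 * s * (s / 2)" by (simp add: power2_eq_square)
      finally show ?thesis using sp by simp
    qed
    ultimately have "s \<le> 2 * Q" by simp
    then have "ennreal (K x) \<le> ennreal (2 * Q)" by (simp add: s_def ennreal_leI)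
    also have "\<dots> = 2 * ennreal Q" by (simp add: ennreal_mult' Q_def)
    also have "ennreal Q = (\<integral>\<^sup>+f. ennreal ((X f)\<^sup>2 * indicator (E N) f) \<partial>\<mu>)"
      unfolding Q_def using iQ by (intro nn_integral_eq_integral[symmetric]) auto
    also have "\<dots> = (\<integral>\<^sup>+f. ennreal ((app f x)\<^sup>2 * indicator (E N) f) \<partial>\<mu>)"
      using AE_app by (intro nn_integral_cong_AE) (auto elim!: eventually_mono simp: X_def)
    finally show ?thesis .
  qed
  \<comment> \<open>After the restriction to \<open>E N\<close>, exchanging the integrals meets the
    squared path norm, which is at most \<open>N\<close> there.\<close>
  have "(\<integral>\<^sup>+x. ennreal (K x) \<partial>P) \<le> (\<integral>\<^sup>+x. 2 * (\<integral>\<^sup>+f. ennreal ((app f x)\<^sup>2 * indicator (E N) f) \<partial>\<mu>) \<partial>P)"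
    by (intro nn_integral_mono half)
  also have "\<dots> = 2 * (\<integral>\<^sup>+x. (\<integral>\<^sup>+f. ennreal ((app f x)\<^sup>2 * indicator (E N) f) \<partial>\<mu>) \<partial>P)"
    by (rule nn_integral_cmult) measurable
  also have "(\<integral>\<^sup>+x. (\<integral>\<^sup>+f. ennreal ((app f x)\<^sup>2 * indicator (E N) f) \<partial>\<mu>) \<partial>P) =
      (\<integral>\<^sup>+f. (\<integral>\<^sup>+x. ennreal ((app f x)\<^sup>2 * indicator (E N) f) \<partial>P) \<partial>\<mu>)"
    by (rule MP.Fubini') measurable
  also have "\<dots> = (\<integral>\<^sup>+f. h f * indicator (E N) f \<partial>\<mu>)"
    unfolding h_def by (intro nn_integral_cong) (auto simp: indicator_def)
  also have "\<dots> \<le> (\<integral>\<^sup>+f. of_nat N \<partial>\<mu>)"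
    by (intro nn_integral_mono) (auto simp: E_def indicator_def)
  also have "\<dots> = of_nat N" by (simp add: M.emeasure_space_1)
  finally have "(\<integral>\<^sup>+x. ennreal (K x) \<partial>P) \<le> 2 * of_nat N" by (auto simp: mult_left_mono)
  also have "\<dots> < \<infinity>" by (simp add: ennreal_mult_less_top of_nat_less_top)
  finally show ?thesis using K_nonneg by (intro integrableI_nonneg) auto
qed

end

section \<open>Consistency of sampling\<close>

context gaussian_approximation
begin

text \<open>Weak-star separability of the evaluations. The operator norm is recorded as an additional
  coordinate, so that convergence of the coordinates includes boundedness.\<close>

lemma weak_star_dense_points:
  "\<exists>y :: nat \<Rightarrow> 'x. (\<forall>j. y j \<in> space P) \<and>
     (\<forall>x\<in>space P. \<exists>k :: nat \<Rightarrow> nat. \<forall>f\<in>V. (\<lambda>i. ev f (y (k i))) \<longlonglongrightarrow> ev f x)"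
proof -
  from dense_sequence obtain q :: "nat \<Rightarrow> 'f" where q': "\<forall>i. q i \<in> V"
    and q_dense': "\<forall>f\<in>V. \<forall>e>0. \<exists>i. dist f (q i) < e" by (elim exE conjE)
  define N where "N x = onorm (\<lambda>f. ev f x)" for x
  \<comment> \<open>Sequences with the product topology form a second countable space, so the image
    of all evaluation points has a countable dense subset of such images.\<close>
  define \<Psi> where "\<Psi> x = (\<lambda>i. case i of 0 \<Rightarrow> N x | Suc j \<Rightarrow> ev (q j) x)" for x
  obtain T where T: "countable T" "T \<subseteq> \<Psi> ` space P" "\<Psi> ` space P \<subseteq> closure T"
    using countable_dense_subset_of by blast
  have "T \<noteq> {}" using T(3) P.not_empty by force
  define y where "y i = inv_into (space P) \<Psi> (from_nat_into T i)" for i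
  have tT: "from_nat_into T i \<in> \<Psi> ` space P" for i
    using T(2) from_nat_into[OF \<open>T \<noteq> {}\<close>, of i] by (rule subsetD)
  have y: "y i \<in> space P" "\<Psi> (y i) = from_nat_into T i" for i
    unfolding y_def using inv_into_into[OF tT] f_inv_into_f[OF tT] by auto
  have Nb: "\<bar>ev f x\<bar> \<le> N x * norm f" if "x \<in> space P" for f x
    using onorm[OF ev_linear[OF that], of f] by (simp add: N_def)
  have "\<exists>k :: nat \<Rightarrow> nat. \<forall>f\<in>V. (\<lambda>i. ev f (y (k i))) \<longlonglongrightarrow> ev f x" if x: "x \<in> space P" for x
  proof -
    have "\<Psi> x \<in> closure T" using T(3) x by blast
    then obtain s where s: "\<And>n. s n \<in> T" "s \<longlonglongrightarrow> \<Psi> x" unfolding closure_sequential by blast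
    have "\<exists>k. from_nat_into T k = s n" for n
      using from_nat_into_surj[OF T(1) s(1)] by blast
    then obtain k where k: "\<And>n. from_nat_into T (k n) = s n" by metis
    have lim: "(\<lambda>n. \<Psi> (y (k n)) i) \<longlonglongrightarrow> \<Psi> x i" for i
    proof -
      have "isCont (\<lambda>g :: nat \<Rightarrow> real. g i) (\<Psi> x)"
        by (rule continuous_on_interior[OF continuous_on_product_coordinates]) simp
      from isCont_tendsto_compose[OF this s(2)] show ?thesis by (simp add: y(2) k)
    qed
    have limN: "(\<lambda>n. N (y (k n))) \<longlonglongrightarrow> N x" using lim[of 0] by (simp add: \<Psi>_def)
    have limq: "(\<lambda>n. ev (q j) (y (k n))) \<longlonglongrightarrow> ev (q j) x" for j using lim[of "Suc j"] by (simp add: \<Psi>_def)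
    have N0: "N x \<ge> 0" unfolding N_def by (rule onorm_pos_le[OF ev_linear[OF x]])
    \<comment> \<open>The usual three-term estimate: convergence holds at the dense
      \<open>q j\<close>, and the functionals eventually have norm below \<open>N x + 1\<close>, so
      the passage from \<open>q j\<close> to \<open>f\<close> is uniform.\<close>
    have "(\<lambda>n. ev f (y (k n))) \<longlonglongrightarrow> ev f x" if f: "f \<in> V" for f
    proof (rule LIMSEQ_I)
      fix r :: real assume r: "r > 0"
      have "r / (3 * (N x + 1)) > 0" using r N0 by simp
      with bspec[OF q_dense' f] obtain j where j: "dist f (q j) < r / (3 * (N x + 1))" by blast
      have d: "(N x + 1) * dist f (q j) < r / 3"
        using j N0 by (simp add: field_simps)
      have "\<forall>\<^sub>F n in sequentially. N (y (k n)) < N x + 1"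
        by (rule order_tendstoD(2)[OF limN]) simp
      moreover have "\<forall>\<^sub>F n in sequentially. dist (ev (q j) (y (k n))) (ev (q j) x) < r / 3"
        using r by (intro tendstoD[OF limq]) auto
      ultimately have "\<forall>\<^sub>F n in sequentially. norm (ev f (y (k n)) - ev f x) < r"
      proof eventually_elim
        case (elim n)
        have l: "ev (f - q j) z = ev f z - ev (q j) z" if "z \<in> space P" for z
          using linear_diff[OF bounded_linear.linear[OF ev_linear[OF that]]] by simp
        have "\<bar>ev f (y (k n)) - ev (q j) (y (k n))\<bar> \<le> N (y (k n)) * dist f (q j)"
          using Nb[OF y(1), of "f - q j" "k n"] l[OF y(1)] by (simp add: dist_norm)
        also have "\<dots> \<le> (N x + 1) * dist f (q j)"
          using elim(1) by (intro mult_right_mono) auto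
        finally have 1: "\<bar>ev f (y (k n)) - ev (q j) (y (k n))\<bar> < r / 3" using d by simp
        have "\<bar>ev f x - ev (q j) x\<bar> \<le> N x * dist f (q j)"
          using Nb[OF x, of "f - q j"] l[OF x] by (simp add: dist_norm)
        also have "\<dots> \<le> (N x + 1) * dist f (q j)"
          by (intro mult_right_mono) auto
        finally have 2: "\<bar>ev f x - ev (q j) x\<bar> < r / 3" using d by simp
        show ?case using 1 2 elim(2) unfolding dist_real_def real_norm_def by linarith
      qed
      then show "\<exists>no. \<forall>n\<ge>no. norm (ev f (y (k n)) - ev f x) < r"
        by (simp add: eventually_sequentially)
    qed
    then show ?thesis by (intro exI[of _ k]) blast
  qed
  then show ?thesis using y(1) by (intro exI[of _ y]) blast
qed

text \<open>Squares have no evident integrable majorant, but cosines are bounded by 1. The mean of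
  \<open>cos (L n f)\<close> tends to 1 by dominated convergence, and it equals \<open>exp\<close>
  of minus half the variance, so taking logarithms finishes.\<close>

lemma gaussian_variance_tendsto_0:
  fixes L :: "nat \<Rightarrow> 'f \<Rightarrow> real"
  assumes L: "\<And>n. bounded_linear (L n)" and lim: "\<And>f. f \<in> V \<Longrightarrow> (\<lambda>n. L n f) \<longlonglongrightarrow> 0"
  shows "(\<lambda>n. \<integral>f. (L n f)\<^sup>2 \<partial>\<mu>) \<longlonglongrightarrow> 0"
proof -
  define \<sigma> where "\<sigma> n = (\<integral>f. (L n f)\<^sup>2 \<partial>\<mu>)" for n
  note [measurable] = bounded_linear_measurable[OF L]
  have "(\<lambda>n. \<integral>f. cos (L n f) \<partial>\<mu>) \<longlonglongrightarrow> (\<integral>f. 1 \<partial>\<mu>)"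
  proof (rule integral_dominated_convergence[where w="\<lambda>_. 1"])
    show "AE f in \<mu>. (\<lambda>n. cos (L n f)) \<longlonglongrightarrow> 1"
      using AE_V
    proof eventually_elim
      case (elim f)
      from tendsto_cos[OF lim[OF elim]] show ?case by simp
    qed
  qed (use bounded_linear_measurable[OF L] in auto)
  moreover have "(\<integral>f. cos (L n f) \<partial>\<mu>) = exp (- \<sigma> n / 2)" for n
    unfolding \<sigma>_def by (rule bounded_linear_moments(5)[OF L])
  ultimately have "(\<lambda>n. exp (- \<sigma> n / 2)) \<longlonglongrightarrow> 1" by (simp add: M.prob_space)
  from tendsto_ln[OF this] have "(\<lambda>n. - \<sigma> n / 2) \<longlonglongrightarrow> 0" by simp
  from tendsto_mult[OF tendsto_const[of "-2"] this] show ?thesis by (simp add: \<sigma>_def)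
qed

text \<open>Here \<open>J x\<close> is the first index \<open>j\<close> for which the variance of \<open>f x - f (y j)\<close> is small.\<close>

lemma sampling_consistent:
  assumes \<delta>: "\<delta> > 0"
  shows "\<exists>n\<ge>1. \<exists>(y :: nat \<Rightarrow> 'x) J. (\<forall>j. y j \<in> space P) \<and> J \<in> measurable P (count_space UNIV) \<and>
    (\<integral>\<^sup>+f. \<integral>\<^sup>+x. ennreal ((app f x - (if J x < n then app f (y (J x)) else 0))\<^sup>2) \<partial>P \<partial>\<mu>) \<le> ennreal \<delta>"
proof -
  from weak_star_dense_points obtain y :: "nat \<Rightarrow> 'x" where y': "\<forall>j. y j \<in> space P"
    and ylim: "\<forall>x\<in>space P. \<exists>k :: nat \<Rightarrow> nat. \<forall>f\<in>V. (\<lambda>i. ev f (y (k i))) \<longlonglongrightarrow> ev f x" by (elim exE conjE)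
  have y: "y j \<in> space P" for j using y' by (rule spec)
  note [measurable] = app_measurable_2[OF y]
  define \<kappa> where "\<kappa> j x = (\<integral>f. (app f x - app f (y j))\<^sup>2 \<partial>\<mu>)" for j x
  have \<kappa>m[measurable]: "\<kappa> j \<in> borel_measurable P" for j
    unfolding \<kappa>_def by measurable
  have dl: "bounded_linear (\<lambda>f. ev f x - ev f (y j))" if "x \<in> space P" for x j
    by (intro bounded_linear_sub ev_linear that y)
  have \<kappa>_eq: "\<kappa> j x = (\<integral>f. (ev f x - ev f (y j))\<^sup>2 \<partial>\<mu>)" if x: "x \<in> space P" for j x
    unfolding \<kappa>_def
  proof (rule integral_cong_AE)
    show "AE f in \<mu>. (app f x - app f (y j))\<^sup>2 = (ev f x - ev f (y j))\<^sup>2"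
      using AE_app by eventually_elim simp
  qed (use bounded_linear_measurable[OF dl[OF x]] app_measurable_2[OF x] in auto)
  have \<kappa>_nn: "(\<integral>\<^sup>+f. ennreal ((app f x - app f (y j))\<^sup>2) \<partial>\<mu>) = ennreal (\<kappa> j x)" if x: "x \<in> space P" for j x
  proof -
    have "(\<integral>\<^sup>+f. ennreal ((app f x - app f (y j))\<^sup>2) \<partial>\<mu>) = (\<integral>\<^sup>+f. ennreal ((ev f x - ev f (y j))\<^sup>2) \<partial>\<mu>)"
      using AE_app by (intro nn_integral_cong_AE) (auto elim!: eventually_mono)
    also have "\<dots> = ennreal (\<kappa> j x)"
      unfolding \<kappa>_eq[OF x] by (intro nn_integral_eq_integral bounded_linear_moments(2)[OF dl[OF x]]) auto
    finally show ?thesis .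
  qed
  have K_nn: "(\<integral>\<^sup>+f. ennreal ((app f x)\<^sup>2) \<partial>\<mu>) = ennreal (K x)" if x: "x \<in> space P" for x
  proof -
    have "(\<integral>\<^sup>+f. ennreal ((app f x)\<^sup>2) \<partial>\<mu>) = (\<integral>\<^sup>+f. ennreal ((ev f x)\<^sup>2) \<partial>\<mu>)"
      using AE_app by (intro nn_integral_cong_AE) (auto elim!: eventually_mono)
    also have "\<dots> = ennreal (K x)"
      unfolding K_eq[OF x] by (intro nn_integral_eq_integral bounded_linear_moments(2)[OF ev_linear[OF x]]) auto
    finally show ?thesis .
  qed
  \<comment> \<open>The points \<open>y (k i)\<close> approximate evaluation at \<open>x\<close> on
    all of \<open>V\<close>; for Gaussian functionals this implies convergence in mean
    square.\<close>
  have ex: "\<exists>j. \<kappa> j x < \<delta> / 2" if x: "x \<in> space P" for x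
  proof -
    from bspec[OF ylim x] obtain k where k: "\<And>f. f \<in> V \<Longrightarrow> (\<lambda>i. ev f (y (k i))) \<longlonglongrightarrow> ev f x" by blast
    have "(\<lambda>i. \<integral>f. (ev f x - ev f (y (k i)))\<^sup>2 \<partial>\<mu>) \<longlonglongrightarrow> 0"
    proof (rule gaussian_variance_tendsto_0[OF dl[OF x]])
      fix f assume "f \<in> V"
      from tendsto_diff[OF tendsto_const[of "ev f x"] k[OF this]]
      show "(\<lambda>i. ev f x - ev f (y (k i))) \<longlonglongrightarrow> 0" by simp
    qed
    then have "\<forall>\<^sub>F i in sequentially. (\<integral>f. (ev f x - ev f (y (k i)))\<^sup>2 \<partial>\<mu>) < \<delta> / 2"
      using \<delta> by (intro order_tendstoD) auto
    then show ?thesis using \<kappa>_eq[OF x] by (auto simp: eventually_sequentially)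
  qed
  define J where "J x = (LEAST j. \<kappa> j x < \<delta> / 2)" for x
  have J[measurable]: "J \<in> measurable P (count_space UNIV)"
    unfolding J_def by (rule measurable_Least) measurable
  have J_le: "\<kappa> (J x) x < \<delta> / 2" if "x \<in> space P" for x
    unfolding J_def by (rule LeastI_ex[OF ex[OF that]])
  \<comment> \<open>Where \<open>J x\<close> is at least \<open>n\<close>, the algorithm returns 0
    and its local error is \<open>K x\<close>. As \<open>J x\<close> is finite at every point and
    \<open>K\<close> is integrable, this contribution tends to 0.\<close>
  have "(\<lambda>n. \<integral>x. K x * indicator {x \<in> space P. n \<le> J x} x \<partial>P) \<longlonglongrightarrow> (\<integral>x. 0 \<partial>P)"
  proof (rule integral_dominated_convergence[where w=K])
    show "integrable P K" by (rule K_integrable)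
    show "AE x in P. (\<lambda>n. K x * indicator {x \<in> space P. n \<le> J x} x) \<longlonglongrightarrow> 0"
    proof (intro AE_I2 tendsto_eventually)
      fix x
      show "\<forall>\<^sub>F n in sequentially. K x * indicator {x \<in> space P. n \<le> J x} x = 0"
        by (rule eventually_mono[OF eventually_gt_at_top[of "J x"]]) auto
    qed
  qed (auto simp: indicator_def K_nonneg)
  then have "\<forall>\<^sub>F n in sequentially. (\<integral>x. K x * indicator {x \<in> space P. n \<le> J x} x \<partial>P) < \<delta> / 2"
    using \<delta> by (intro order_tendstoD) auto
  then obtain n0 where n0: "\<And>n. n \<ge> n0 \<Longrightarrow> (\<integral>x. K x * indicator {x \<in> space P. n \<le> J x} x \<partial>P) < \<delta> / 2"
    unfolding eventually_sequentially by blast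
  \<comment> \<open>The successor ensures \<open>n >= 1\<close>; with no samples
    \<open>min_err2\<close> stands for the zero algorithm only.\<close>
  define n where "n = Suc n0"
  have n: "(\<integral>x. K x * indicator {x \<in> space P. n \<le> J x} x \<partial>P) < \<delta> / 2"
    by (rule n0) (simp add: n_def)
  have Jm: "(\<lambda>z. app (fst z) (y (J (snd z)))) \<in> borel_measurable (\<mu> \<Otimes>\<^sub>M P)"
    by (rule measurable_compose_countable[of "\<lambda>j z. app (fst z) (y j)"]) measurable
  then have Jm'[measurable]: "(\<lambda>(f, x). app f (y (J x))) \<in> borel_measurable (\<mu> \<Otimes>\<^sub>M P)"
    by (simp add: case_prod_unfold)
  have "(\<integral>\<^sup>+f. \<integral>\<^sup>+x. ennreal ((app f x - (if J x < n then app f (y (J x)) else 0))\<^sup>2) \<partial>P \<partial>\<mu>)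
      = (\<integral>\<^sup>+x. \<integral>\<^sup>+f. ennreal ((app f x - (if J x < n then app f (y (J x)) else 0))\<^sup>2) \<partial>\<mu> \<partial>P)"
    by (rule MP.Fubini'[symmetric]) measurable
  also have "\<dots> \<le> (\<integral>\<^sup>+x. ennreal (\<delta> / 2) + ennreal (K x * indicator {x \<in> space P. n \<le> J x} x) \<partial>P)"
  proof (rule nn_integral_mono)
    fix x assume x: "x \<in> space P"
    show "(\<integral>\<^sup>+f. ennreal ((app f x - (if J x < n then app f (y (J x)) else 0))\<^sup>2) \<partial>\<mu>)
      \<le> ennreal (\<delta> / 2) + ennreal (K x * indicator {x \<in> space P. n \<le> J x} x)"
    proof (cases "J x < n")
      case True
      then show ?thesis using J_le[OF x] \<kappa>_nn[OF x, of "J x"]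
        by (auto intro!: order_trans[OF ennreal_leI[of "\<kappa> (J x) x" "\<delta> / 2"]])
    next
      case False
      then show ?thesis using K_nn[OF x] x by simp
    qed
  qed
  also have "\<dots> = ennreal (\<delta> / 2) + (\<integral>\<^sup>+x. ennreal (K x * indicator {x \<in> space P. n \<le> J x} x) \<partial>P)"
    by (subst nn_integral_add) (auto simp: P.emeasure_space_1)
  also have "(\<integral>\<^sup>+x. ennreal (K x * indicator {x \<in> space P. n \<le> J x} x) \<partial>P) = ennreal (\<integral>x. K x * indicator {x \<in> space P. n \<le> J x} x \<partial>P)"
  proof (rule nn_integral_eq_integral)
    show "integrable P (\<lambda>x. K x * indicator {x \<in> space P. n \<le> J x} x)"
      by (rule Bochner_Integration.integrable_bound[OF K_integrable]) (auto simp: indicator_def)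
  qed (auto simp: K_nonneg)
  also have "ennreal (\<delta> / 2) + \<dots> \<le> ennreal (\<delta> / 2) + ennreal (\<delta> / 2)"
    using n by (intro add_left_mono ennreal_leI) auto
  also have "\<dots> = ennreal \<delta>" using \<delta> by (subst ennreal_plus[symmetric]) auto
  finally show ?thesis
    using y' J by (intro exI[of _ n] conjI exI[of _ y] exI[of _ J]) (auto simp: n_def)
qed

end

section \<open>Reconstruction from samples\<close>

context gaussian_approximation
begin

lemma bounded_linear_lincomb:
  fixes L :: "nat \<Rightarrow> 'f \<Rightarrow> real"
  assumes "\<And>i. i < n \<Longrightarrow> bounded_linear (L i)"
  shows "bounded_linear (\<lambda>f. \<Sum>i<n. c i * L i f)"
  using assms by (intro bounded_linear_sum bounded_linear_const_mult) auto

lemma app_sq_int: "x \<in> space P \<Longrightarrow> sq_int \<mu> (\<lambda>f. app f x)"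
proof -
  assume x: "x \<in> space P"
  have "integrable \<mu> (\<lambda>f. (app f x)\<^sup>2) \<longleftrightarrow> integrable \<mu> (\<lambda>f. (ev f x)\<^sup>2)"
    using app_measurable_2[OF x] ev_measurable_2[OF x] AE_app
    by (intro integrable_cong_AE) (auto elim!: eventually_mono)
  then show ?thesis
    using app_measurable_2[OF x] bounded_linear_moments(2)[OF ev_linear[OF x]] by (simp add: sq_int_def)
qed

text \<open>At each \<open>x\<close> the evaluation is projected, in \<open>L_2\<close> of
  \<open>\<mu>\<close>, onto the span of the data functionals. The residual is uncorrelated with all
  data, so its variance \<open>\<gamma> x\<close> is at most the mean squared error at
  \<open>x\<close> of the nonlinear \<open>\<phi>\<close>. Integration over \<open>x\<close>
  preserves this comparison.\<close>

lemma linear_reconstruction: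
  fixes L :: "nat \<Rightarrow> 'f \<Rightarrow> real"
  assumes L: "\<And>i. i < n \<Longrightarrow> bounded_linear (L i)"
    and \<phi>: "(\<lambda>(y, x). \<phi> y x) \<in> borel_measurable (PiM {..<n} (\<lambda>_. borel) \<Otimes>\<^sub>M P)"
    and err: "(\<integral>\<^sup>+f. \<integral>\<^sup>+x. ennreal ((app f x - \<phi> (restrict (\<lambda>i. L i f) {..<n}) x)\<^sup>2) \<partial>P \<partial>\<mu>) \<le> ennreal E0"
    and E0: "E0 > 0"
  shows "\<exists>l\<le>n. \<exists>(\<beta> :: nat \<Rightarrow> 'f \<Rightarrow> real) (a :: nat \<Rightarrow> 'x \<Rightarrow> real) \<gamma>.
    (\<forall>p<l. bounded_linear (\<beta> p)) \<and> (\<forall>p<l. sq_int P (a p)) \<and>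
    (\<forall>x\<in>space P. \<gamma> x = (\<integral>f. (app f x - (\<Sum>p<l. a p x * \<beta> p f))\<^sup>2 \<partial>\<mu>)) \<and>
    (\<forall>x. \<gamma> x \<ge> 0) \<and> integrable P \<gamma> \<and> (\<integral>x. \<gamma> x \<partial>P) \<le> E0"
proof -
  have sqL: "sq_int \<mu> (L i)" if "i < n" for i by (rule bounded_linear_sq_int[OF L[OF that]])
  from gram_schmidt_L2[of n \<mu> L, OF sqL] obtain l :: nat and \<beta> where l: "l \<le> n"
    and lin: "\<forall>p<l. \<exists>c. \<beta> p = (\<lambda>f. \<Sum>i<n. c i * L i f)"
    and on': "\<forall>p<l. \<forall>q<l. (\<integral>f. \<beta> p f * \<beta> q f \<partial>\<mu>) = (if p = q then 1 else 0)"
    and ex: "\<forall>i<n. AE f in \<mu>. L i f = (\<Sum>p<l. (\<integral>f. L i f * \<beta> p f \<partial>\<mu>) * \<beta> p f)" by blast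
  have on: "(\<integral>f. \<beta> p f * \<beta> q f \<partial>\<mu>) = (if p = q then 1 else 0)" if "p < l" "q < l" for p q using on' that by blast
  from lin obtain C where C: "\<And>p. p < l \<Longrightarrow> \<beta> p = (\<lambda>f. \<Sum>i<n. C p i * L i f)" by metis
  have \<beta>: "bounded_linear (\<beta> p)" if "p < l" for p
    unfolding C[OF that] by (rule bounded_linear_lincomb[OF L])
  have sq\<beta>: "sq_int \<mu> (\<beta> p)" if "p < l" for p by (rule bounded_linear_sq_int[OF \<beta>[OF that]])
  define a where "a p x = (\<integral>f. app f x * \<beta> p f \<partial>\<mu>)" for p x
  have am: "a p \<in> borel_measurable P" if "p < l" for p
  proof -
    note [measurable] = bounded_linear_measurable[OF \<beta>[OF that]]
    show ?thesis unfolding a_def by measurable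
  qed
  have sqa: "sq_int P (a p)" if p: "p < l" for p
  proof -
    \<comment> \<open>Bessel's inequality in \<open>L_2\<close> of \<open>\<mu>\<close> bounds the
      coefficients by the variance; integrability of \<open>K\<close> then makes each
      \<open>a p\<close> square integrable over \<open>P\<close>.\<close>
    have "(a p x)\<^sup>2 \<le> K x" if x: "x \<in> space P" for x
    proof -
      have "(a p x)\<^sup>2 \<le> (\<Sum>p<l. (a p x)\<^sup>2)" using p by (intro member_le_sum) auto
      also have "\<dots> \<le> K x" unfolding a_def K_def
        by (rule bessel_inequality) (auto intro: sq\<beta> app_sq_int x simp: on)
      finally show ?thesis .
    qed
    then have "integrable P (\<lambda>x. (a p x)\<^sup>2)"
      using am[OF p] by (intro Bochner_Integration.integrable_bound[OF K_integrable]) (auto simp: K_nonneg)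
    then show ?thesis using am[OF p] by (simp add: sq_int_def)
  qed
  define \<gamma> where "\<gamma> x = (\<integral>f. (app f x - (\<Sum>p<l. a p x * \<beta> p f))\<^sup>2 \<partial>\<mu>)" for x
  have gm: "(\<lambda>(x, f). app f x - (\<Sum>p<l. a p x * \<beta> p f)) \<in> borel_measurable (P \<Otimes>\<^sub>M \<mu>)"
  proof -
    have "(\<lambda>z. a p (fst z) * \<beta> p (snd z)) \<in> borel_measurable (P \<Otimes>\<^sub>M \<mu>)" if "p \<in> {..<l}" for p
    proof -
      have "p < l" using that by simp
      note [measurable] = bounded_linear_measurable[OF \<beta>[OF this]] am[OF this]
      show ?thesis by measurable
    qed
    then have [measurable]: "(\<lambda>z. \<Sum>p<l. a p (fst z) * \<beta> p (snd z)) \<in> borel_measurable (P \<Otimes>\<^sub>M \<mu>)"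
      by (rule borel_measurable_sum)
    have "(\<lambda>z. app (snd z) (fst z) - (\<Sum>p<l. a p (fst z) * \<beta> p (snd z))) \<in> borel_measurable (P \<Otimes>\<^sub>M \<mu>)"
      by measurable
    then show ?thesis by (simp add: case_prod_unfold)
  qed
  then have [measurable]: "\<gamma> \<in> borel_measurable P"
    unfolding \<gamma>_def by measurable
  define T where "T f = restrict (\<lambda>i. L i f) {..<n}" for f
  have T[measurable]: "T \<in> measurable \<mu> (PiM {..<n} (\<lambda>_. borel))"
    unfolding T_def using bounded_linear_measurable[OF L] by (intro measurable_restrict) auto
  have \<gamma>_le: "ennreal (\<gamma> x) \<le> (\<integral>\<^sup>+f. ennreal ((app f x - \<phi> (T f) x)\<^sup>2) \<partial>\<mu>)" if x: "x \<in> space P" for x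
  proof -
    define Z where "Z f = ev f x - (\<Sum>p<l. a p x * \<beta> p f)" for f
    have Z: "bounded_linear Z"
      unfolding Z_def by (intro bounded_linear_sub ev_linear x bounded_linear_lincomb \<beta>)
    have sqZ: "sq_int \<mu> Z" by (rule bounded_linear_sq_int[OF Z])
    have a_ev: "(\<integral>f. ev f x * \<beta> q f \<partial>\<mu>) = a q x" if "q < l" for q
      unfolding a_def
    proof (rule integral_cong_AE)
      show "AE f in \<mu>. ev f x * \<beta> q f = app f x * \<beta> q f" using AE_app by eventually_elim simp
    qed (use bounded_linear_measurable[OF \<beta>[OF that]] app_measurable_2[OF x] ev_measurable_2[OF x] in auto)
    have Z\<beta>: "(\<integral>f. \<beta> q f * Z f \<partial>\<mu>) = 0" if q: "q < l" for q
    proof -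
      have sqev: "sq_int \<mu> (\<lambda>f. ev f x)" by (rule bounded_linear_sq_int[OF ev_linear[OF x]])
      have sqs: "sq_int \<mu> (\<lambda>f. \<Sum>p<l. a p x * \<beta> p f)" by (intro sq_int_lincomb sq\<beta>) auto
      have "(\<integral>f. \<beta> q f * Z f \<partial>\<mu>) = (\<integral>f. ev f x * \<beta> q f - (\<Sum>p<l. a p x * \<beta> p f) * \<beta> q f \<partial>\<mu>)"
        by (intro Bochner_Integration.integral_cong) (auto simp: Z_def algebra_simps)
      also have "\<dots> = a q x - (\<integral>f. (\<Sum>p<l. a p x * \<beta> p f) * \<beta> q f \<partial>\<mu>)"
        unfolding a_ev[OF q, symmetric]
        by (intro Bochner_Integration.integral_diff sq_int_mult_integrable sqs sqev sq\<beta>[OF q])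
      also have "(\<integral>f. (\<Sum>p<l. a p x * \<beta> p f) * \<beta> q f \<partial>\<mu>) = (\<Sum>p<l. a p x * (\<integral>f. \<beta> p f * \<beta> q f \<partial>\<mu>))"
        using q by (intro integral_lincomb_mult sq\<beta>) auto
      also have "\<dots> = (\<Sum>p<l. a p x * (if p = q then 1 else 0))"
        using on q by (intro sum.cong) auto
      also have "\<dots> = a q x" by (rule sum_kronecker[OF q])
      finally show ?thesis by simp
    qed
    have ZL: "(\<integral>f. Z f * L i f \<partial>\<mu>) = 0" if i: "i < n" for i
    proof -
      have "(\<integral>f. Z f * L i f \<partial>\<mu>) = (\<integral>f. (\<Sum>p<l. (\<integral>f. L i f * \<beta> p f \<partial>\<mu>) * \<beta> p f) * Z f \<partial>\<mu>)"
      proof (rule integral_cong_AE)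
        show "AE f in \<mu>. Z f * L i f = (\<Sum>p<l. (\<integral>f. L i f * \<beta> p f \<partial>\<mu>) * \<beta> p f) * Z f"
          using ex[rule_format, OF i] by eventually_elim (metis mult.commute)
        show "(\<lambda>f. Z f * L i f) \<in> borel_measurable \<mu>"
          by (intro borel_measurable_integrable sq_int_mult_integrable sqZ sqL i)
        show "(\<lambda>f. (\<Sum>p<l. (\<integral>f. L i f * \<beta> p f \<partial>\<mu>) * \<beta> p f) * Z f) \<in> borel_measurable \<mu>"
          by (intro borel_measurable_integrable sq_int_mult_integrable sqZ sq_int_lincomb sq\<beta>) auto
      qed
      also have "\<dots> = (\<Sum>p<l. (\<integral>f. L i f * \<beta> p f \<partial>\<mu>) * (\<integral>f. \<beta> p f * Z f \<partial>\<mu>))"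
        by (intro integral_lincomb_mult sq\<beta> sqZ) auto
      also have "\<dots> = 0" using Z\<beta> by simp
      finally show ?thesis .
    qed
    \<comment> \<open>The linear prediction is itself a function of the data. Subtracting it from
      \<open>\<phi>\<close> gives an \<open>h\<close> for which \<open>Z\<close> minus
      \<open>h\<close> of the data is the original error at \<open>x\<close>.\<close>
    define h where "h y = \<phi> y x - (\<Sum>p<l. a p x * (\<Sum>i<n. C p i * y i))" for y
    have hm: "h \<in> borel_measurable (PiM {..<n} (\<lambda>_. borel))"
    proof -
      have "(\<lambda>y. \<phi> y x) \<in> borel_measurable (PiM {..<n} (\<lambda>_. borel))"
        using measurable_compose[OF measurable_Pair[OF measurable_ident measurable_const[OF x]] \<phi>] by simp
      moreover have "(\<lambda>y. \<Sum>p<l. a p x * (\<Sum>i<n. C p i * y i)) \<in> borel_measurable (PiM {..<n} (\<lambda>_. borel))"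
        by measurable
      ultimately show ?thesis unfolding h_def by (rule borel_measurable_diff)
    qed
    have g: "centered_gaussian_real (distr \<mu> borel (\<lambda>f. a * Z f + (\<Sum>i<n. t i * L i f)))" for a t
      by (intro gaussian bounded_linear_add bounded_linear_const_mult Z bounded_linear_lincomb L)
    have \<gamma>Z: "\<gamma> x = (\<integral>f. (Z f)\<^sup>2 \<partial>\<mu>)"
      unfolding \<gamma>_def
    proof (rule integral_cong_AE)
      show "AE f in \<mu>. (app f x - (\<Sum>p<l. a p x * \<beta> p f))\<^sup>2 = (Z f)\<^sup>2"
        using AE_app by eventually_elim (simp add: Z_def)
      show "(\<lambda>f. (Z f)\<^sup>2) \<in> borel_measurable \<mu>" using sqZ by (auto simp: sq_int_def)
      have "sq_int \<mu> (\<lambda>f. app f x - (\<Sum>p<l. a p x * \<beta> p f))"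
        by (intro sq_int_diff app_sq_int x sq_int_lincomb sq\<beta>) auto
      then show "(\<lambda>f. (app f x - (\<Sum>p<l. a p x * \<beta> p f))\<^sup>2) \<in> borel_measurable \<mu>"
        by (auto simp: sq_int_def)
    qed
    have "ennreal (\<gamma> x) \<le> (\<integral>\<^sup>+f. ennreal ((Z f - h (restrict (\<lambda>i. L i f) {..<n}))\<^sup>2) \<partial>\<mu>)"
      unfolding \<gamma>Z
      by (rule gaussian_nonlinear_approximation_ge[OF prob_\<mu> _ _ g ZL hm])
         (auto intro: bounded_linear_measurable[OF Z] bounded_linear_measurable[OF L])
    also have "\<dots> = (\<integral>\<^sup>+f. ennreal ((app f x - \<phi> (T f) x)\<^sup>2) \<partial>\<mu>)"
    proof (rule nn_integral_cong_AE)
      have e: "Z f - h (restrict (\<lambda>i. L i f) {..<n}) = ev f x - \<phi> (T f) x" for f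
      proof -
        have "(\<Sum>p<l. a p x * (\<Sum>i<n. C p i * restrict (\<lambda>i. L i f) {..<n} i)) = (\<Sum>p<l. a p x * \<beta> p f)"
          by (intro sum.cong refl) (simp add: C)
        then show ?thesis by (simp add: Z_def h_def T_def)
      qed
      show "AE f in \<mu>. ennreal ((Z f - h (restrict (\<lambda>i. L i f) {..<n}))\<^sup>2) = ennreal ((app f x - \<phi> (T f) x)\<^sup>2)"
        using AE_app by eventually_elim (simp only: e)
    qed
    finally show ?thesis .
  qed
  have \<gamma>0: "\<gamma> x \<ge> 0" for x by (simp add: \<gamma>_def)
  have \<phi>m: "(\<lambda>(f, x). ennreal ((app f x - \<phi> (T f) x)\<^sup>2)) \<in> borel_measurable (\<mu> \<Otimes>\<^sub>M P)"
  proof -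
    have "(\<lambda>z. (T (fst z), snd z)) \<in> measurable (\<mu> \<Otimes>\<^sub>M P) (PiM {..<n} (\<lambda>_. borel) \<Otimes>\<^sub>M P)" by measurable
    from measurable_compose[OF this \<phi>] have [measurable]: "(\<lambda>z. \<phi> (T (fst z)) (snd z)) \<in> borel_measurable (\<mu> \<Otimes>\<^sub>M P)" by simp
    have "(\<lambda>z. ennreal ((app (fst z) (snd z) - \<phi> (T (fst z)) (snd z))\<^sup>2)) \<in> borel_measurable (\<mu> \<Otimes>\<^sub>M P)" by measurable
    then show ?thesis by (simp add: case_prod_unfold)
  qed
  have "(\<integral>\<^sup>+x. ennreal (\<gamma> x) \<partial>P) \<le> (\<integral>\<^sup>+x. \<integral>\<^sup>+f. ennreal ((app f x - \<phi> (T f) x)\<^sup>2) \<partial>\<mu> \<partial>P)"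
    by (intro nn_integral_mono \<gamma>_le)
  also have "\<dots> = (\<integral>\<^sup>+f. \<integral>\<^sup>+x. ennreal ((app f x - \<phi> (T f) x)\<^sup>2) \<partial>P \<partial>\<mu>)"
    by (rule MP.Fubini'[OF \<phi>m])
  also have "\<dots> \<le> ennreal E0" using err by (simp add: T_def)
  finally have nn: "(\<integral>\<^sup>+x. ennreal (\<gamma> x) \<partial>P) \<le> ennreal E0" .
  then have \<gamma>i: "integrable P \<gamma>"
    using \<gamma>0 by (intro integrableI_nonneg) (auto simp: order_le_less_trans)
  have "ennreal (\<integral>x. \<gamma> x \<partial>P) \<le> ennreal E0"
    using nn nn_integral_eq_integral[OF \<gamma>i] \<gamma>0 by simp
  then have "(\<integral>x. \<gamma> x \<partial>P) \<le> E0" using E0 by (subst (asm) ennreal_le_iff) auto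
  then show ?thesis
    using l \<beta> sqa \<gamma>0 \<gamma>i
    by (intro exI[of _ l] exI[of _ \<beta>] exI[of _ a] exI[of _ \<gamma>] conjI) (auto simp: \<gamma>_def)
qed

end

text \<open>If \<open>z\<close> samples a function \<open>g\<close> plus the combination of the
  \<open>u i\<close> with coefficients \<open>s\<close>, the right-hand side sees only
  \<open>g\<close> at the sample points. The last conclusion thus expresses exactness on the span
  together with stability, while the second one keeps the sampled residual comparable to its
  integral.\<close>

lemma sampling_least_squares:
  fixes u :: "nat \<Rightarrow> 'x \<Rightarrow> real"
  assumes P: "prob_space P" and k: "k \<ge> 1"
    and sq: "\<And>p. p < k \<Longrightarrow> sq_int P (u p)"
    and on: "\<And>p q. p < k \<Longrightarrow> q < k \<Longrightarrow> (\<integral>x. u p x * u q x \<partial>P) = (if p = q then 1 else 0)"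
    and \<gamma>: "\<And>x. \<gamma> x \<ge> 0" "integrable P \<gamma>" "(\<integral>x. \<gamma> x \<partial>P) \<le> E0" and E0: "E0 > 0"
    and Q: "AE x in P. Q x" and m: "m = 8 * k\<^sup>2"
  shows "\<exists>x \<tau> B. (\<forall>j<m. x j \<in> space P \<and> Q (x j) \<and> \<tau> j > 0) \<and>
    (\<Sum>j<m. \<tau> j * \<gamma> (x j)) \<le> 2 * E0 \<and>
    (\<forall>s z. (\<Sum>i<k. (s i - (\<Sum>j<m. B i j * z j))\<^sup>2) \<le> 2 * (\<Sum>j<m. \<tau> j * (z j - (\<Sum>i<k. s i * u i (x j)))\<^sup>2))"
proof -
  have m0: "real m > 0" using k by (simp add: m)
  \<comment> \<open>This balances the two terms of the potential: both may grow by
    \<open>k^2\<close> per point, so each is at most \<open>2 m k^2\<close> after \<open>m\<close>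
    points. Dividing the Gram part by \<open>m^2\<close> leaves \<open>2 k^2 / m\<close>, and
    \<open>m = 8 k^2\<close> makes this \<open>1/4\<close>.\<close>
  define \<alpha> where "\<alpha> = (real k)\<^sup>2 / E0"
  have \<alpha>: "\<alpha> > 0" "\<alpha> * E0 = (real k)\<^sup>2" using E0 k by (auto simp: \<alpha>_def)
  obtain x \<omega> where x: "\<And>j. j < m \<Longrightarrow> x j \<in> space P \<and> Q (x j) \<and> \<omega> j > 0"
    and b: "(\<Sum>p<k. \<Sum>q<k. (\<Sum>j<m. \<omega> j * u p (x j) * u q (x j) - (if p = q then 1 else 0))\<^sup>2)
        + \<alpha> * (\<Sum>j<m. \<omega> j * \<gamma> (x j)) \<le> real m * ((real k)\<^sup>2 + \<alpha> * E0)"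
    using sampling_points[OF P k sq on \<gamma> Q, of \<alpha> m] \<alpha> by auto
  define F where "F = (\<Sum>p<k. \<Sum>q<k. (\<Sum>j<m. \<omega> j * u p (x j) * u q (x j) - (if p = q then 1 else 0))\<^sup>2)"
  define R where "R = (\<Sum>j<m. \<omega> j * \<gamma> (x j))"
  have F0: "F \<ge> 0" unfolding F_def by (intro sum_nonneg) auto
  have R0: "R \<ge> 0" unfolding R_def using x \<gamma>(1) by (intro sum_nonneg mult_nonneg_nonneg) (auto intro: less_imp_le)
  have FR: "F + \<alpha> * R \<le> 2 * real m * (real k)\<^sup>2" using b \<alpha>(2) by (simp add: F_def R_def)
  define \<tau> where "\<tau> j = \<omega> j / m" for j
  have \<tau>: "\<tau> j > 0" if "j < m" for j using x[OF that] m0 by (simp add: \<tau>_def)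
  have R: "(\<Sum>j<m. \<tau> j * \<gamma> (x j)) \<le> 2 * E0"
  proof -
    have "\<alpha> * R \<le> 2 * real m * (\<alpha> * E0)" using FR F0 \<alpha>(2) by simp
    then have "\<alpha> * R \<le> \<alpha> * (2 * real m * E0)" by (simp add: mult_ac)
    then have "R \<le> 2 * real m * E0" using \<alpha>(1) by simp
    then have "R / m \<le> 2 * E0" using m0 by (simp add: field_simps)
    then show ?thesis by (simp add: R_def \<tau>_def sum_divide_distrib)
  qed
  define G where "G p q = (\<Sum>j<m. \<tau> j * u p (x j) * u q (x j))" for p q
  have G: "(\<Sum>p<k. \<Sum>q<k. (G p q - (if p = q then 1 else 0))\<^sup>2) \<le> 1/4"
  proof -
    have "G p q - (if p = q then 1 else 0) = (\<Sum>j<m. \<omega> j * u p (x j) * u q (x j) - (if p = q then 1 else 0)) / m" for p q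
      using m0 by (simp add: G_def \<tau>_def sum_subtractf diff_divide_distrib sum_divide_distrib)
    then have "(\<Sum>p<k. \<Sum>q<k. (G p q - (if p = q then 1 else 0))\<^sup>2) = F / (real m)\<^sup>2"
      by (simp only: F_def power_divide sum_divide_distrib[symmetric])
    also have "\<dots> \<le> (2 * real m * (real k)\<^sup>2) / (real m)\<^sup>2"
      using FR R0 \<alpha>(1) by (intro divide_right_mono) (auto intro: order_trans[rotated])
    also have "\<dots> = 1/4" using k by (simp add: m power2_eq_square field_simps)
    finally show ?thesis .
  qed
  \<comment> \<open>Square roots of the weights turn the weighted least squares problem into an
    unweighted one whose quadratic form is that of \<open>G\<close>.\<close>
  define H where "H j i = sqrt (\<tau> j) * u i (x j)" for j i
  have "\<exists>B. \<forall>s z. (\<Sum>i<k. (s i - (\<Sum>j<m. B i j * z j))\<^sup>2) \<le> 2 * (\<Sum>j<m. (z j - (\<Sum>i<k. H j i * s i))\<^sup>2)"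
  proof (rule least_squares_operator)
    fix c :: "nat \<Rightarrow> real"
    have "(\<Sum>i<k. H j i * c i)\<^sup>2 = (\<Sum>p<k. \<Sum>q<k. c p * c q * (\<tau> j * u p (x j) * u q (x j)))" if "j < m" for j
    proof -
      have "H j p * c p * (H j q * c q) = c p * c q * (\<tau> j * u p (x j) * u q (x j))" for p q
      proof -
        have "H j p * c p * (H j q * c q) = (sqrt (\<tau> j) * sqrt (\<tau> j)) * (c p * c q * u p (x j) * u q (x j))"
          by (simp add: H_def mult_ac)
        then show ?thesis using \<tau>[OF that] by (simp add: mult_ac)
      qed
      then show ?thesis unfolding power2_eq_square sum_product by (intro sum.cong refl)
    qed
    then have "(\<Sum>j<m. (\<Sum>i<k. H j i * c i)\<^sup>2) = (\<Sum>j<m. \<Sum>p<k. \<Sum>q<k. c p * c q * (\<tau> j * u p (x j) * u q (x j)))"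
      by simp
    also have "\<dots> = (\<Sum>p<k. \<Sum>q<k. \<Sum>j<m. c p * c q * (\<tau> j * u p (x j) * u q (x j)))"
      by (subst sum.swap) (intro sum.cong refl sum.swap)
    also have "\<dots> = (\<Sum>p<k. \<Sum>q<k. c p * c q * G p q)"
      by (simp add: G_def sum_distrib_left)
    finally show "(\<Sum>i<k. (c i)\<^sup>2) \<le> 2 * (\<Sum>j<m. (\<Sum>i<k. H j i * c i)\<^sup>2)"
      using near_identity_quadratic_form[OF G, of c] by simp
  qed
  then obtain B where B: "\<And>s z. (\<Sum>i<k. (s i - (\<Sum>j<m. B i j * z j))\<^sup>2) \<le> 2 * (\<Sum>j<m. (z j - (\<Sum>i<k. H j i * s i))\<^sup>2)"
    by blast
  have "(\<Sum>i<k. (s i - (\<Sum>j<m. (B i j * sqrt (\<tau> j)) * z j))\<^sup>2) \<le> 2 * (\<Sum>j<m. \<tau> j * (z j - (\<Sum>i<k. s i * u i (x j)))\<^sup>2)" for s z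
  proof -
    have "(\<Sum>j<m. (sqrt (\<tau> j) * z j - (\<Sum>i<k. H j i * s i))\<^sup>2) = (\<Sum>j<m. \<tau> j * (z j - (\<Sum>i<k. s i * u i (x j)))\<^sup>2)"
    proof (intro sum.cong refl)
      fix j assume "j \<in> {..<m}"
      then have t: "\<tau> j > 0" using \<tau> by simp
      have "sqrt (\<tau> j) * z j - (\<Sum>i<k. H j i * s i) = sqrt (\<tau> j) * (z j - (\<Sum>i<k. s i * u i (x j)))"
        by (simp add: H_def right_diff_distrib sum_distrib_left mult_ac)
      then show "(sqrt (\<tau> j) * z j - (\<Sum>i<k. H j i * s i))\<^sup>2 = \<tau> j * (z j - (\<Sum>i<k. s i * u i (x j)))\<^sup>2"
        using t by (simp add: power_mult_distrib)
    qed
    then show ?thesis using B[of s "\<lambda>j. sqrt (\<tau> j) * z j"] by (simp add: mult.assoc)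
  qed
  then show ?thesis
    using x \<tau> R by (intro exI[of _ x] exI[of _ \<tau>] exI[of _ "\<lambda>i j. B i j * sqrt (\<tau> j)"]) auto
qed

context gaussian_approximation
begin

text \<open>The dimension \<open>k\<close> of the span governs the number of samples. Pathwise, the
  error consists of the residual \<open>g\<close> and the coefficient error \<open>d\<close>, with
  squared length at most twice the weighted sampled square of \<open>g\<close>. Averaging over
  \<open>f\<close> turns the sampled squares into values of \<open>\<gamma>\<close>, which is why
  points chosen for \<open>\<gamma>\<close> alone serve all \<open>f\<close>.\<close>

lemma standard_reconstruction:
  fixes L :: "nat \<Rightarrow> 'f \<Rightarrow> real"
  assumes L: "\<And>i. i < n \<Longrightarrow> bounded_linear (L i)"
    and \<phi>: "(\<lambda>(y, x). \<phi> y x) \<in> borel_measurable (PiM {..<n} (\<lambda>_. borel) \<Otimes>\<^sub>M P)"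
    and err: "(\<integral>\<^sup>+f. \<integral>\<^sup>+x. ennreal ((app f x - \<phi> (restrict (\<lambda>i. L i f) {..<n}) x)\<^sup>2) \<partial>P \<partial>\<mu>) \<le> ennreal E0"
    and E0: "E0 > 0"
  shows "\<exists>k\<le>n. \<exists>(y :: nat \<Rightarrow> 'x) b. (\<forall>j<8 * k\<^sup>2. y j \<in> space P) \<and> (\<forall>j<8 * k\<^sup>2. sq_int P (b j)) \<and>
    (\<integral>\<^sup>+f. \<integral>\<^sup>+x. ennreal ((app f x - (\<Sum>j<8 * k\<^sup>2. app f (y j) * b j x))\<^sup>2) \<partial>P \<partial>\<mu>) \<le> ennreal (10 * E0)"
proof -
  from linear_reconstruction[OF L \<phi> err E0] obtain l :: nat and \<beta> :: "nat \<Rightarrow> 'f \<Rightarrow> real" and a :: "nat \<Rightarrow> 'x \<Rightarrow> real" and \<gamma>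
    where l: "l \<le> n" and \<beta>': "\<forall>p<l. bounded_linear (\<beta> p)" and sqa': "\<forall>p<l. sq_int P (a p)"
      and \<gamma>_eq': "\<forall>x\<in>space P. \<gamma> x = (\<integral>f. (app f x - (\<Sum>p<l. a p x * \<beta> p f))\<^sup>2 \<partial>\<mu>)"
      and \<gamma>0': "\<forall>x. \<gamma> x \<ge> 0" and \<gamma>i: "integrable P \<gamma>" and \<gamma>E: "(\<integral>x. \<gamma> x \<partial>P) \<le> E0" by blast
  have \<beta>: "bounded_linear (\<beta> p)" if "p < l" for p using \<beta>' that by blast
  have sqa: "sq_int P (a p)" if "p < l" for p using sqa' that by blast
  have am[measurable]: "a p \<in> borel_measurable P" if "p < l" for p using sqa[OF that] by (auto simp: sq_int_def)
  have \<gamma>0: "\<gamma> x \<ge> 0" for x using \<gamma>0' by blast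
  have \<gamma>m[measurable]: "\<gamma> \<in> borel_measurable P" using \<gamma>i by auto
  define g where "g f x = app f x - (\<Sum>p<l. a p x * \<beta> p f)" for f x
  have g_pair: "(\<lambda>(f, x). g f x) \<in> borel_measurable (\<mu> \<Otimes>\<^sub>M P)"
  proof -
    have "(\<lambda>z. a p (snd z) * \<beta> p (fst z)) \<in> borel_measurable (\<mu> \<Otimes>\<^sub>M P)" if "p \<in> {..<l}" for p
    proof -
      have "p < l" using that by simp
      note [measurable] = bounded_linear_measurable[OF \<beta>[OF this]] am[OF this]
      show ?thesis by measurable
    qed
    then have [measurable]: "(\<lambda>z. \<Sum>p<l. a p (snd z) * \<beta> p (fst z)) \<in> borel_measurable (\<mu> \<Otimes>\<^sub>M P)"
      by (rule borel_measurable_sum)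
    have "(\<lambda>z. app (fst z) (snd z) - (\<Sum>p<l. a p (snd z) * \<beta> p (fst z))) \<in> borel_measurable (\<mu> \<Otimes>\<^sub>M P)"
      by measurable
    then show ?thesis by (simp add: case_prod_unfold g_def)
  qed
  have g2_pair: "(\<lambda>(f, x). ennreal ((g f x)\<^sup>2)) \<in> borel_measurable (\<mu> \<Otimes>\<^sub>M P)"
  proof -
    have [measurable]: "(\<lambda>z. g (fst z) (snd z)) \<in> borel_measurable (\<mu> \<Otimes>\<^sub>M P)"
      using g_pair by (simp add: case_prod_unfold)
    have "(\<lambda>z. ennreal ((g (fst z) (snd z))\<^sup>2)) \<in> borel_measurable (\<mu> \<Otimes>\<^sub>M P)" by measurable
    then show ?thesis by (simp add: case_prod_unfold)
  qed
  have g1[measurable]: "g f \<in> borel_measurable P" for f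
    unfolding g_def using am by (intro borel_measurable_diff borel_measurable_sum) auto
  have gnn: "(\<integral>\<^sup>+f. ennreal ((g f x)\<^sup>2) \<partial>\<mu>) = ennreal (\<gamma> x)" if x: "x \<in> space P" for x
  proof -
    have "sq_int \<mu> (\<lambda>f. g f x)" unfolding g_def
      by (intro sq_int_diff app_sq_int x sq_int_lincomb bounded_linear_sq_int \<beta>) auto
    then have "(\<integral>\<^sup>+f. ennreal ((g f x)\<^sup>2) \<partial>\<mu>) = ennreal (\<integral>f. (g f x)\<^sup>2 \<partial>\<mu>)"
      by (intro nn_integral_eq_integral sq_int_square) auto
    then show ?thesis using \<gamma>_eq' x by (simp add: g_def)
  qed
  have g_err: "(\<integral>\<^sup>+f. \<integral>\<^sup>+x. ennreal ((g f x)\<^sup>2) \<partial>P \<partial>\<mu>) \<le> ennreal E0"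
  proof -
    have "(\<integral>\<^sup>+f. \<integral>\<^sup>+x. ennreal ((g f x)\<^sup>2) \<partial>P \<partial>\<mu>) = (\<integral>\<^sup>+x. \<integral>\<^sup>+f. ennreal ((g f x)\<^sup>2) \<partial>\<mu> \<partial>P)"
      by (rule MP.Fubini'[OF g2_pair, symmetric])
    also have "\<dots> = (\<integral>\<^sup>+x. ennreal (\<gamma> x) \<partial>P)" by (intro nn_integral_cong gnn)
    also have "\<dots> = ennreal (\<integral>x. \<gamma> x \<partial>P)" using \<gamma>i \<gamma>0 by (intro nn_integral_eq_integral) auto
    also have "\<dots> \<le> ennreal E0" using \<gamma>E by (rule ennreal_leI)
    finally show ?thesis .
  qed
  from gram_schmidt_L2[of l P a] sqa obtain k :: nat and u where k: "k \<le> l"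
    and ulin: "\<forall>i<k. \<exists>c. u i = (\<lambda>x. \<Sum>p<l. c p * a p x)"
    and on': "\<forall>i<k. \<forall>j<k. (\<integral>x. u i x * u j x \<partial>P) = (if i = j then 1 else 0)"
    and ex: "\<forall>p<l. AE x in P. a p x = (\<Sum>i<k. (\<integral>x. a p x * u i x \<partial>P) * u i x)" by blast
  have on: "(\<integral>x. u i x * u j x \<partial>P) = (if i = j then 1 else 0)" if "i < k" "j < k" for i j using on' that by blast
  have squ: "sq_int P (u i)" if "i < k" for i
  proof -
    from ulin that have "\<exists>c. u i = (\<lambda>x. \<Sum>p<l. c p * a p x)" by blast
    then obtain c where c: "u i = (\<lambda>x. \<Sum>p<l. c p * a p x)" by blast
    show ?thesis unfolding c by (intro sq_int_lincomb sqa) auto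
  qed
  have um[measurable]: "u i \<in> borel_measurable P" if "i < k" for i using squ[OF that] by (auto simp: sq_int_def)
  define \<alpha> where "\<alpha> p i = (\<integral>x. a p x * u i x \<partial>P)" for p i
  \<comment> \<open>The orthonormal expansion of the \<open>a p\<close> holds only almost
    everywhere, but is needed at every sample point.\<close>
  define Q where "Q x \<longleftrightarrow> (\<forall>p<l. a p x = (\<Sum>i<k. \<alpha> p i * u i x))" for x
  have Q: "AE x in P. Q x"
  proof -
    have "AE x in P. \<forall>p\<in>{..<l}. a p x = (\<Sum>i<k. \<alpha> p i * u i x)"
      using ex by (intro AE_finite_allI) (auto simp: \<alpha>_def)
    then show ?thesis by eventually_elim (auto simp: Q_def)
  qed
  define s where "s f i = (\<Sum>p<l. \<alpha> p i * \<beta> p f)" for f i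
  have sQ: "app f x = g f x + (\<Sum>i<k. s f i * u i x)" if "Q x" for f x
  proof -
    have "(\<Sum>p<l. a p x * \<beta> p f) = (\<Sum>p<l. (\<Sum>i<k. \<alpha> p i * u i x) * \<beta> p f)"
      using that by (intro sum.cong) (auto simp: Q_def)
    also have "\<dots> = (\<Sum>p<l. \<Sum>i<k. \<alpha> p i * \<beta> p f * u i x)"
      by (simp add: sum_distrib_right mult.assoc mult.left_commute mult.commute[of "u _ _"])
    also have "\<dots> = (\<Sum>i<k. s f i * u i x)"
      by (subst sum.swap) (simp add: s_def sum_distrib_right)
    finally show ?thesis by (simp add: g_def)
  qed
  show ?thesis
  proof (cases "k = 0")
    \<comment> \<open>Here all \<open>a p\<close> vanish almost everywhere, so \<open>f\<close>
      coincides with its residual and zero samples suffice.\<close>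
    case True
    have "(\<integral>\<^sup>+x. ennreal ((app f x)\<^sup>2) \<partial>P) = (\<integral>\<^sup>+x. ennreal ((g f x)\<^sup>2) \<partial>P)" for f
      using Q by (intro nn_integral_cong_AE) (auto elim!: eventually_mono simp: sQ True)
    then have "(\<integral>\<^sup>+f. \<integral>\<^sup>+x. ennreal ((app f x)\<^sup>2) \<partial>P \<partial>\<mu>) \<le> ennreal E0" using g_err by simp
    also have "\<dots> \<le> ennreal (10 * E0)" using E0 by (intro ennreal_leI) auto
    finally show ?thesis by (intro exI[of _ 0]) auto
  next
    case False
    then have k1: "k \<ge> 1" by simp
    define m where "m = 8 * k\<^sup>2"
    from sampling_least_squares[OF prob_P k1 squ on \<gamma>0 \<gamma>i \<gamma>E E0 Q m_def] obtain y \<tau> B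
      where y': "\<forall>j<m. y j \<in> space P \<and> Q (y j) \<and> \<tau> j > 0"
        and yR: "(\<Sum>j<m. \<tau> j * \<gamma> (y j)) \<le> 2 * E0"
        and B: "\<forall>s z. (\<Sum>i<k. (s i - (\<Sum>j<m. B i j * z j))\<^sup>2) \<le> 2 * (\<Sum>j<m. \<tau> j * (z j - (\<Sum>i<k. s i * u i (y j)))\<^sup>2)"
      by blast
    have y: "y j \<in> space P" "Q (y j)" "\<tau> j > 0" if "j < m" for j using y' that by auto
    define b where "b j x = (\<Sum>i<k. B i j * u i x)" for j x
    have sqb: "sq_int P (b j)" for j unfolding b_def by (intro sq_int_lincomb squ) auto
    define d where "d f i = s f i - (\<Sum>j<m. B i j * app f (y j))" for f i
    \<comment> \<open>The factor \<open>4\<close> is \<open>2\<close> from the square of a sum times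
      \<open>2\<close> from the stability of least squares.\<close>
    have err_f: "(\<integral>\<^sup>+x. ennreal ((app f x - (\<Sum>j<m. app f (y j) * b j x))\<^sup>2) \<partial>P)
        \<le> 2 * (\<integral>\<^sup>+x. ennreal ((g f x)\<^sup>2) \<partial>P) + (\<Sum>j<m. ennreal (4 * \<tau> j) * ennreal ((g f (y j))\<^sup>2))" for f
    proof -
      have sqd: "sq_int P (\<lambda>x. \<Sum>i<k. d f i * u i x)" by (intro sq_int_lincomb squ) auto
      have dec: "app f x - (\<Sum>j<m. app f (y j) * b j x) = g f x + (\<Sum>i<k. d f i * u i x)" if "Q x" for x
      proof -
        have "(\<Sum>j<m. app f (y j) * b j x) = (\<Sum>j<m. \<Sum>i<k. B i j * app f (y j) * u i x)"
          by (simp add: b_def sum_distrib_left mult_ac)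
        also have "\<dots> = (\<Sum>i<k. (\<Sum>j<m. B i j * app f (y j)) * u i x)"
          by (subst sum.swap) (simp add: sum_distrib_right)
        finally show ?thesis using sQ[OF that] by (simp add: d_def left_diff_distrib sum_subtractf)
      qed
      have two: "(p + q)\<^sup>2 \<le> 2 * p\<^sup>2 + 2 * q\<^sup>2" for p q :: real
      proof -
        have "0 \<le> (p - q)\<^sup>2" by simp
        then show ?thesis unfolding power2_diff power2_sum by linarith
      qed
      have "(\<integral>\<^sup>+x. ennreal ((app f x - (\<Sum>j<m. app f (y j) * b j x))\<^sup>2) \<partial>P)
          \<le> (\<integral>\<^sup>+x. 2 * ennreal ((g f x)\<^sup>2) + 2 * ennreal ((\<Sum>i<k. d f i * u i x)\<^sup>2) \<partial>P)"
      proof (rule nn_integral_mono_AE)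
        show "AE x in P. ennreal ((app f x - (\<Sum>j<m. app f (y j) * b j x))\<^sup>2)
            \<le> 2 * ennreal ((g f x)\<^sup>2) + 2 * ennreal ((\<Sum>i<k. d f i * u i x)\<^sup>2)"
          using Q
        proof eventually_elim
          case (elim x)
          have "ennreal ((app f x - (\<Sum>j<m. app f (y j) * b j x))\<^sup>2) \<le> ennreal (2 * (g f x)\<^sup>2 + 2 * (\<Sum>i<k. d f i * u i x)\<^sup>2)"
            unfolding dec[OF elim] by (intro ennreal_leI two)
          also have "\<dots> = 2 * ennreal ((g f x)\<^sup>2) + 2 * ennreal ((\<Sum>i<k. d f i * u i x)\<^sup>2)"
            by (subst ennreal_plus) (auto simp: ennreal_mult')
          finally show ?case .
        qed
      qed
      also have "\<dots> = 2 * (\<integral>\<^sup>+x. ennreal ((g f x)\<^sup>2) \<partial>P) + 2 * (\<integral>\<^sup>+x. ennreal ((\<Sum>i<k. d f i * u i x)\<^sup>2) \<partial>P)"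
        using sqd by (subst nn_integral_add) (auto simp: nn_integral_cmult sq_int_def)
      also have "(\<integral>\<^sup>+x. ennreal ((\<Sum>i<k. d f i * u i x)\<^sup>2) \<partial>P) = ennreal (\<integral>x. (\<Sum>i<k. d f i * u i x)\<^sup>2 \<partial>P)"
        using sq_int_square[OF sqd] by (intro nn_integral_eq_integral) auto
      also have "(\<integral>x. (\<Sum>i<k. d f i * u i x)\<^sup>2 \<partial>P) = (\<Sum>i<k. (d f i)\<^sup>2)"
        by (rule integral_orthonormal_lincomb_square[OF squ on])
      also have "ennreal (\<Sum>i<k. (d f i)\<^sup>2) \<le> ennreal (\<Sum>j<m. 2 * \<tau> j * (g f (y j))\<^sup>2)"
      proof (rule ennreal_leI)
        have "(\<Sum>i<k. (d f i)\<^sup>2) \<le> 2 * (\<Sum>j<m. \<tau> j * (app f (y j) - (\<Sum>i<k. s f i * u i (y j)))\<^sup>2)"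
          unfolding d_def using B[rule_format, of "s f" "\<lambda>j. app f (y j)"] .
        also have "\<dots> = 2 * (\<Sum>j<m. \<tau> j * (g f (y j))\<^sup>2)"
          using sQ[OF y(2)] by (intro arg_cong[where f="\<lambda>t. 2 * t"] sum.cong) auto
        finally show "(\<Sum>i<k. (d f i)\<^sup>2) \<le> (\<Sum>j<m. 2 * \<tau> j * (g f (y j))\<^sup>2)"
          by (simp add: sum_distrib_left mult.assoc)
      qed
      also have "ennreal (\<Sum>j<m. 2 * \<tau> j * (g f (y j))\<^sup>2) = (\<Sum>j<m. ennreal (2 * \<tau> j * (g f (y j))\<^sup>2))"
        using y(3) by (intro sum_ennreal[symmetric] mult_nonneg_nonneg) (auto intro: less_imp_le)
      also have "2 * \<dots> = (\<Sum>j<m. ennreal (4 * \<tau> j) * ennreal ((g f (y j))\<^sup>2))"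
        unfolding sum_distrib_left
      proof (intro sum.cong refl)
        fix j assume "j \<in> {..<m}"
        then have t: "\<tau> j > 0" using y(3) by simp
        have "2 * ennreal (2 * \<tau> j * (g f (y j))\<^sup>2) = ennreal (2 * (2 * \<tau> j * (g f (y j))\<^sup>2))"
          using t by (subst ennreal_mult) auto
        also have "\<dots> = ennreal ((4 * \<tau> j) * (g f (y j))\<^sup>2)" by (simp add: mult_ac)
        also have "\<dots> = ennreal (4 * \<tau> j) * ennreal ((g f (y j))\<^sup>2)"
          using t by (intro ennreal_mult) auto
        finally show "2 * ennreal (2 * \<tau> j * (g f (y j))\<^sup>2) = ennreal (4 * \<tau> j) * ennreal ((g f (y j))\<^sup>2)" .
      qed
      finally show ?thesis by (simp add: add_left_mono mult_left_mono)
    qed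
    have gmf: "(\<lambda>f. \<integral>\<^sup>+x. ennreal ((g f x)\<^sup>2) \<partial>P) \<in> borel_measurable \<mu>"
      using P.borel_measurable_nn_integral[OF g2_pair] by simp
    have gym: "(\<lambda>f. ennreal ((g f (y j))\<^sup>2)) \<in> borel_measurable \<mu>" if "j < m" for j
    proof -
      have "sq_int \<mu> (\<lambda>f. g f (y j))" unfolding g_def
        by (intro sq_int_diff app_sq_int y that sq_int_lincomb bounded_linear_sq_int \<beta>) auto
      then show ?thesis by (auto simp: sq_int_def)
    qed
    have "(\<integral>\<^sup>+f. \<integral>\<^sup>+x. ennreal ((app f x - (\<Sum>j<m. app f (y j) * b j x))\<^sup>2) \<partial>P \<partial>\<mu>)
        \<le> (\<integral>\<^sup>+f. 2 * (\<integral>\<^sup>+x. ennreal ((g f x)\<^sup>2) \<partial>P) + (\<Sum>j<m. ennreal (4 * \<tau> j) * ennreal ((g f (y j))\<^sup>2)) \<partial>\<mu>)"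
      by (intro nn_integral_mono err_f)
    also have "\<dots> = 2 * (\<integral>\<^sup>+f. \<integral>\<^sup>+x. ennreal ((g f x)\<^sup>2) \<partial>P \<partial>\<mu>) + (\<Sum>j<m. ennreal (4 * \<tau> j) * (\<integral>\<^sup>+f. ennreal ((g f (y j))\<^sup>2) \<partial>\<mu>))"
    proof -
      have cm: "(\<lambda>f. ennreal (4 * \<tau> j) * ennreal ((g f (y j))\<^sup>2)) \<in> borel_measurable \<mu>" if "j \<in> {..<m}" for j
        using gym[of j] that by (intro borel_measurable_times_ennreal) auto
      have "(\<integral>\<^sup>+f. (\<Sum>j<m. ennreal (4 * \<tau> j) * ennreal ((g f (y j))\<^sup>2)) \<partial>\<mu>)
          = (\<Sum>j<m. \<integral>\<^sup>+f. ennreal (4 * \<tau> j) * ennreal ((g f (y j))\<^sup>2) \<partial>\<mu>)"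
        by (rule nn_integral_sum[OF cm])
      also have "\<dots> = (\<Sum>j<m. ennreal (4 * \<tau> j) * (\<integral>\<^sup>+f. ennreal ((g f (y j))\<^sup>2) \<partial>\<mu>))"
        using gym by (intro sum.cong refl nn_integral_cmult) auto
      finally have sums: "(\<integral>\<^sup>+f. (\<Sum>j<m. ennreal (4 * \<tau> j) * ennreal ((g f (y j))\<^sup>2)) \<partial>\<mu>)
          = (\<Sum>j<m. ennreal (4 * \<tau> j) * (\<integral>\<^sup>+f. ennreal ((g f (y j))\<^sup>2) \<partial>\<mu>))" .
      have "(\<lambda>f. \<Sum>j<m. ennreal (4 * \<tau> j) * ennreal ((g f (y j))\<^sup>2)) \<in> borel_measurable \<mu>"
        by (intro borel_measurable_sum cm)
      then show ?thesis
        using gmf sums by (subst nn_integral_add) (auto simp: nn_integral_cmult)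
    qed
    also have "(\<Sum>j<m. ennreal (4 * \<tau> j) * (\<integral>\<^sup>+f. ennreal ((g f (y j))\<^sup>2) \<partial>\<mu>)) = (\<Sum>j<m. ennreal (4 * (\<tau> j * \<gamma> (y j))))"
      using y \<gamma>0 by (intro sum.cong refl) (simp add: gnn ennreal_mult[symmetric] less_imp_le mult.assoc)
    also have "\<dots> = ennreal (4 * (\<Sum>j<m. \<tau> j * \<gamma> (y j)))"
      unfolding sum_distrib_left using y \<gamma>0 by (intro sum_ennreal mult_nonneg_nonneg) (auto intro: less_imp_le)
    \<comment> \<open>The sampled part contributes \<open>4\<close> times the bound
      \<open>2 * E0\<close>; with \<open>2 * E0\<close> from \<open>g\<close> itself this gives the
      factor \<open>10\<close>.\<close>
    also have "2 * (\<integral>\<^sup>+f. \<integral>\<^sup>+x. ennreal ((g f x)\<^sup>2) \<partial>P \<partial>\<mu>) + \<dots> \<le> 2 * ennreal E0 + ennreal (8 * E0)"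
      using yR by (intro add_mono mult_left_mono g_err ennreal_leI) auto
    also have "\<dots> = ennreal (2 * E0) + ennreal (8 * E0)" using E0 by (simp add: ennreal_mult)
    also have "\<dots> = ennreal (10 * E0)" using E0 by (subst ennreal_plus[symmetric]) auto
    finally show ?thesis
      using k l y(1) sqb unfolding m_def by (intro exI[of _ k] conjI exI[of _ y] exI[of _ b]) auto
  qed
qed

end

section \<open>Comparison of the information complexities\<close>

text \<open>The restriction makes the carrier exactly \<open>D d\<close>, so points chosen in
  \<open>space\<close> are admissible for \<open>Lambda_std\<close>.\<close>

definition density_space :: "(nat \<Rightarrow> (nat \<Rightarrow> real) set) \<Rightarrow> (nat \<Rightarrow> (nat \<Rightarrow> real) \<Rightarrow> real) \<Rightarrow> nat \<Rightarrow> (nat \<Rightarrow> real) measure" where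
  "density_space D \<rho> d = density (restrict_space (Rd d) (D d)) (\<lambda>x. ennreal (\<rho> d x))"

lemma sets_density_space: "sets (density_space D \<rho> d) = sets (restrict_space (Rd d) (D d))"
  by (simp add: density_space_def)

context
  fixes D :: "nat \<Rightarrow> (nat \<Rightarrow> real) set"
    and \<rho> :: "nat \<Rightarrow> (nat \<Rightarrow> real) \<Rightarrow> real"
    and V :: "nat \<Rightarrow> 'f::{banach, second_countable_topology} set"
    and evl :: "nat \<Rightarrow> 'f \<Rightarrow> (nat \<Rightarrow> real) \<Rightarrow> real"
    and \<mu> :: "nat \<Rightarrow> 'f measure" and d :: nat
  assumes setting: "avg_app_setting D \<rho> V evl \<mu>" and d: "d \<ge> 1"
begin

private lemma setting_d:
  "D d \<in> sets (Rd d)" "\<rho> d \<in> borel_measurable (Rd d)" "\<And>x. x \<in> D d \<Longrightarrow> \<rho> d x \<ge> 0"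
  "(\<integral>\<^sup>+ x. ennreal (\<rho> d x) * indicator (D d) x \<partial>Rd d) = 1" "closed (V d)"
  "\<And>x. x \<in> D d \<Longrightarrow> bounded_linear (\<lambda>f. evl d f x)"
  "\<And>f. f \<in> V d \<Longrightarrow> evl d f \<in> borel_measurable (restrict_space (Rd d) (D d))"
  "\<exists>C. \<forall>f\<in>V d. G_normsq d D \<rho> (evl d f) \<le> ennreal (C * (norm f)\<^sup>2)"
  "gaussian_measure (\<mu> d) (V d)"
proof -
  note s = setting[unfolded avg_app_setting_def, THEN spec, THEN mp, OF d]
  note s' = s[THEN conjunct2, THEN conjunct2]
  show "D d \<in> sets (Rd d)" by (rule s[THEN conjunct1])
  show "\<rho> d \<in> borel_measurable (Rd d)" by (rule s'[THEN conjunct1])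
  note s' = s'[THEN conjunct2]
  show "\<rho> d x \<ge> 0" if "x \<in> D d" for x by (rule s'[THEN conjunct1, THEN bspec, OF that])
  note s' = s'[THEN conjunct2]
  show "(\<integral>\<^sup>+ x. ennreal (\<rho> d x) * indicator (D d) x \<partial>Rd d) = 1" by (rule s'[THEN conjunct1])
  note s' = s'[THEN conjunct2, THEN conjunct2]
  show "closed (V d)" by (rule s'[THEN conjunct1])
  note s' = s'[THEN conjunct2]
  show "bounded_linear (\<lambda>f. evl d f x)" if "x \<in> D d" for x by (rule s'[THEN conjunct1, THEN bspec, OF that])
  note s' = s'[THEN conjunct2, THEN conjunct2]
  show "evl d f \<in> borel_measurable (restrict_space (Rd d) (D d))" if "f \<in> V d" for f
    by (rule s'[THEN conjunct1, THEN bspec, OF that])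
  note s' = s'[THEN conjunct2]
  show "\<exists>C. \<forall>f\<in>V d. G_normsq d D \<rho> (evl d f) \<le> ennreal (C * (norm f)\<^sup>2)" by (rule s'[THEN conjunct1])
  show "gaussian_measure (\<mu> d) (V d)" by (rule s'[THEN conjunct2])
qed

private lemma space_density_space: "space (density_space D \<rho> d) = D d"
  using sets.sets_into_space[OF setting_d(1)] by (auto simp: density_space_def space_restrict_space)

private lemma D_Int: "D d \<inter> space (Rd d) \<in> sets (Rd d)"
  using setting_d(1) by auto

private lemma rho_restrict: "(\<lambda>x. ennreal (\<rho> d x)) \<in> borel_measurable (restrict_space (Rd d) (D d))"
  using setting_d(2) by (intro measurable_restrict_space1) measurable

private lemma G_normsq_eq:
  assumes "h \<in> borel_measurable (density_space D \<rho> d)"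
  shows "G_normsq d D \<rho> h = (\<integral>\<^sup>+x. ennreal ((h x)\<^sup>2) \<partial>density_space D \<rho> d)"
proof -
  have h[measurable]: "h \<in> borel_measurable (restrict_space (Rd d) (D d))"
    using assms measurable_cong_sets[OF sets_density_space refl] by blast
  have "(\<integral>\<^sup>+x. ennreal ((h x)\<^sup>2) \<partial>density_space D \<rho> d)
      = (\<integral>\<^sup>+x. ennreal (\<rho> d x) * ennreal ((h x)\<^sup>2) \<partial>restrict_space (Rd d) (D d))"
    unfolding density_space_def by (rule nn_integral_density[OF rho_restrict]) measurable
  also have "\<dots> = (\<integral>\<^sup>+x. (ennreal (\<rho> d x) * ennreal ((h x)\<^sup>2)) * indicator (D d) x \<partial>Rd d)"
    by (rule nn_integral_restrict_space[OF D_Int])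
  also have "\<dots> = G_normsq d D \<rho> h"
    unfolding G_normsq_def
    by (intro nn_integral_cong) (auto simp: indicator_def setting_d(3) ennreal_mult' mult.commute)
  finally show ?thesis by simp
qed

private lemma approximation:
  "gaussian_approximation (\<mu> d) (V d) (density_space D \<rho> d) (evl d)"
proof (rule gaussian_approximation.intro)
  note g = setting_d(9)[unfolded gaussian_measure_def]
  show "prob_space (\<mu> d)" by (rule g[THEN conjunct1])
  note g = g[THEN conjunct2]
  show "sets (\<mu> d) = sets borel" by (rule g[THEN conjunct1])
  note g = g[THEN conjunct2]
  show "emeasure (\<mu> d) (V d) = 1" by (rule g[THEN conjunct1])
  show "centered_gaussian_real (distr (\<mu> d) borel L)" if "bounded_linear L" for L
    by (rule g[THEN conjunct2, THEN spec, THEN mp, OF that])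
  show "closed (V d)" by (rule setting_d(5))
  have "emeasure (density_space D \<rho> d) (D d) = (\<integral>\<^sup>+x. ennreal (\<rho> d x) * indicator (D d) x \<partial>restrict_space (Rd d) (D d))"
    unfolding density_space_def using setting_d(1) sets.sets_into_space[OF setting_d(1)]
    by (intro emeasure_density[OF rho_restrict]) (auto simp: sets_restrict_space_iff D_Int)
  also have "\<dots> = (\<integral>\<^sup>+x. (ennreal (\<rho> d x) * indicator (D d) x) * indicator (D d) x \<partial>Rd d)"
    by (rule nn_integral_restrict_space[OF D_Int])
  also have "\<dots> = (\<integral>\<^sup>+x. ennreal (\<rho> d x) * indicator (D d) x \<partial>Rd d)"
    by (intro nn_integral_cong) (auto simp: indicator_def)
  finally show "prob_space (density_space D \<rho> d)"
    using setting_d(4) by (intro prob_spaceI) (simp add: space_density_space)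
  show "bounded_linear (\<lambda>f. evl d f x)" if "x \<in> space (density_space D \<rho> d)" for x
    using that setting_d(6) by (simp add: space_density_space)
  show m: "evl d f \<in> borel_measurable (density_space D \<rho> d)" if "f \<in> V d" for f
    using setting_d(7)[OF that] unfolding measurable_cong_sets[OF sets_density_space refl] .
  show "(\<integral>\<^sup>+x. ennreal ((evl d f x)\<^sup>2) \<partial>density_space D \<rho> d) < \<infinity>" if "f \<in> V d" for f
  proof -
    from setting_d(8) obtain C where "\<forall>f\<in>V d. G_normsq d D \<rho> (evl d f) \<le> ennreal (C * (norm f)\<^sup>2)" ..
    from bspec[OF this that] have "G_normsq d D \<rho> (evl d f) \<le> ennreal (C * (norm f)\<^sup>2)" .
    also have "\<dots> < \<infinity>" by simp
    finally show ?thesis using G_normsq_eq[OF m[OF that]] by simp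
  qed
qed

interpretation A: gaussian_approximation "\<mu> d" "V d" "density_space D \<rho> d" "evl d"
  by (rule approximation)

private lemma joint_measurable_iff:
  "F \<in> borel_measurable (PiM {..<n} (\<lambda>_. borel) \<Otimes>\<^sub>M restrict_space (Rd d) (D d)) \<longleftrightarrow>
   F \<in> borel_measurable (PiM {..<n} (\<lambda>_. borel) \<Otimes>\<^sub>M density_space D \<rho> d)"
  for F :: "(nat \<Rightarrow> real) \<times> (nat \<Rightarrow> real) \<Rightarrow> real"
  by (subst measurable_cong_sets[OF sets_pair_measure_cong[OF refl sets_density_space] refl]) (rule refl)

private lemma alg_err2_eq:
  assumes \<phi>: "(\<lambda>(y, x). \<phi> y x) \<in> borel_measurable (PiM {..<n} (\<lambda>_. borel) \<Otimes>\<^sub>M density_space D \<rho> d)"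
  shows "alg_err2 D \<rho> evl \<mu> d n L \<phi> =
    (\<integral>\<^sup>+f. \<integral>\<^sup>+x. ennreal ((A.app f x - \<phi> (restrict (\<lambda>i. L i f) {..<n}) x)\<^sup>2) \<partial>density_space D \<rho> d \<partial>\<mu> d)"
  unfolding alg_err2_def
proof (rule nn_integral_cong_AE)
  show "AE f in \<mu> d. G_normsq d D \<rho> (\<lambda>x. evl d f x - \<phi> (restrict (\<lambda>i. L i f) {..<n}) x) =
      (\<integral>\<^sup>+x. ennreal ((A.app f x - \<phi> (restrict (\<lambda>i. L i f) {..<n}) x)\<^sup>2) \<partial>density_space D \<rho> d)"
    using A.AE_V
  proof eventually_elim
    case (elim f)
    define y where "y = restrict (\<lambda>i. L i f) {..<n}"
    have y: "y \<in> space (PiM {..<n} (\<lambda>_. borel))" by (auto simp: y_def space_PiM)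
    have "\<phi> y \<in> borel_measurable (density_space D \<rho> d)"
      using measurable_compose[OF measurable_Pair[OF measurable_const[OF y] measurable_ident] \<phi>] by simp
    then have "(\<lambda>x. A.app f x - \<phi> y x) \<in> borel_measurable (density_space D \<rho> d)"
      by measurable
    moreover have "A.app f x = evl d f x" for x using elim by (simp add: A.app_def)
    ultimately show ?case unfolding y_def[symmetric] using G_normsq_eq[of "\<lambda>x. evl d f x - \<phi> y x"] by simp
  qed
qed

text \<open>A bridge from error bounds for the truncated paths to the complexity; the two error
  integrands agree because almost every path lies in \<open>V\<close>.\<close>

private lemma min_err2_std_le:
  assumes n: "n \<ge> 1" and y: "\<And>j. j < n \<Longrightarrow> y j \<in> D d"
    and \<phi>: "(\<lambda>(y, x). \<phi> y x) \<in> borel_measurable (PiM {..<n} (\<lambda>_. borel) \<Otimes>\<^sub>M density_space D \<rho> d)"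
    and fin: "\<And>z. (\<integral>\<^sup>+x. ennreal ((\<phi> z x)\<^sup>2) \<partial>density_space D \<rho> d) < \<infinity>"
    and err: "(\<integral>\<^sup>+f. \<integral>\<^sup>+x. ennreal ((A.app f x - \<phi> (restrict (\<lambda>j. A.app f (y j)) {..<n}) x)\<^sup>2) \<partial>density_space D \<rho> d \<partial>\<mu> d) \<le> E"
  shows "min_err2 D \<rho> evl \<mu> (Lambda_std D evl) n d \<le> E"
proof -
  define L where "L j f = evl d f (y j)" for j :: nat and f
  have adm: "admissible_alg D \<rho> (Lambda_std D evl) d n L \<phi>"
    unfolding admissible_alg_def
  proof (intro conjI allI impI ballI)
    fix i assume "i < n"
    then show "Lambda_std D evl d (L i)" unfolding Lambda_std_def L_def using y by blast
  next
    show "(\<lambda>(y, x). \<phi> y x) \<in> borel_measurable (PiM {..<n} (\<lambda>_. borel) \<Otimes>\<^sub>M restrict_space (Rd d) (D d))"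
      using \<phi> unfolding joint_measurable_iff .
  next
    fix z :: "nat \<Rightarrow> real" assume z: "z \<in> space (PiM {..<n} (\<lambda>_. borel))"
    have "\<phi> z \<in> borel_measurable (density_space D \<rho> d)"
      using measurable_compose[OF measurable_Pair[OF measurable_const[OF z] measurable_ident] \<phi>] by simp
    then show "G_normsq d D \<rho> (\<phi> z) < \<infinity>" using G_normsq_eq fin by simp
  qed
  have "min_err2 D \<rho> evl \<mu> (Lambda_std D evl) n d \<le> alg_err2 D \<rho> evl \<mu> d n L \<phi>"
    unfolding min_err2_def using n adm by (auto intro!: INF_lower2[of "(L, \<phi>)"])
  also have "\<dots> = (\<integral>\<^sup>+f. \<integral>\<^sup>+x. ennreal ((A.app f x - \<phi> (restrict (\<lambda>j. A.app f (y j)) {..<n}) x)\<^sup>2) \<partial>density_space D \<rho> d \<partial>\<mu> d)"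
    unfolding alg_err2_eq[OF \<phi>]
    using A.AE_app by (intro nn_integral_cong_AE) (auto elim!: eventually_mono simp: L_def)
  finally show ?thesis using err by (rule order_trans)
qed

lemma min_err2_all_le_std:
  "min_err2 D \<rho> evl \<mu> Lambda_all n d \<le> min_err2 D \<rho> evl \<mu> (Lambda_std D evl) n d"
proof (cases "n = 0")
  case False
  have "Lambda_all d L" if "Lambda_std D evl d L" for L
    using that setting_d(6) by (auto simp: Lambda_std_def Lambda_all_def)
  then have "admissible_alg D \<rho> Lambda_all d n L \<phi>" if "admissible_alg D \<rho> (Lambda_std D evl) d n L \<phi>" for L \<phi>
    using that by (auto simp: admissible_alg_def)
  then show ?thesis using False
    unfolding min_err2_def by (auto intro!: INF_superset_mono)
qed (simp add: min_err2_def)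

text \<open>Guarantees that the minimum defining \<open>n_abs\<close> is attained, for samples and
  hence also for arbitrary functionals.\<close>

lemma min_err2_std_small:
  assumes \<delta>: "\<delta> > 0"
  shows "\<exists>n. min_err2 D \<rho> evl \<mu> (Lambda_std D evl) n d \<le> ennreal \<delta>"
proof -
  from A.sampling_consistent[OF \<delta>] obtain n :: nat and y :: "nat \<Rightarrow> nat \<Rightarrow> real" and J where n: "n \<ge> 1"
    and y: "\<forall>j. y j \<in> space (density_space D \<rho> d)"
    and J: "J \<in> measurable (density_space D \<rho> d) (count_space UNIV)"
    and err: "(\<integral>\<^sup>+f. \<integral>\<^sup>+x. ennreal ((A.app f x - (if J x < n then A.app f (y (J x)) else 0))\<^sup>2) \<partial>density_space D \<rho> d \<partial>\<mu> d) \<le> ennreal \<delta>"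
    by blast
  \<comment> \<open>The selection of the datum with index \<open>J x\<close> is written as a finite
    sum, which makes joint measurability in data and point immediate.\<close>
  define \<phi> where "\<phi> z x = (\<Sum>j<n. z j * indicator {x. J x = j} x)" for z :: "nat \<Rightarrow> real" and x
  have \<phi>_eq: "\<phi> z x = (if J x < n then z (J x) else 0)" for z x
    by (auto simp: \<phi>_def indicator_def if_distrib[of "\<lambda>t. _ * t"] cong: if_cong)
  have Jm: "(\<lambda>x. indicator {x. J x = j} x :: real) \<in> borel_measurable (density_space D \<rho> d)" for j
  proof -
    have "(\<lambda>x. indicator {j} (J x) :: real) \<in> borel_measurable (density_space D \<rho> d)"
      by (rule measurable_compose[OF J]) simp
    then show ?thesis by (simp add: indicator_def)
  qed
  have "min_err2 D \<rho> evl \<mu> (Lambda_std D evl) n d \<le> ennreal \<delta>"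
  proof (rule min_err2_std_le[OF n])
    show "y j \<in> D d" for j using y space_density_space by blast
    show "(\<lambda>(z, x). \<phi> z x) \<in> borel_measurable (PiM {..<n} (\<lambda>_. borel) \<Otimes>\<^sub>M density_space D \<rho> d)"
    proof -
      have "(\<lambda>w. (fst w) j * (indicator {x. J x = j} (snd w) :: real)) \<in> borel_measurable (PiM {..<n} (\<lambda>_. borel) \<Otimes>\<^sub>M density_space D \<rho> d)"
        if "j \<in> {..<n}" for j
        by (rule borel_measurable_times)
           (rule measurable_compose[OF measurable_fst measurable_component_singleton[OF that]],
            rule measurable_compose[OF measurable_snd Jm])
      then show ?thesis unfolding \<phi>_def case_prod_unfold by (rule borel_measurable_sum)
    qed
    show "(\<integral>\<^sup>+x. ennreal ((\<phi> z x)\<^sup>2) \<partial>density_space D \<rho> d) < \<infinity>" for z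
    proof -
      have "(\<phi> z x)\<^sup>2 \<le> (\<Sum>j<n. (z j)\<^sup>2)" for x
        by (auto simp: \<phi>_eq intro!: member_le_sum sum_nonneg)
      then have "(\<integral>\<^sup>+x. ennreal ((\<phi> z x)\<^sup>2) \<partial>density_space D \<rho> d) \<le> (\<integral>\<^sup>+x. ennreal (\<Sum>j<n. (z j)\<^sup>2) \<partial>density_space D \<rho> d)"
        by (intro nn_integral_mono ennreal_leI)
      also have "\<dots> < \<infinity>" by (simp add: A.P.emeasure_space_1)
      finally show ?thesis .
    qed
    show "(\<integral>\<^sup>+f. \<integral>\<^sup>+x. ennreal ((A.app f x - \<phi> (restrict (\<lambda>j. A.app f (y j)) {..<n}) x)\<^sup>2) \<partial>density_space D \<rho> d \<partial>\<mu> d) \<le> ennreal \<delta>"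
    proof -
      have "\<phi> (restrict (\<lambda>j. A.app f (y j)) {..<n}) x = (if J x < n then A.app f (y (J x)) else 0)" for f x
        by (simp add: \<phi>_eq)
      then show ?thesis using err by simp
    qed
  qed
  then show ?thesis by blast
qed

text \<open>The infimum over algorithms need not be attained, so one with squared error below
  \<open>2 * \<delta>\<close> is taken; the reconstruction multiplies this by
  \<open>10\<close>.\<close>

lemma min_err2_std_le_all:
  assumes err: "min_err2 D \<rho> evl \<mu> Lambda_all n d \<le> ennreal \<delta>" and \<delta>: "\<delta> > 0"
  shows "\<exists>m\<le>8 * n\<^sup>2. min_err2 D \<rho> evl \<mu> (Lambda_std D evl) m d \<le> ennreal (20 * \<delta>)"
proof (cases "n = 0")
  case True
  have "min_err2 D \<rho> evl \<mu> (Lambda_std D evl) 0 d = min_err2 D \<rho> evl \<mu> Lambda_all n d"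
    by (simp add: min_err2_def True)
  also have "\<dots> \<le> ennreal (20 * \<delta>)" using err \<delta> by (auto intro: order_trans ennreal_leI)
  finally show ?thesis by (intro exI[of _ 0]) simp
next
  case False
  have "min_err2 D \<rho> evl \<mu> Lambda_all n d < ennreal (2 * \<delta>)"
    using \<delta> by (intro order_le_less_trans[OF err]) (simp add: ennreal_less_iff)
  then obtain L \<phi> where adm: "admissible_alg D \<rho> Lambda_all d n L \<phi>"
    and e: "alg_err2 D \<rho> evl \<mu> d n L \<phi> < ennreal (2 * \<delta>)"
    using False unfolding min_err2_def by (auto simp: INF_less_iff)
  have L: "bounded_linear (L i)" if "i < n" for i
    using adm that by (auto simp: admissible_alg_def Lambda_all_def)
  have \<phi>: "(\<lambda>(y, x). \<phi> y x) \<in> borel_measurable (PiM {..<n} (\<lambda>_. borel) \<Otimes>\<^sub>M density_space D \<rho> d)"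
    by (rule adm[unfolded admissible_alg_def, THEN conjunct2, THEN conjunct1, unfolded joint_measurable_iff])
  have "2 * \<delta> > 0" using \<delta> by simp
  from A.standard_reconstruction[OF L \<phi> less_imp_le[OF e[unfolded alg_err2_eq[OF \<phi>]]] this]
  obtain k :: nat and y :: "nat \<Rightarrow> nat \<Rightarrow> real" and b :: "nat \<Rightarrow> (nat \<Rightarrow> real) \<Rightarrow> real" where k: "k \<le> n"
    and y: "\<forall>j<8 * k\<^sup>2. y j \<in> space (density_space D \<rho> d)" and b: "\<forall>j<8 * k\<^sup>2. sq_int (density_space D \<rho> d) (b j)"
    and err: "(\<integral>\<^sup>+f. \<integral>\<^sup>+x. ennreal ((A.app f x - (\<Sum>j<8 * k\<^sup>2. A.app f (y j) * b j x))\<^sup>2) \<partial>density_space D \<rho> d \<partial>\<mu> d) \<le> ennreal (10 * (2 * \<delta>))"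
    by blast
  define m where "m = 8 * k\<^sup>2"
  define \<psi> where "\<psi> z x = (\<Sum>j<m. z j * b j x)" for z :: "nat \<Rightarrow> real" and x
  have bsq: "sq_int (density_space D \<rho> d) (b j)" if "j < m" for j using b that by (simp add: m_def)
  have \<psi>m: "(\<lambda>(z, x). \<psi> z x) \<in> borel_measurable (PiM {..<m} (\<lambda>_. borel) \<Otimes>\<^sub>M density_space D \<rho> d)"
  proof -
    have "(\<lambda>w. (fst w) j * b j (snd w)) \<in> borel_measurable (PiM {..<m} (\<lambda>_. borel) \<Otimes>\<^sub>M density_space D \<rho> d)"
      if "j \<in> {..<m}" for j
    proof (rule borel_measurable_times)
      show "(\<lambda>w. fst w j) \<in> borel_measurable (PiM {..<m} (\<lambda>_. borel) \<Otimes>\<^sub>M density_space D \<rho> d)"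
        by (rule measurable_compose[OF measurable_fst measurable_component_singleton[OF that]])
      have "j < m" using that by simp
      show "(\<lambda>w. b j (snd w)) \<in> borel_measurable (PiM {..<m} (\<lambda>_. borel) \<Otimes>\<^sub>M density_space D \<rho> d)"
        by (rule measurable_compose[OF measurable_snd sq_int_measurable[OF bsq[OF \<open>j < m\<close>]]])
    qed
    then show ?thesis unfolding \<psi>_def case_prod_unfold by (rule borel_measurable_sum)
  qed
  have \<psi>err: "(\<integral>\<^sup>+f. \<integral>\<^sup>+x. ennreal ((A.app f x - \<psi> (restrict (\<lambda>j. A.app f (y j)) {..<m}) x)\<^sup>2) \<partial>density_space D \<rho> d \<partial>\<mu> d) \<le> ennreal (20 * \<delta>)"
    using err by (simp add: \<psi>_def m_def)
  have "min_err2 D \<rho> evl \<mu> (Lambda_std D evl) m d \<le> ennreal (20 * \<delta>)"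
  \<comment> \<open>Without samples the error is by definition that of the zero algorithm, which
    agrees with the empty sum \<open>\<psi>\<close>.\<close>
  proof (cases "m = 0")
    case True
    have "alg_err2 D \<rho> evl \<mu> d 0 (\<lambda>_ _. 0) (\<lambda>_ _. 0) =
      (\<integral>\<^sup>+f. \<integral>\<^sup>+x. ennreal ((A.app f x - 0)\<^sup>2) \<partial>density_space D \<rho> d \<partial>\<mu> d)"
      by (rule alg_err2_eq) simp
    then show ?thesis using \<psi>err True by (simp add: min_err2_def \<psi>_def)
  next
    case False
    show ?thesis
    proof (rule min_err2_std_le[OF _ _ \<psi>m _ \<psi>err])
      show "y j \<in> D d" if "j < m" for j using y that space_density_space by (simp add: m_def)
      show "(\<integral>\<^sup>+x. ennreal ((\<psi> z x)\<^sup>2) \<partial>density_space D \<rho> d) < \<infinity>" for z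
      proof -
        have "sq_int (density_space D \<rho> d) (\<psi> z)"
          unfolding \<psi>_def by (intro sq_int_lincomb bsq) auto
        from nn_integral_eq_integral[OF sq_int_square[OF this]] show ?thesis by simp
      qed
    qed (use False in simp)
  qed
  moreover have "m \<le> 8 * n\<^sup>2" using k by (simp add: m_def power_mono)
  ultimately show ?thesis by blast
qed

text \<open>Any divisor whose square is at least \<open>20\<close> absorbs the loss in the squared
  error; \<open>5\<close> gives \<open>20 / 25\<close>.\<close>

lemma n_abs_std_le_all:
  assumes \<epsilon>: "\<epsilon> > 0"
  shows "n_abs D \<rho> evl \<mu> (Lambda_std D evl) \<epsilon> d \<le> 8 * (n_abs D \<rho> evl \<mu> Lambda_all (\<epsilon> / 5) d)\<^sup>2"
proof -
  define n where "n = n_abs D \<rho> evl \<mu> Lambda_all (\<epsilon> / 5) d"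
  have p: "(\<epsilon> / 5)\<^sup>2 > 0" using \<epsilon> by simp
  have "\<exists>n. min_err2 D \<rho> evl \<mu> Lambda_all n d \<le> ennreal ((\<epsilon> / 5)\<^sup>2)"
    using min_err2_std_small[OF p] min_err2_all_le_std order_trans by blast
  then have "min_err2 D \<rho> evl \<mu> Lambda_all n d \<le> ennreal ((\<epsilon> / 5)\<^sup>2)"
    unfolding n_def n_abs_def by (rule LeastI_ex)
  from min_err2_std_le_all[OF this p] obtain m where m: "m \<le> 8 * n\<^sup>2"
    and e: "min_err2 D \<rho> evl \<mu> (Lambda_std D evl) m d \<le> ennreal (20 * (\<epsilon> / 5)\<^sup>2)" by blast
  have "20 * (\<epsilon> / 5)\<^sup>2 \<le> \<epsilon>\<^sup>2" by (simp add: power_divide)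
  then have "min_err2 D \<rho> evl \<mu> (Lambda_std D evl) m d \<le> ennreal (\<epsilon>\<^sup>2)"
    using e by (blast intro: order_trans ennreal_leI)
  then have "n_abs D \<rho> evl \<mu> (Lambda_std D evl) \<epsilon> d \<le> m"
    unfolding n_abs_def by (rule Least_le)
  with m show ?thesis unfolding n_def by simp
qed

text \<open>Samples are continuous linear functionals, which compares errors at equal
  \<open>n\<close>. This passes to the least indices because the one for samples is
  attained.\<close>

lemma n_abs_all_le_std:
  assumes \<epsilon>: "\<epsilon> > 0"
  shows "n_abs D \<rho> evl \<mu> Lambda_all \<epsilon> d \<le> n_abs D \<rho> evl \<mu> (Lambda_std D evl) \<epsilon> d"
proof -
  have "\<epsilon>\<^sup>2 > 0" using \<epsilon> by simp
  from LeastI_ex[OF min_err2_std_small[OF this]]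
  have "min_err2 D \<rho> evl \<mu> (Lambda_std D evl) (n_abs D \<rho> evl \<mu> (Lambda_std D evl) \<epsilon> d) d \<le> ennreal (\<epsilon>\<^sup>2)"
    unfolding n_abs_def .
  then have "min_err2 D \<rho> evl \<mu> Lambda_all (n_abs D \<rho> evl \<mu> (Lambda_std D evl) \<epsilon> d) d \<le> ennreal (\<epsilon>\<^sup>2)"
    using min_err2_all_le_std order_trans by blast
  then show ?thesis unfolding n_abs_def[of _ _ _ _ Lambda_all] by (rule Least_le)
qed

end

section \<open>Passage to the logarithmic limit\<close>

lemma ALG_WT_mono:
  assumes "ALG_WT s t N1" and le: "\<And>\<epsilon> d. d \<ge> 1 \<Longrightarrow> \<epsilon> > 0 \<Longrightarrow> N2 \<epsilon> d \<le> N1 \<epsilon> d"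
  shows "ALG_WT s t N2"
  unfolding ALG_WT_def
proof (intro allI impI)
  fix \<eta> :: real assume "\<eta> > 0"
  from assms(1)[unfolded ALG_WT_def, THEN spec, THEN mp, OF this] obtain M
    where M: "\<forall>d \<epsilon>. 1 \<le> d \<and> 0 < \<epsilon> \<and> \<epsilon> < 1 \<and> M < 1 / \<epsilon> + real d \<longrightarrow>
      ln (max 1 (real (N1 \<epsilon> d))) / (\<epsilon> powr (-s) + real d powr t) < \<eta>" ..
  show "\<exists>M. \<forall>d \<epsilon>. 1 \<le> d \<and> 0 < \<epsilon> \<and> \<epsilon> < 1 \<and> M < 1 / \<epsilon> + real d \<longrightarrow>
      ln (max 1 (real (N2 \<epsilon> d))) / (\<epsilon> powr (-s) + real d powr t) < \<eta>"
  proof (intro exI[of _ M] allI impI)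
    fix d :: nat and \<epsilon> :: real assume a: "1 \<le> d \<and> 0 < \<epsilon> \<and> \<epsilon> < 1 \<and> M < 1 / \<epsilon> + real d"
    have "ln (max 1 (real (N2 \<epsilon> d))) / (\<epsilon> powr (-s) + real d powr t) \<le>
        ln (max 1 (real (N1 \<epsilon> d))) / (\<epsilon> powr (-s) + real d powr t)"
      using le[of d \<epsilon>] a by (intro divide_right_mono) auto
    then show "ln (max 1 (real (N2 \<epsilon> d))) / (\<epsilon> powr (-s) + real d powr t) < \<eta>"
      using M[THEN spec, THEN spec, THEN mp, OF a] by simp
  qed
qed

text \<open>Squaring only doubles the logarithm, the factor \<open>8\<close> adds a constant, and
  replacing \<open>\<epsilon>\<close> by \<open>\<epsilon> / 5\<close> enlarges the denominator by
  at most \<open>5 powr s\<close>. The added constant is negligible because positive exponents make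
  the denominator tend to infinity.\<close>

lemma ALG_WT_quadratic:
  assumes WT: "ALG_WT s t N1" and s: "s > 0" and t: "t > 0"
    and le: "\<And>\<epsilon> d. d \<ge> 1 \<Longrightarrow> \<epsilon> > 0 \<Longrightarrow> N2 \<epsilon> d \<le> 8 * (N1 (\<epsilon> / 5) d)\<^sup>2"
  shows "ALG_WT s t N2"
  unfolding ALG_WT_def
proof (intro allI impI)
  fix \<eta> :: real assume \<eta>: "\<eta> > 0"
  define c where "c = (5::real) powr s"
  have c: "c \<ge> 1" using s by (simp add: c_def ge_one_powr_ge_zero)
  \<comment> \<open>The factor \<open>c\<close> pays for the rescaled accuracy; the remaining
    \<open>\<eta> / 4\<close> doubles to \<open>\<eta> / 2\<close> under squaring and leaves
    \<open>\<eta> / 2\<close> for \<open>ln 8\<close>.\<close>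
  have "\<eta> / (4 * c) > 0" using \<eta> c by simp
  from WT[unfolded ALG_WT_def, THEN spec, THEN mp, OF this] obtain M1
    where M1: "\<forall>d \<epsilon>. 1 \<le> d \<and> 0 < \<epsilon> \<and> \<epsilon> < 1 \<and> M1 < 1 / \<epsilon> + real d \<longrightarrow>
      ln (max 1 (real (N1 \<epsilon> d))) / (\<epsilon> powr (-s) + real d powr t) < \<eta> / (4 * c)" ..
  define B where "B = 2 * ln 8 / \<eta>"
  have B: "B > 0" using \<eta> by (simp add: B_def)
  \<comment> \<open>If \<open>1 / \<epsilon> + d\<close> exceeds \<open>M\<close>, one summand
    exceeds \<open>M / 2\<close>, and the corresponding power alone pushes the denominator beyond
    \<open>B\<close>.\<close>
  define M where "M = max M1 (2 * max (B powr (1 / s)) (B powr (1 / t)))"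
  show "\<exists>M. \<forall>d \<epsilon>. 1 \<le> d \<and> 0 < \<epsilon> \<and> \<epsilon> < 1 \<and> M < 1 / \<epsilon> + real d \<longrightarrow>
      ln (max 1 (real (N2 \<epsilon> d))) / (\<epsilon> powr (-s) + real d powr t) < \<eta>"
  proof (intro exI[of _ M] allI impI)
    fix d :: nat and \<epsilon> :: real assume "1 \<le> d \<and> 0 < \<epsilon> \<and> \<epsilon> < 1 \<and> M < 1 / \<epsilon> + real d"
    then have d: "d \<ge> 1" and \<epsilon>: "\<epsilon> > 0" "\<epsilon> < 1" and M: "1 / \<epsilon> + real d > M" by auto
    define R where "R = \<epsilon> powr (-s) + real d powr t"
    have inv: "\<epsilon> powr (-s) = (1 / \<epsilon>) powr s" using \<epsilon> by (simp add: powr_minus_divide powr_divide)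
    have R0: "R > 0" unfolding R_def using \<epsilon> by (intro add_pos_nonneg) auto
    have "B < R"
    proof (cases "1 / \<epsilon> > M / 2")
      case True
      then have "B powr (1 / s) < 1 / \<epsilon>" by (auto simp: M_def)
      then have "(B powr (1 / s)) powr s < (1 / \<epsilon>) powr s" using s by (intro powr_less_mono2) auto
      then have "B < \<epsilon> powr (-s)" using s B by (simp add: powr_powr inv)
      then show ?thesis using powr_ge_zero[of "real d" t] unfolding R_def by linarith
    next
      case False
      then have "real d > M / 2" using M by simp
      then have "B powr (1 / t) < real d" by (auto simp: M_def)
      then have "(B powr (1 / t)) powr t < real d powr t" using t by (intro powr_less_mono2) auto
      then have "B < real d powr t" using t B by (simp add: powr_powr)
      then show ?thesis using powr_ge_zero[of \<epsilon> "-s"] unfolding R_def by linarith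
    qed
    then have ln8: "ln 8 < \<eta> / 2 * R" using \<eta> by (simp add: B_def pos_divide_less_eq mult.commute)
    define q where "q = ln (max 1 (real (N1 (\<epsilon> / 5) d)))"
    have R5: "(\<epsilon> / 5) powr (-s) + real d powr t \<le> c * R"
    proof -
      have "(\<epsilon> / 5) powr (-s) = c * \<epsilon> powr (-s)"
        using \<epsilon> by (simp add: powr_divide c_def powr_minus_divide)
      moreover have "real d powr t \<le> c * real d powr t" using c by (simp add: mult_le_cancel_right1)
      ultimately show ?thesis by (simp add: R_def distrib_left)
    qed
    have "q / ((\<epsilon> / 5) powr (-s) + real d powr t) < \<eta> / (4 * c)"
      unfolding q_def
    proof (rule M1[THEN spec, THEN spec, THEN mp], intro conjI)
      have "1 / \<epsilon> \<le> 1 / (\<epsilon> / 5)" using \<epsilon> by (simp add: field_simps)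
      then show "1 / (\<epsilon> / 5) + real d > M1" using M by (simp add: M_def)
    qed (use d \<epsilon> in auto)
    then have "q < \<eta> / (4 * c) * ((\<epsilon> / 5) powr (-s) + real d powr t)"
      using \<epsilon> by (subst (asm) pos_divide_less_eq) (auto intro!: add_pos_nonneg)
    also have "\<dots> \<le> \<eta> / (4 * c) * (c * R)" using R5 \<eta> c by (intro mult_left_mono) auto
    also have "\<dots> = \<eta> / 4 * R" using c by simp
    finally have q: "q < \<eta> / 4 * R" .
    have "ln (max 1 (real (N2 \<epsilon> d))) \<le> ln (8 * (max 1 (real (N1 (\<epsilon> / 5) d)))\<^sup>2)"
    proof (rule ln_mono)
      have "1 \<le> (max 1 (real (N1 (\<epsilon> / 5) d)))\<^sup>2" by (simp add: one_le_power)
      moreover have "real (N2 \<epsilon> d) \<le> real (8 * (N1 (\<epsilon> / 5) d)\<^sup>2)"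
        using le[OF d \<epsilon>(1)] by (simp only: of_nat_le_iff)
      then have "real (N2 \<epsilon> d) \<le> 8 * (real (N1 (\<epsilon> / 5) d))\<^sup>2" by simp
      moreover have "(real (N1 (\<epsilon> / 5) d))\<^sup>2 \<le> (max 1 (real (N1 (\<epsilon> / 5) d)))\<^sup>2" by (intro power_mono) auto
      ultimately show "max 1 (real (N2 \<epsilon> d)) \<le> 8 * (max 1 (real (N1 (\<epsilon> / 5) d)))\<^sup>2" by linarith
    qed auto
    also have "\<dots> = ln 8 + 2 * q" unfolding q_def by (subst ln_mult) (auto simp: ln_realpow)
    also have "\<dots> < \<eta> * R" using ln8 q by simp
    finally show "ln (max 1 (real (N2 \<epsilon> d))) / (\<epsilon> powr (-s) + real d powr t) < \<eta>"
      using R0 unfolding R_def[symmetric] by (simp add: pos_divide_less_eq)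
  qed
qed

theorem theorem4p4:
  fixes D :: "nat \<Rightarrow> (nat \<Rightarrow> real) set"
    and \<rho> :: "nat \<Rightarrow> (nat \<Rightarrow> real) \<Rightarrow> real"
    and V :: "nat \<Rightarrow> 'f::{banach, second_countable_topology} set"
    and evl :: "nat \<Rightarrow> 'f \<Rightarrow> (nat \<Rightarrow> real) \<Rightarrow> real"
    and \<mu> :: "nat \<Rightarrow> 'f measure"
    and s t :: real
  assumes "avg_app_setting D \<rho> V evl \<mu>"
    and "s > 0" and "t > 0"
  shows "ALG_WT s t (n_abs D \<rho> evl \<mu> Lambda_all) \<longleftrightarrow>
         ALG_WT s t (n_abs D \<rho> evl \<mu> (Lambda_std D evl))"
proof
  assume "ALG_WT s t (n_abs D \<rho> evl \<mu> Lambda_all)"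
  then show "ALG_WT s t (n_abs D \<rho> evl \<mu> (Lambda_std D evl))"
    using assms(2,3) by (rule ALG_WT_quadratic) (rule n_abs_std_le_all[OF assms(1)])
next
  assume "ALG_WT s t (n_abs D \<rho> evl \<mu> (Lambda_std D evl))"
  then show "ALG_WT s t (n_abs D \<rho> evl \<mu> Lambda_all)"
    by (rule ALG_WT_mono) (rule n_abs_all_le_std[OF assms(1)])
qed

end
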